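(* Let $\Omega\subset\mathbb{R}$ be one of $\mathbb{R}$, $(-\infty,L_1)$, $(L_2,\infty)$, where $L_1,L_2\in\mathbb{R}$ are arbitrary, and let $m\ge 1$ be an integer. Let $v:\overline{\Omega}\to\mathbb{R}$ belong to $C^m(\overline{\Omega})$ and satisfy: (1) $|v'(y)|+|v''(y)|+\cdots+|v^{(m)}(y)|>0$ for all $y\in\overline{\Omega}$; (2) there exists $c_0>0$ such that $\liminf_{|y|\to\infty,\ y\in\Omega}|v'(y)|\ge c_0$. Then there exist constants $C>0$ and $c>0$ such that, for every $\nu>0$, every real $k\neq 0$ and every $g_0\in L^2(\Omega)$, the solution $g(k,\cdot)\in C^0([0,\infty),L^2(\Omega))$ of $$\partial_t g+\mathrm{i}k\,v(y)\,g=\nu\,\partial_y^2 g \quad (y\in\Omega,\ t>0),\qquad g(k,0)=g_0,$$ with homogeneous Neumann condition on $\partial\Omega$ (no condition if $\Omega=\mathbb{R}$), satisfies for all $t\ge 0$ $$\|g(k,t)\|_{L^2(\Omega)}\le C\,e^{-c\lambda_{\nu,k}t}\,\|g_0\|_{L^2(\Omega)},$$ where $$\lambda_{\nu,k}=\begin{cases}\nu^{\frac{m}{m+2}}|k|^{\frac{2}{m+2}}, & \text{if } 0<\nu\le|k|,\\[1ex] \dfrac{k^2}{\nu}, & \text{if } 0<|k|\le\nu.\end{cases}$$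
   Context: Functions in $L^2(\Omega)$ are complex-valued. $C^m(\overline{\Omega})$ means $m$ times continuously differentiable up to the boundary (one-sided derivatives at a finite endpoint); no boundedness of $v$ or its derivatives is required. The solution of the evolution equation is $g(k,t)=e^{-tH_{\nu,k}}g_0$, where $(e^{-tH_{\nu,k}})_{t\ge0}$ is the contraction semigroup on $L^2(\Omega)$ generated by $-H_{\nu,k}$, and $H_{\nu,k}=-\nu\partial_y^2+\mathrm{i}k v(y)$ is the m-accretive Neumann realization on $L^2(\Omega)$: $g\in D(H_{\nu,k})$ and $H_{\nu,k}g=h$ if and only if $g\in H^1(\Omega)$, $h\in L^2(\Omega)$ and $$\nu\int_\Omega g'\,\overline{\varphi'}\,dy+\mathrm{i}k\int_\Omega v\,g\,\overline{\varphi}\,dy=\int_\Omega h\,\overline{\varphi}\,dy$$ for all $\varphi\in H^1(\Omega)$ with bounded support (i.e. vanishing a.e. outside a bounded subset of $\Omega$). *)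

theory Defs
  imports "HOL-Analysis.Analysis"
begin

text \<open>
  Elements of \<open>L\<^sup>2(\<Omega>)\<close> are handled through representatives \<open>real \<Rightarrow> complex\<close>; only the values on
  \<open>\<Omega>\<close> matter, and equality in \<open>L\<^sup>2(\<Omega>)\<close> is equality almost everywhere on \<open>\<Omega>\<close>.
\<close>

definition L2 :: "real set \<Rightarrow> (real \<Rightarrow> complex) set" where
  "L2 \<Omega> = {f \<in> borel_measurable (lebesgue_on \<Omega>). integrable (lebesgue_on \<Omega>) (\<lambda>x. (cmod (f x))\<^sup>2)}"

definition L2_norm :: "real set \<Rightarrow> (real \<Rightarrow> complex) \<Rightarrow> real" where
  "L2_norm \<Omega> f = sqrt (LINT x|lebesgue_on \<Omega>. (cmod (f x))\<^sup>2)"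

text \<open>Taken relative to \<open>S\<close>, so derivatives are one-sided at a finite endpoint of \<open>S\<close>.\<close>

definition nth_deriv_on :: "real set \<Rightarrow> nat \<Rightarrow> (real \<Rightarrow> real) \<Rightarrow> real \<Rightarrow> real" where
  "nth_deriv_on S n f = ((\<lambda>u x. vector_derivative u (at x within S)) ^^ n) f"

definition C_on :: "nat \<Rightarrow> real set \<Rightarrow> (real \<Rightarrow> real) \<Rightarrow> bool" where
  "C_on m S f \<longleftrightarrow> (\<forall>j<m. nth_deriv_on S j f differentiable_on S) \<and>
                  continuous_on S (nth_deriv_on S m f)"

definition test_function :: "real set \<Rightarrow> (real \<Rightarrow> real) \<Rightarrow> bool" where
  "test_function \<Omega> \<phi> \<longleftrightarrow> (\<forall>n. (deriv ^^ n) \<phi> differentiable_on UNIV) \<and>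
     compact (closure {x. \<phi> x \<noteq> 0}) \<and> closure {x. \<phi> x \<noteq> 0} \<subseteq> \<Omega>"

text \<open>\<open>H1_deriv \<Omega> g g'\<close>: \<open>g\<close> belongs to \<open>H\<^sup>1(\<Omega>)\<close> and \<open>g'\<close> represents its weak derivative.\<close>

definition H1_deriv :: "real set \<Rightarrow> (real \<Rightarrow> complex) \<Rightarrow> (real \<Rightarrow> complex) \<Rightarrow> bool" where
  "H1_deriv \<Omega> g g' \<longleftrightarrow> g \<in> L2 \<Omega> \<and> g' \<in> L2 \<Omega> \<and>
     (\<forall>\<phi>. test_function \<Omega> \<phi> \<longrightarrow>
        (LINT x|lebesgue_on \<Omega>. deriv \<phi> x *\<^sub>R g x) = - (LINT x|lebesgue_on \<Omega>. \<phi> x *\<^sub>R g' x))"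

definition bounded_support :: "real set \<Rightarrow> (real \<Rightarrow> complex) \<Rightarrow> bool" where
  "bounded_support \<Omega> \<phi> \<longleftrightarrow> (\<exists>B. bounded B \<and> (AE x in lebesgue_on \<Omega>. x \<notin> B \<longrightarrow> \<phi> x = 0))"

text \<open>
  The graph of the Neumann realization \<open>H = -\<nu> \<partial>\<^sub>y\<^sup>2 + i k v(y)\<close>: \<open>neumann_op \<Omega> v \<nu> k g h\<close> means
  \<open>g \<in> D(H)\<close> and \<open>H g = h\<close>. The integrals converge absolutely when \<open>v\<close> is continuous on
  the closure of \<open>\<Omega>\<close>, because \<open>\<phi>\<close> has bounded support.
\<close>

definition neumann_op ::
  "real set \<Rightarrow> (real \<Rightarrow> real) \<Rightarrow> real \<Rightarrow> real \<Rightarrow> (real \<Rightarrow> complex) \<Rightarrow> (real \<Rightarrow> complex) \<Rightarrow> bool" where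
  "neumann_op \<Omega> v \<nu> k g h \<longleftrightarrow> h \<in> L2 \<Omega> \<and>
     (\<exists>g'. H1_deriv \<Omega> g g' \<and>
       (\<forall>\<phi> \<phi>'. H1_deriv \<Omega> \<phi> \<phi>' \<longrightarrow> bounded_support \<Omega> \<phi> \<longrightarrow>
          complex_of_real \<nu> * (LINT y|lebesgue_on \<Omega>. g' y * cnj (\<phi>' y))
          + \<i> * complex_of_real k * (LINT y|lebesgue_on \<Omega>. complex_of_real (v y) * g y * cnj (\<phi> y))
          = (LINT y|lebesgue_on \<Omega>. h y * cnj (\<phi> y))))"

text \<open>Strongly continuous semigroups of linear contractions on \<open>L\<^sup>2(\<Omega>)\<close>.\<close>

definition contraction_semigroup ::
  "real set \<Rightarrow> (real \<Rightarrow> (real \<Rightarrow> complex) \<Rightarrow> (real \<Rightarrow> complex)) \<Rightarrow> bool" where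
  "contraction_semigroup \<Omega> T \<longleftrightarrow>
     (\<forall>t\<ge>0. \<forall>f\<in>L2 \<Omega>. T t f \<in> L2 \<Omega> \<and> L2_norm \<Omega> (T t f) \<le> L2_norm \<Omega> f) \<and>
     (\<forall>t\<ge>0. \<forall>f\<in>L2 \<Omega>. \<forall>g\<in>L2 \<Omega>. \<forall>a b.
        AE x in lebesgue_on \<Omega>. T t (\<lambda>y. a * f y + b * g y) x = a * T t f x + b * T t g x) \<and>
     (\<forall>f\<in>L2 \<Omega>. AE x in lebesgue_on \<Omega>. T 0 f x = f x) \<and>
     (\<forall>s\<ge>0. \<forall>t\<ge>0. \<forall>f\<in>L2 \<Omega>. AE x in lebesgue_on \<Omega>. T (s + t) f x = T s (T t f) x) \<and>
     (\<forall>f\<in>L2 \<Omega>. ((\<lambda>t. L2_norm \<Omega> (\<lambda>x. T t f x - f x)) \<longlongrightarrow> 0) (at_right 0))"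

text \<open>The graph of the infinitesimal generator.\<close>

definition generator ::
  "real set \<Rightarrow> (real \<Rightarrow> (real \<Rightarrow> complex) \<Rightarrow> (real \<Rightarrow> complex)) \<Rightarrow>
   (real \<Rightarrow> complex) \<Rightarrow> (real \<Rightarrow> complex) \<Rightarrow> bool" where
  "generator \<Omega> T f h \<longleftrightarrow> f \<in> L2 \<Omega> \<and> h \<in> L2 \<Omega> \<and>
     ((\<lambda>t. L2_norm \<Omega> (\<lambda>x. (T t f x - f x) / complex_of_real t - h x)) \<longlongrightarrow> 0) (at_right 0)"

text \<open>
  \<open>T\<close> is \<open>(e\<^sup>-\<^sup>t\<^sup>H)\<close>, the contraction semigroup generated by \<open>-H\<close> with \<open>H\<close> the Neumann realization;
  it is unique up to equality almost everywhere.
\<close>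

definition neumann_semigroup ::
  "real set \<Rightarrow> (real \<Rightarrow> real) \<Rightarrow> real \<Rightarrow> real \<Rightarrow>
   (real \<Rightarrow> (real \<Rightarrow> complex) \<Rightarrow> (real \<Rightarrow> complex)) \<Rightarrow> bool" where
  "neumann_semigroup \<Omega> v \<nu> k T \<longleftrightarrow> contraction_semigroup \<Omega> T \<and>
     (\<forall>f h. generator \<Omega> T f h \<longleftrightarrow> neumann_op \<Omega> v \<nu> k f (\<lambda>x. - h x))"

definition decay_rate :: "nat \<Rightarrow> real \<Rightarrow> real \<Rightarrow> real" where
  "decay_rate m \<nu> k =
     (if \<nu> \<le> \<bar>k\<bar>
      then \<nu> powr (real m / real (m + 2)) * \<bar>k\<bar> powr (2 / real (m + 2))
      else k\<^sup>2 / \<nu>)"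

end

theory Submission
  imports Defs
begin

text \<open>
  The decay follows from the resolvent bound \<open>\<Psi> \<parallel>u\<parallel> \<le> \<parallel>H u + z u\<parallel>\<close> for \<open>Re z \<ge> 0\<close>, where \<open>\<Psi>\<close> is a
  small multiple of the decay rate. Put \<open>\<mu> = - Im z / k\<close>. By the nondegeneracy of \<open>v\<close> there is a
  set \<open>Z\<close>, of cardinality bounded independently of \<open>\<mu>\<close>, such that \<open>\<bar>v - \<mu>\<bar> \<ge> c \<delta>\<^sup>m\<close> at distance at least
  \<open>\<delta> \<le> 1\<close> from \<open>Z\<close>. Testing the equation with \<open>\<sigma> u\<close>, where \<open>\<sigma>\<close> has the sign of \<open>v - \<mu>\<close> and slope of order
  \<open>1 / \<delta>\<close>, controls \<open>u\<close> away from \<open>Z\<close>; near \<open>Z\<close> the bound \<open>\<bar>u\<bar>\<^sup>2 \<le> 2 \<parallel>u\<parallel> \<parallel>u'\<parallel>\<close> and the dissipation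
  \<open>\<nu> \<parallel>u'\<parallel>\<^sup>2 \<le> \<parallel>H u + z u\<parallel> \<parallel>u\<parallel>\<close> suffice. The choice \<open>\<delta> = (\<nu> / \<bar>k\<bar>)\<close> to the power \<open>1 / (m + 2)\<close>,
  or \<open>\<delta> = 1\<close> if \<open>\<nu> > \<bar>k\<bar>\<close>, balances all terms. A resolvent bound on a half plane gives exponential
  decay of the contraction semigroup by Plancherel in time, applied to an orbit cut off in time.
\<close>

section \<open>Exceptional sets of level sets\<close>

text \<open>The constants must not depend on Im z, which moves the level \<mu> over all reals, nor
  on \<nu> and k. Independence of \<mu> is a matter of counting: where a derivative of some order j
  \<ge> 1 stays away from zero, Rolle's theorem bounds the number of zeros of v - \<mu> and of the
  derivatives below order j without reference to \<mu>, and the lower bound on |v'| at infinity lets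
  finitely many such intervals cover \<Omega>. Independence of \<nu> and k comes from three
  conditions on the scale \<delta> and the rate \<rho>: \<delta>^2 \<rho> \<le> \<nu>, \<rho> \<le>
  |k| \<delta>^m and \<nu> \<rho> \<le> (|k| \<delta>^(m+1))^2. All three are equalities for
  \<delta>^(m+2) = \<nu> / |k| and \<rho> = |k| \<delta>^m. Neumann test functions are unconstrained
  at the boundary, so the multipliers can follow the sign of v - \<mu> up to it.\<close>

lemma continuous_nonzero_same_sign:
  fixes f :: "real \<Rightarrow> real"
  assumes "a \<le> b" "continuous_on {a..b} f" "\<And>x. x \<in> {a..b} \<Longrightarrow> f x \<noteq> 0"
  shows "f a * f b > 0"
proof (rule ccontr)
  assume "\<not> f a * f b > 0"
  then consider "f a \<le> 0" "0 \<le> f b" | "0 \<le> f a" "f b \<le> 0"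
    by (metis linorder_le_cases mult_neg_neg mult_pos_pos not_le)
  then show False
  proof cases
    case 1
    then show False using IVT'[of f a 0 b] assms by auto
  next
    case 2
    then show False using IVT2'[of f b 0 a] assms by auto
  qed
qed

lemma has_real_derivative_within_imp_at:
  fixes f :: "real \<Rightarrow> real"
  assumes "(f has_real_derivative d) (at x within I)" "{a<..<b} \<subseteq> I" "a < x" "x < b"
  shows "(f has_real_derivative d) (at x)"
proof -
  have "(f has_real_derivative d) (at x within {a<..<b})"
    by (rule DERIV_subset[OF assms(1,2)])
  then show ?thesis
    using assms(3,4) by (simp add: at_within_open[of x "{a<..<b}"])
qed

text \<open>Rolle's theorem puts a zero of \<open>f'\<close> strictly between consecutive zeros of
  \<open>f\<close>, and distinct gaps give distinct points. Arguing with finite subsets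
  \<open>A\<close> of the zero set yields finiteness together with the bound; \<open>nx\<close> is
  the successor within \<open>A\<close>, defined on all of \<open>A\<close> but its maximum.\<close>

lemma card_zeros_le_card_deriv_zeros:
  fixes f f' :: "real \<Rightarrow> real"
  assumes I: "convex I"
    and der: "\<And>x. x \<in> I \<Longrightarrow> (f has_real_derivative f' x) (at x within I)"
    and fin: "finite {x \<in> I. f' x = 0}" and card: "card {x \<in> I. f' x = 0} \<le> n"
  shows "finite {x \<in> I. f x = 0} \<and> card {x \<in> I. f x = 0} \<le> Suc n"
proof (rule finite_if_finite_subsets_card_bdd)
  fix A assume A: "A \<subseteq> {x \<in> I. f x = 0}" "finite A"
  show "card A \<le> Suc n"
  proof (cases "A = {}")
    case False
    define B where "B = A - {Max A}"
    define nx where "nx z = Min {w \<in> A. z < w}" for z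
    have nx: "nx z \<in> A" "z < nx z" "\<And>w. w \<in> A \<Longrightarrow> z < w \<Longrightarrow> nx z \<le> w" if "z \<in> B" for z
    proof -
      have "z < Max A" "Max A \<in> A"
        using that A False Max_in[of A] Max_ge[of A z] unfolding B_def by (auto simp: order_less_le)
      then have "{w \<in> A. z < w} \<noteq> {}" by blast
      then have "nx z \<in> {w \<in> A. z < w}"
        unfolding nx_def using A by (intro Min_in) auto
      then show "nx z \<in> A" "z < nx z" by auto
      show "nx z \<le> w" if "w \<in> A" "z < w" for w
        unfolding nx_def using A that by (intro Min_le) auto
    qed
    have "\<exists>p. z < p \<and> p < nx z \<and> p \<in> I \<and> f' p = 0" if z: "z \<in> B" for z
    proof -
      have zA: "z \<in> A" using z by (auto simp: B_def)
      have sub: "{z..nx z} \<subseteq> I"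
        using I A zA nx[OF z] by (metis (no_types, lifting) closed_segment_subset closed_segment_eq_real_ivl1 less_imp_le mem_Collect_eq subset_eq)
      have cont: "continuous_on {z..nx z} f"
        by (rule continuous_on_subset[OF _ sub]) (use der in \<open>auto intro!: DERIV_continuous_on\<close>)
      have "\<exists>p. z < p \<and> p < nx z \<and> (\<lambda>v. f' p * v) = (\<lambda>v. 0)"
      proof (rule Rolle_deriv)
        have "f z = 0" "f (nx z) = 0" using A zA nx(1)[OF z] by blast+
        then show "f z = f (nx z)" by simp
        show "(f has_derivative (*) (f' x)) (at x)" if "z < x" "x < nx z" for x
        proof -
          have "(f has_real_derivative f' x) (at x)"
            by (rule has_real_derivative_within_imp_at[OF der, of _ z "nx z"]) (use that sub in auto)
          then show ?thesis by (simp add: has_field_derivative_def)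
        qed
      qed (use nx[OF z] cont in auto)
      then obtain p where p: "z < p" "p < nx z" "(\<lambda>v. f' p * v) = (\<lambda>v. 0)" by blast
      have "f' p = 0" using fun_cong[OF p(3), of 1] by simp
      then show ?thesis using p sub by (intro exI[of _ p]) auto
    qed
    then obtain p where p: "\<And>z. z \<in> B \<Longrightarrow> z < p z \<and> p z < nx z \<and> p z \<in> I \<and> f' (p z) = 0"
      by metis
    have "inj_on p B"
    proof (rule inj_onI, rule ccontr)
      fix x y assume xy: "x \<in> B" "y \<in> B" "p x = p y" "x \<noteq> y"
      have *: "p x < p y" if "x < y" "x \<in> B" "y \<in> B" for x y
        using p[OF that(2)] p[OF that(3)] nx(3)[OF that(2), of y] that by (force simp: B_def)
      show False using *[of x y] *[of y x] xy by force
    qed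
    then have "card B \<le> card {x \<in> I. f' x = 0}"
      by (rule card_inj_on_le) (use p fin in auto)
    moreover have "card A = Suc (card B)"
      unfolding B_def using A False by (metis Max_in card_Suc_Diff1)
    ultimately show ?thesis using card by simp
  qed simp
qed

text \<open>Rolle's theorem iterated from the top: \<open>D j\<close> has no zero, and each step
  down in order adds at most one. The induction shifts the whole family, so \<open>D\<close> has to
  be generalised.\<close>

lemma card_zeros_le_order:
  fixes D :: "nat \<Rightarrow> real \<Rightarrow> real"
  assumes I: "convex I"
    and "\<And>i x. i < j \<Longrightarrow> x \<in> I \<Longrightarrow> (D i has_real_derivative D (Suc i) x) (at x within I)"
    and "\<And>x. x \<in> I \<Longrightarrow> D j x \<noteq> 0"
  shows "finite {x \<in> I. D 0 x = 0} \<and> card {x \<in> I. D 0 x = 0} \<le> j"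
  using assms(2,3)
proof (induction j arbitrary: D)
  case 0
  then have "{x \<in> I. D 0 x = 0} = {}" by auto
  then show ?case by (metis card.empty finite.emptyI order_refl)
next
  case (Suc j)
  have "finite {x \<in> I. D (Suc 0) x = 0} \<and> card {x \<in> I. D (Suc 0) x = 0} \<le> j"
    by (rule Suc.IH[of "\<lambda>i. D (Suc i)"]) (use Suc.prems in auto)
  then show ?case
    using card_zeros_le_card_deriv_zeros[OF I, of "D 0" "D (Suc 0)" j] Suc.prems(1)[of 0] by auto
qed

text \<open>Away from the zeros of all lower derivatives both \<open>D 0\<close> and \<open>D 1\<close> keep their sign near \<open>y\<close>, so the absolute
  value of \<open>D 0\<close> decreases on one of the two sides of \<open>y\<close>, and the mean value theorem on that side applies.\<close>

lemma abs_lower_bound_off_deriv_zeros: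
  fixes D :: "nat \<Rightarrow> real \<Rightarrow> real"
  assumes "\<And>i x. i < j \<Longrightarrow> x \<in> I \<Longrightarrow> (D i has_real_derivative D (Suc i) x) (at x within I)"
    and "continuous_on I (D j)"
    and "\<And>x. x \<in> I \<Longrightarrow> c \<le> \<bar>D j x\<bar>" and c: "c > 0"
    and "ball y \<delta> \<subseteq> I" "\<delta> > 0"
    and "\<And>i x. i < j \<Longrightarrow> x \<in> ball y \<delta> \<Longrightarrow> D i x \<noteq> 0"
  shows "c * (\<delta> / 2 ^ j) ^ j \<le> \<bar>D 0 y\<bar>"
  using assms(1-3,5-)
proof (induction j arbitrary: D y \<delta>)
  case 0
  have "y \<in> I" using 0(4,5) by auto
  then show ?case using 0(3) by simp
next
  case (Suc j)
  \<comment> \<open>Halving leaves a ball of radius \<open>r\<close> around every point of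
    [y - r, y + r] inside the original ball. The induction hypothesis for the shifted family
    therefore bounds |D 1| below on that whole interval; the powers of 2 in the statement are a
    generous record of these halvings.\<close>
  define r where "r = \<delta> / 2"
  have r: "r > 0" "{y - r..y + r} \<subseteq> ball y \<delta>"
    using Suc.prems(5) by (auto simp: r_def dist_real_def)
  define K where "K = c * (r / 2 ^ j) ^ j"
  have K: "K > 0" using c r by (simp add: K_def)
  have low: "K \<le> \<bar>D 1 s\<bar>" if s: "s \<in> {y - r..y + r}" for s
  proof -
    have sub: "ball s r \<subseteq> ball y \<delta>"
    proof
      fix x assume "x \<in> ball s r"
      then show "x \<in> ball y \<delta>"
        using s unfolding r_def mem_ball dist_real_def atLeastAtMost_iff by linarith
    qed
    show ?thesis
      unfolding K_def One_nat_def
      by (rule Suc.IH[of "\<lambda>i. D (Suc i)"])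
        (use Suc.prems sub r in \<open>auto simp: subset_iff\<close>)
  qed
  have cont: "continuous_on I (D i)" if "i \<le> Suc j" for i
    using Suc.prems(1)[of i] Suc.prems(2) that
    by (cases "i = Suc j") (auto intro!: DERIV_continuous_on)
  have sub: "{y - r..y + r} \<subseteq> I" using r Suc.prems(4) by blast
  have der: "(D 0 has_real_derivative D 1 x) (at x)" if "y - r < x" "x < y + r" for x
    by (rule has_real_derivative_within_imp_at[of _ _ _ I "y - r" "y + r"])
      (use Suc.prems(1)[of 0] that sub in \<open>auto simp: subset_iff\<close>)
  have c0: "continuous_on {a..b} (D i)" if "y - r \<le> a" "b \<le> y + r" "i \<le> Suc j" for a b i
    by (rule continuous_on_subset[OF cont[OF that(3)]]) (use that sub in auto)
  have diff: "D 0 differentiable (at x)" if "y - r < x" "x < y + r" for x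
    using der[OF that] real_differentiable_def by blast
  obtain x1 where x1: "y - r < x1" "x1 < y" "D 0 y - D 0 (y - r) = r * D 1 x1"
  proof -
    have "\<exists>l z. y - r < z \<and> z < y \<and> (D 0 has_real_derivative l) (at z) \<and> D 0 y - D 0 (y - r) = (y - (y - r)) * l"
      by (rule MVT) (use r(1) in \<open>auto intro!: c0 diff\<close>)
    then obtain l z where "y - r < z" "z < y" "(D 0 has_real_derivative l) (at z)" "D 0 y - D 0 (y - r) = r * l" by auto
    moreover from this have "l = D 1 z" using der[of z] DERIV_unique r by fastforce
    ultimately show ?thesis using that by auto
  qed
  obtain x2 where x2: "y < x2" "x2 < y + r" "D 0 (y + r) - D 0 y = r * D 1 x2"
  proof -
    have "\<exists>l z. y < z \<and> z < y + r \<and> (D 0 has_real_derivative l) (at z) \<and> D 0 (y + r) - D 0 y = (y + r - y) * l"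
      by (rule MVT) (use r(1) in \<open>auto intro!: c0 diff\<close>)
    then obtain l z where "y < z" "z < y + r" "(D 0 has_real_derivative l) (at z)" "D 0 (y + r) - D 0 y = r * l" by auto
    moreover from this have "l = D 1 z" using der[of z] DERIV_unique r by fastforce
    ultimately show ?thesis using that by auto
  qed
  have nz: "D 0 s \<noteq> 0" if "s \<in> {y - r..y + r}" for s
    using Suc.prems(6)[of 0 s] that r by blast
  have same: "D 0 a * D 0 b > 0" if "y - r \<le> a" "a \<le> b" "b \<le> y + r" for a b
    by (rule continuous_nonzero_same_sign) (use that nz in \<open>auto intro!: c0\<close>)
  have s0: "D 0 (y - r) * D 0 y > 0" "D 0 y * D 0 (y + r) > 0"
    using same[of "y - r" y] same[of y "y + r"] r(1) by auto
  have s1: "D 1 x1 * D 1 x2 > 0"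
  proof (rule continuous_nonzero_same_sign[where f="D 1"])
    show "continuous_on {x1..x2} (D 1)" using c0[of x1 x2 1] x1 x2 by auto
    show "D 1 x \<noteq> 0" if "x \<in> {x1..x2}" for x
      using low[of x] K that x1 x2 by auto
  qed (use x1 x2 in auto)
  have k1: "r * K \<le> \<bar>r * D 1 x1\<bar>" "r * K \<le> \<bar>r * D 1 x2\<bar>"
    using low[of x1] low[of x2] x1 x2 r by (auto simp: abs_mult)
  have sgn: "r * D 1 x1 * (r * D 1 x2) > 0"
    using s1 r(1) by (auto simp: zero_less_mult_iff mult_less_0_iff)
  have "r * K \<le> \<bar>D 0 y\<bar>"
  proof (cases "r * D 1 x1 > 0")
    case True
    then have "r * D 1 x2 > 0" using sgn by (rule zero_less_mult_pos[rotated])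
    then show ?thesis
      using True s0 k1 x1(3) x2(3) unfolding zero_less_mult_iff[of "D 0 _"] by linarith
  next
    case False
    then have "r * D 1 x1 < 0" "r * D 1 x2 < 0"
      using zero_less_mult_iff[THEN iffD1, OF sgn] by blast+
    then show ?thesis
      using s0 k1 x1(3) x2(3) unfolding zero_less_mult_iff[of "D 0 _"] by linarith
  qed
  moreover have "c * (\<delta> / 2 ^ Suc j) ^ Suc j \<le> r * K"
  proof -
    have "\<delta> / 2 ^ Suc j = r / 2 ^ j" by (simp add: r_def)
    then have "c * (\<delta> / 2 ^ Suc j) ^ Suc j = (r / 2 ^ j) * K" by (simp add: K_def)
    also have "\<dots> \<le> r * K"
      using K r by (intro mult_right_mono) (auto simp: field_simps)
    finally show ?thesis .
  qed
  ultimately show ?case by linarith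
qed

text \<open>Each of the \<open>j\<close> functions below order \<open>j\<close> has at most
  \<open>j\<close> zeros by iterated Rolle, which explains \<open>j * j\<close>. With all of these
  zeros collected in \<open>Z\<close>, every lower derivative keeps its sign on a ball that misses
  \<open>Z\<close>, as the pointwise lower bound requires.\<close>

lemma exceptional_set_on_interval:
  fixes D :: "nat \<Rightarrow> real \<Rightarrow> real"
  assumes I: "convex I"
    and der: "\<And>i x. i < j \<Longrightarrow> x \<in> I \<Longrightarrow> (D i has_real_derivative D (Suc i) x) (at x within I)"
    and cont: "continuous_on I (D j)"
    and low: "\<And>x. x \<in> I \<Longrightarrow> c \<le> \<bar>D j x\<bar>" and c: "c > 0"
  obtains Z where "finite Z" "card Z \<le> j * j" "\<And>x. x \<in> I \<Longrightarrow> D 0 x = 0 \<Longrightarrow> x \<in> Z"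
    "\<And>\<delta> y. \<delta> > 0 \<Longrightarrow> ball y \<delta> \<subseteq> I \<Longrightarrow> ball y \<delta> \<inter> Z = {} \<Longrightarrow> c * (\<delta> / 2 ^ j) ^ j \<le> \<bar>D 0 y\<bar>"
proof
  define Z where "Z = (\<Union>i<j. {x \<in> I. D i x = 0})"
  have *: "finite {x \<in> I. D i x = 0} \<and> card {x \<in> I. D i x = 0} \<le> j" if "i < j" for i
    using card_zeros_le_order[OF I, of "j - i" "\<lambda>l. D (i + l)"] der low c that
    by (force simp del: abs_le_zero_iff)
  show "finite Z" unfolding Z_def using * by auto
  have "card Z \<le> (\<Sum>i<j. card {x \<in> I. D i x = 0})"
    unfolding Z_def by (rule card_UN_le) simp
  also have "\<dots> \<le> (\<Sum>i<j. j)" by (rule sum_mono) (use * in auto)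
  finally show "card Z \<le> j * j" by simp
  show "x \<in> Z" if "x \<in> I" "D 0 x = 0" for x
    using that low[of x] c unfolding Z_def by (cases "j = 0") auto
  show "c * (\<delta> / 2 ^ j) ^ j \<le> \<bar>D 0 y\<bar>"
    if "\<delta> > 0" "ball y \<delta> \<subseteq> I" "ball y \<delta> \<inter> Z = {}" for \<delta> y
  proof (rule abs_lower_bound_off_deriv_zeros[OF der cont low c that(2,1)])
    show "D i x \<noteq> 0" if "i < j" "x \<in> ball y \<delta>" for i x
      using that \<open>ball y \<delta> \<subseteq> I\<close> \<open>ball y \<delta> \<inter> Z = {}\<close> unfolding Z_def by blast
  qed
qed

text \<open>Subtracting \<mu> changes only \<open>D 0\<close>, while the nonvanishing derivative has
  order \<open>j \<ge> 1\<close>; hence neither the count nor the constant sees \<mu>. The frontier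
  points of \<open>I\<close> join \<open>Z\<close> so that a ball with centre in \<open>I\<close>
  and away from \<open>Z\<close> stays inside \<open>I\<close>. The restriction \<delta> \<le> 1
  allows the common exponent \<open>m\<close> in place of \<open>j\<close>, and
  \<open>2 ^ (m * m)\<close> dominates \<open>2 ^ (j * j)\<close>.\<close>

lemma exceptional_set_uniform:
  fixes D :: "nat \<Rightarrow> real \<Rightarrow> real"
  assumes der: "\<And>i x. i < m \<Longrightarrow> x \<in> S \<Longrightarrow> (D i has_real_derivative D (Suc i) x) (at x within S)"
    and cont: "continuous_on S (D m)"
    and I: "convex I" "I \<subseteq> S" "finite (frontier I)"
    and j: "1 \<le> j" "j \<le> m" and low: "\<And>x. x \<in> I \<Longrightarrow> c \<le> \<bar>D j x\<bar>" and c: "c > 0"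
  shows "\<exists>a>0. \<forall>\<mu>. \<exists>Z. finite Z \<and> card Z \<le> m * m + card (frontier I) \<and>
           (\<forall>x\<in>I. D 0 x = \<mu> \<longrightarrow> x \<in> Z) \<and>
           (\<forall>\<delta> y. 0 < \<delta> \<longrightarrow> \<delta> \<le> 1 \<longrightarrow> y \<in> I \<longrightarrow> (\<forall>z\<in>Z. \<delta> \<le> \<bar>y - z\<bar>) \<longrightarrow> a * \<delta> ^ m \<le> \<bar>D 0 y - \<mu>\<bar>)"
proof -
  define a where "a = c / 2 ^ (m * m)"
  have a0: "a > 0" using c by (simp add: a_def)
  define Q where "Q \<mu> Z \<longleftrightarrow> finite Z \<and> card Z \<le> m * m + card (frontier I) \<and>
           (\<forall>x\<in>I. D 0 x = \<mu> \<longrightarrow> x \<in> Z) \<and>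
           (\<forall>\<delta> y. 0 < \<delta> \<longrightarrow> \<delta> \<le> 1 \<longrightarrow> y \<in> I \<longrightarrow> (\<forall>z\<in>Z. \<delta> \<le> \<bar>y - z\<bar>) \<longrightarrow> a * \<delta> ^ m \<le> \<bar>D 0 y - \<mu>\<bar>)" for \<mu> Z
  have "\<exists>Z. Q \<mu> Z" for \<mu>
  proof -
    define E where "E i x = (if i = 0 then D 0 x - \<mu> else D i x)" for i x
    have derE: "(E i has_real_derivative E (Suc i) x) (at x within I)" if "i < j" "x \<in> I" for i x
    proof -
      have "(D i has_real_derivative D (Suc i) x) (at x within I)"
        by (rule DERIV_subset[OF der I(2)]) (use that j I in auto)
      then show ?thesis unfolding E_def by (cases "i = 0") (auto intro!: derivative_eq_intros)
    qed
    have contE: "continuous_on I (E j)"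
    proof -
      have "continuous_on S (D j)"
        using der[of j] cont j by (cases "j = m") (auto intro!: DERIV_continuous_on)
      then show ?thesis using j I continuous_on_subset by (auto simp: E_def)
    qed
    obtain Z where Z: "finite Z" "card Z \<le> j * j" "\<And>x. x \<in> I \<Longrightarrow> E 0 x = 0 \<Longrightarrow> x \<in> Z"
      "\<And>\<delta> y. \<delta> > 0 \<Longrightarrow> ball y \<delta> \<subseteq> I \<Longrightarrow> ball y \<delta> \<inter> Z = {} \<Longrightarrow> c * (\<delta> / 2 ^ j) ^ j \<le> \<bar>E 0 y\<bar>"
      by (rule exceptional_set_on_interval[OF I(1) derE contE _ c]) (use low j in \<open>auto simp: E_def\<close>)
    have "Q \<mu> (Z \<union> frontier I)"
      unfolding Q_def
    proof (intro conjI allI)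
      show "finite (Z \<union> frontier I)" using Z I by auto
      have "card (Z \<union> frontier I) \<le> card Z + card (frontier I)" by (rule card_Un_le)
      also have "\<dots> \<le> m * m + card (frontier I)" using Z(2) mult_le_mono[OF j(2) j(2)] by linarith
      finally show "card (Z \<union> frontier I) \<le> m * m + card (frontier I)" .
      show "\<forall>x\<in>I. D 0 x = \<mu> \<longrightarrow> x \<in> Z \<union> frontier I" using Z(3) by (auto simp: E_def)
      show "0 < \<delta> \<longrightarrow> \<delta> \<le> 1 \<longrightarrow> y \<in> I \<longrightarrow> (\<forall>z\<in>Z \<union> frontier I. \<delta> \<le> \<bar>y - z\<bar>) \<longrightarrow> a * \<delta> ^ m \<le> \<bar>D 0 y - \<mu>\<bar>" for \<delta> y
      proof (intro impI)
        assume \<delta>: "0 < \<delta>" "\<delta> \<le> 1" and y: "y \<in> I" and far: "\<forall>z\<in>Z \<union> frontier I. \<delta> \<le> \<bar>y - z\<bar>"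
        have disj: "ball y \<delta> \<inter> (Z \<union> frontier I) = {}"
          using far by (force simp: dist_real_def abs_minus_commute)
        have "ball y \<delta> \<inter> I \<noteq> {}" "ball y \<delta> \<inter> frontier I = {}"
          using disj y \<delta> by (auto intro: centre_in_ball[THEN iffD2])
        then have "ball y \<delta> \<subseteq> I"
          using connected_Int_frontier[of "ball y \<delta>" I] by (meson Diff_eq_empty_iff connected_ball)
        then have *: "c * (\<delta> / 2 ^ j) ^ j \<le> \<bar>E 0 y\<bar>"
          using Z(4) \<delta> disj by auto
        have "a * \<delta> ^ m \<le> c / 2 ^ (j * j) * \<delta> ^ j"
          unfolding a_def using c \<delta> j
          by (intro mult_mono power_decreasing divide_left_mono power_increasing) (auto intro: mult_le_mono)
        also have "\<dots> = c * (\<delta> / 2 ^ j) ^ j" by (simp add: power_divide power_mult)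
        finally show "a * \<delta> ^ m \<le> \<bar>D 0 y - \<mu>\<bar>" using * by (simp add: E_def)
      qed
    qed
    then show ?thesis ..
  qed
  then show ?thesis using a0 unfolding Q_def by blast
qed

text \<open>Near infinity the order is 1, by the tail hypothesis. On the compact rest every point
  has a neighbourhood in which one derivative keeps at least half of its modulus at that point, and
  finitely many such neighbourhoods suffice. \<open>N\<close> adds up the counts of the pieces, and
  \<open>c\<close> lies below all of their constants.\<close>

lemma level_set_exceptional_points:
  fixes D :: "nat \<Rightarrow> real \<Rightarrow> real"
  assumes \<Omega>: "open \<Omega>" "convex \<Omega>" "finite (frontier \<Omega>)" and m: "m \<ge> 1"
    and der: "\<And>i x. i < m \<Longrightarrow> x \<in> closure \<Omega> \<Longrightarrow> (D i has_real_derivative D (Suc i) x) (at x within closure \<Omega>)"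
    and cont: "continuous_on (closure \<Omega>) (D m)"
    and pos: "\<And>y. y \<in> closure \<Omega> \<Longrightarrow> \<exists>j\<in>{1..m}. D j y \<noteq> 0"
    and tail: "c\<^sub>0 > 0" "\<And>y. y \<in> \<Omega> \<Longrightarrow> R \<le> \<bar>y\<bar> \<Longrightarrow> c\<^sub>0 \<le> \<bar>D 1 y\<bar>"
  shows "\<exists>N c. c > 0 \<and> (\<forall>\<mu>. \<exists>Z. finite Z \<and> card Z \<le> N \<and> (\<forall>x\<in>\<Omega>. D 0 x = \<mu> \<longrightarrow> x \<in> Z) \<and>
           (\<forall>\<delta> y. 0 < \<delta> \<longrightarrow> \<delta> \<le> 1 \<longrightarrow> y \<in> \<Omega> \<longrightarrow> (\<forall>z\<in>Z. \<delta> \<le> \<bar>y - z\<bar>) \<longrightarrow> c * \<delta> ^ m \<le> \<bar>D 0 y - \<mu>\<bar>))"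
proof -
  define good where "good I \<longleftrightarrow> convex I \<and> I \<subseteq> closure \<Omega> \<and> finite (frontier I) \<and>
     (\<exists>j c. 1 \<le> j \<and> j \<le> m \<and> 0 < c \<and> (\<forall>x\<in>I. c \<le> \<bar>D j x\<bar>))" for I
  have sub: "\<Omega> \<subseteq> closure \<Omega>" by (rule closure_subset)
  have fr: "finite (frontier (A \<inter> B))" if "finite (frontier A)" "finite (frontier B)" for A B :: "real set"
    using frontier_Int_subset[of A B] that by (meson finite_UnI finite_subset)
  have "\<exists>r>0. good (ball y r \<inter> \<Omega>)" if y: "y \<in> closure \<Omega>" for y
  proof -
    obtain j where j: "j \<in> {1..m}" "D j y \<noteq> 0" using pos[OF y] by auto
    have cj: "continuous_on (closure \<Omega>) (D j)"
      using der[of j] cont j by (cases "j = m") (auto intro!: DERIV_continuous_on)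
    then obtain r where r: "r > 0" "\<And>x. x \<in> closure \<Omega> \<Longrightarrow> dist x y < r \<Longrightarrow> dist (D j x) (D j y) < \<bar>D j y\<bar> / 2"
      using y j unfolding continuous_on_iff by (metis half_gt_zero zero_less_abs_iff)
    have "\<forall>x\<in>ball y r \<inter> \<Omega>. \<bar>D j y\<bar> / 2 \<le> \<bar>D j x\<bar>"
    proof
      fix x assume "x \<in> ball y r \<inter> \<Omega>"
      then have "dist (D j x) (D j y) < \<bar>D j y\<bar> / 2" using r(2)[of x] sub by (auto simp: dist_commute)
      then show "\<bar>D j y\<bar> / 2 \<le> \<bar>D j x\<bar>" unfolding dist_real_def by linarith
    qed
    moreover have "finite (frontier (ball y r))"
      using r(1) by (simp add: sphere_def dist_real_def)
        (rule finite_subset[of _ "{y - r, y + r}"], auto)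
    ultimately have "good (ball y r \<inter> \<Omega>)"
      unfolding good_def using \<Omega> j sub by (intro conjI convex_Int fr exI[of _ j] exI[of _ "\<bar>D j y\<bar> / 2"]) auto
    then show ?thesis using r(1) by blast
  qed
  then obtain r where r: "\<And>y. y \<in> closure \<Omega> \<Longrightarrow> r y > 0 \<and> good (ball y (r y) \<inter> \<Omega>)" by metis
  define K where "K = closure \<Omega> \<inter> cball 0 \<bar>R\<bar>"
  have "compact K" unfolding K_def by (intro closed_Int_compact) auto
  then obtain F where F: "finite F" "F \<subseteq> K" "K \<subseteq> (\<Union>y\<in>F. ball y (r y))"
    using compactE_image[of K K "\<lambda>y. ball y (r y)"] r unfolding K_def by force
  have good1: "good ({\<bar>R\<bar><..} \<inter> \<Omega>)" "good ({..<-\<bar>R\<bar>} \<inter> \<Omega>)"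
    unfolding good_def using \<Omega> sub m tail
    by (intro conjI convex_Int fr exI[of _ 1] exI[of _ c\<^sub>0]; auto intro: convex_real_interval)+
  define \<I> where "\<I> = insert ({\<bar>R\<bar><..} \<inter> \<Omega>) (insert ({..<-\<bar>R\<bar>} \<inter> \<Omega>) ((\<lambda>y. ball y (r y) \<inter> \<Omega>) ` F))"
  have \<I>: "finite \<I>" "\<And>I. I \<in> \<I> \<Longrightarrow> good I"
    unfolding \<I>_def using F r good1 by (auto simp: K_def)
  have cover: "\<exists>I\<in>\<I>. y \<in> I" if y: "y \<in> \<Omega>" for y
  proof -
    consider "y > \<bar>R\<bar>" | "y < - \<bar>R\<bar>" | "y \<in> K"
      using y sub unfolding K_def by (fastforce simp: dist_real_def)
    then show ?thesis using y F(3) unfolding \<I>_def by cases auto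
  qed
  define P where "P I a \<mu> Z \<longleftrightarrow> finite Z \<and> card Z \<le> m * m + card (frontier I) \<and>
           (\<forall>x\<in>I. D 0 x = \<mu> \<longrightarrow> x \<in> Z) \<and>
           (\<forall>\<delta> y. 0 < \<delta> \<longrightarrow> \<delta> \<le> 1 \<longrightarrow> y \<in> I \<longrightarrow> (\<forall>z\<in>Z. \<delta> \<le> \<bar>y - z\<bar>) \<longrightarrow> a * \<delta> ^ m \<le> \<bar>D 0 y - \<mu>\<bar>)"
    for I a \<mu> Z
  have "\<exists>a>0. \<forall>\<mu>. \<exists>Z. P I a \<mu> Z" if I: "I \<in> \<I>" for I
  proof -
    obtain j c where jc: "1 \<le> j" "j \<le> m" "0 < c" "\<forall>x\<in>I. c \<le> \<bar>D j x\<bar>" "convex I" "I \<subseteq> closure \<Omega>" "finite (frontier I)"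
      using \<I>(2)[OF I] unfolding good_def by blast
    show ?thesis unfolding P_def
      by (rule exceptional_set_uniform[where S="closure \<Omega>" and j=j and c=c]) (use jc der cont in auto)
  qed
  then obtain a where a: "\<And>I. I \<in> \<I> \<Longrightarrow> a I > 0" "\<And>I \<mu>. I \<in> \<I> \<Longrightarrow> \<exists>Z. P I (a I) \<mu> Z"
    by metis
  define c where "c = Min (insert 1 (a ` \<I>))"
  have c: "c > 0" "\<And>I. I \<in> \<I> \<Longrightarrow> c \<le> a I"
    unfolding c_def using \<I>(1) a(1) by (auto simp: Min_gr_iff)
  define N where "N = (\<Sum>I\<in>\<I>. m * m + card (frontier I))"
  show ?thesis
  proof (intro exI[of _ N] exI[of _ c] conjI allI)
    fix \<mu>
    have "\<forall>I\<in>\<I>. \<exists>Z. P I (a I) \<mu> Z" using a(2) by blast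
    then obtain Z where Z: "\<And>I. I \<in> \<I> \<Longrightarrow> P I (a I) \<mu> (Z I)" using bchoice by meson
    show "\<exists>Z. finite Z \<and> card Z \<le> N \<and> (\<forall>x\<in>\<Omega>. D 0 x = \<mu> \<longrightarrow> x \<in> Z) \<and>
           (\<forall>\<delta> y. 0 < \<delta> \<longrightarrow> \<delta> \<le> 1 \<longrightarrow> y \<in> \<Omega> \<longrightarrow> (\<forall>z\<in>Z. \<delta> \<le> \<bar>y - z\<bar>) \<longrightarrow> c * \<delta> ^ m \<le> \<bar>D 0 y - \<mu>\<bar>)"
    proof (intro exI[of _ "\<Union>(Z ` \<I>)"] conjI ballI allI impI)
      show "finite (\<Union>(Z ` \<I>))" using \<I>(1) Z by (auto simp: P_def)
      have "card (\<Union>(Z ` \<I>)) \<le> (\<Sum>I\<in>\<I>. card (Z I))" by (rule card_UN_le[OF \<I>(1)])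
      also have "\<dots> \<le> N" unfolding N_def by (rule sum_mono) (use Z in \<open>auto simp: P_def\<close>)
      finally show "card (\<Union>(Z ` \<I>)) \<le> N" .
      show "x \<in> \<Union>(Z ` \<I>)" if "x \<in> \<Omega>" "D 0 x = \<mu>" for x
        using cover[OF that(1)] Z that(2) unfolding P_def by blast
      show "c * \<delta> ^ m \<le> \<bar>D 0 y - \<mu>\<bar>"
        if \<delta>: "0 < \<delta>" "\<delta> \<le> 1" "y \<in> \<Omega>" "\<forall>z\<in>\<Union>(Z ` \<I>). \<delta> \<le> \<bar>y - z\<bar>" for \<delta> y
      proof -
        obtain I where I: "I \<in> \<I>" "y \<in> I" using cover[OF \<delta>(3)] by auto
        have "c * \<delta> ^ m \<le> a I * \<delta> ^ m" using c(2)[OF I(1)] \<delta> by (intro mult_right_mono) auto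
        also have "\<dots> \<le> \<bar>D 0 y - \<mu>\<bar>" using Z[OF I(1)] \<delta> I unfolding P_def by blast
        finally show ?thesis .
      qed
    qed
  qed (use c in auto)
qed

text \<open>The domain \<open>S\<close> is an arbitrary set so that the induction can remove a point of \<open>Z\<close> from it.\<close>

lemma sign_pattern_product:
  fixes w :: "real \<Rightarrow> real"
  assumes "finite Z"
    and "\<And>x y. x \<in> S \<Longrightarrow> y \<in> S \<Longrightarrow> x \<le> y \<Longrightarrow> {x..y} \<inter> Z = {} \<Longrightarrow> w x * w y > 0"
  shows "\<exists>Z'\<subseteq>Z. \<exists>s\<in>{-1, 1}. \<forall>y\<in>S - Z. s * (\<Prod>z\<in>Z'. y - z) * w y > 0"
  using assms
proof (induction Z arbitrary: S w)
  case empty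
  show ?case
  proof (cases "S = {}")
    case False
    then obtain x where x: "x \<in> S" by auto
    have "sgn (w x) * w y > 0" if "y \<in> S" for y
    proof -
      have "w x * w y > 0"
        using empty.prems[of x y] empty.prems[of y x] that x by (cases "x \<le> y") (auto simp: mult.commute)
      then show ?thesis by (auto simp: sgn_real_def zero_less_mult_iff)
    qed
    moreover have "sgn (w x) \<in> {-1, 1}"
      using empty.prems[of x x] x by (auto simp: sgn_real_def)
    ultimately show ?thesis by (intro exI[of _ "{}"] conjI bexI[of _ "sgn (w x)"]) auto
  qed auto
next
  case (insert z Z)
  \<comment> \<open>\<open>bad\<close> says that \<open>w\<close> changes sign across
    \<open>z\<close> between two points that no other element of \<open>Z\<close> separates. Exactly
    in this case \<open>z\<close> becomes a factor of the product, and multiplying \<open>w\<close>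
    by \<open>y - z\<close> undoes the flip before the induction hypothesis is applied.\<close>
  define bad where "bad \<longleftrightarrow> (\<exists>x\<in>S. \<exists>y\<in>S. x < z \<and> z < y \<and> {x..y} \<inter> Z = {} \<and> w x * w y < 0)"
  have nz: "w x \<noteq> 0" if "x \<in> S" "x \<notin> insert z Z" for x
    using insert.prems[of x x] that by auto
  show ?case
  proof (cases bad)
    case False
    have "w x * w y > 0" if xy: "x \<in> S - {z}" "y \<in> S - {z}" "x \<le> y" "{x..y} \<inter> Z = {}" for x y
    proof (cases "x < z \<and> z < y")
      case True
      have "x \<notin> Z" "y \<notin> Z" using xy by auto
      then have "w x * w y \<noteq> 0" using nz[of x] nz[of y] xy by auto
      then show ?thesis using False xy True unfolding bad_def by fastforce
    next
      case False
      then show ?thesis using xy by (intro insert.prems) auto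
    qed
    from insert.IH[of "S - {z}" w, OF this] obtain Z' s where
      "Z' \<subseteq> Z" "s \<in> {-1, 1}" "\<forall>y\<in>S - {z} - Z. s * (\<Prod>z\<in>Z'. y - z) * w y > 0" by blast
    then show ?thesis by (intro exI[of _ Z'] conjI bexI[of _ s]) auto
  next
    case True
    then obtain x0 y0 where b: "x0 \<in> S" "y0 \<in> S" "x0 < z" "z < y0" "{x0..y0} \<inter> Z = {}" "w x0 * w y0 < 0"
      unfolding bad_def by auto
    define w1 where "w1 y = (y - z) * w y" for y
    have "w1 x * w1 y > 0" if xy: "x \<in> S - {z}" "y \<in> S - {z}" "x \<le> y" "{x..y} \<inter> Z = {}" for x y
    proof (cases "x < z \<and> z < y")
      case True
      \<comment> \<open>Points on the same side of \<open>z\<close> with no element of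
        \<open>Z\<close> between them share a sign; the interval between \<open>x\<close> and
        \<open>x0\<close> lies in {x..y} or in {x0..y0}, both free of \<open>Z\<close>. So the flip
        seen at the witnesses also occurs between \<open>x\<close> and \<open>y\<close>.\<close>
      have "w x * w x0 > 0"
      proof (cases "x \<le> x0")
        case c: True
        have "{x..x0} \<subseteq> {x..y}" "z \<notin> {x..x0}" using b True by auto
        then have "{x..x0} \<inter> insert z Z = {}" using b(5) xy(4) by blast
        then show ?thesis using insert.prems[of x x0] c xy b by auto
      next
        case c: False
        have "{x0..x} \<subseteq> {x0..y0}" "z \<notin> {x0..x}" using b True by auto
        then have "{x0..x} \<inter> insert z Z = {}" using b(5) xy(4) by blast
        then show ?thesis using insert.prems[of x0 x] c xy b by (auto simp: mult.commute)
      qed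
      moreover have "w y * w y0 > 0"
      proof (cases "y \<le> y0")
        case c: True
        have "{y..y0} \<subseteq> {x0..y0}" "z \<notin> {y..y0}" using b True by auto
        then have "{y..y0} \<inter> insert z Z = {}" using b(5) xy(4) by blast
        then show ?thesis using insert.prems[of y y0] c xy b by auto
      next
        case c: False
        have "{y0..y} \<subseteq> {x..y}" "z \<notin> {y0..y}" using b True by auto
        then have "{y0..y} \<inter> insert z Z = {}" using b(5) xy(4) by blast
        then show ?thesis using insert.prems[of y0 y] c xy b by (auto simp: mult.commute)
      qed
      ultimately have "w x * w y < 0" using b(6)
        by (auto simp: zero_less_mult_iff mult_less_0_iff)
      moreover have "(x - z) * (y - z) < 0" using True by (simp add: mult_neg_pos)
      ultimately have "(w x * w y) * ((x - z) * (y - z)) > 0" by (rule mult_neg_neg)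
      then show ?thesis by (simp add: w1_def mult_ac)
    next
      case False
      then have "w x * w y > 0" using xy by (intro insert.prems) auto
      moreover have "(x - z) * (y - z) > 0"
        using False xy by (auto simp: zero_less_mult_iff)
      ultimately have "(w x * w y) * ((x - z) * (y - z)) > 0" by (rule mult_pos_pos)
      then show ?thesis by (simp add: w1_def mult_ac)
    qed
    from insert.IH[of "S - {z}" w1, OF this] obtain Z' s where
      Z': "Z' \<subseteq> Z" "s \<in> {-1, 1}" "\<forall>y\<in>S - {z} - Z. s * (\<Prod>z\<in>Z'. y - z) * w1 y > 0" by blast
    have "z \<notin> Z'" "finite Z'" using Z'(1) insert.hyps finite_subset by auto
    then show ?thesis
      using Z' by (intro exI[of _ "insert z Z'"] conjI bexI[of _ s]) (auto simp: w1_def mult_ac)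
  qed
qed

section \<open>Absolutely continuous functions\<close>

text \<open>Local absolute continuity of \<open>F\<close> with almost everywhere derivative \<open>f\<close>, stated through the fundamental
  theorem of calculus.\<close>

definition ac_on :: "real set \<Rightarrow> (real \<Rightarrow> complex) \<Rightarrow> (real \<Rightarrow> complex) \<Rightarrow> bool" where
  "ac_on S F f \<longleftrightarrow> (\<forall>a\<in>S. \<forall>b\<in>S. a \<le> b \<longrightarrow>
     f absolutely_integrable_on {a..b} \<and> integral {a..b} f = F b - F a)"

lemma ac_onD:
  assumes "ac_on S F f" "a \<in> S" "b \<in> S" "a \<le> b"
  shows "f absolutely_integrable_on {a..b}" "f integrable_on {a..b}" "integral {a..b} f = F b - F a"
  using assms set_lebesgue_integral_eq_integral(1) unfolding ac_on_def by blast+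

lemma ac_on_subset: "ac_on S F f \<Longrightarrow> T \<subseteq> S \<Longrightarrow> ac_on T F f"
  unfolding ac_on_def by blast

lemma convex_interval_subset:
  fixes S :: "real set"
  assumes "convex S" "a \<in> S" "b \<in> S" shows "{a..b} \<subseteq> S"
  using closed_segment_subset[OF assms(2,3,1)] by (cases "a \<le> b") (auto simp: closed_segment_eq_real_ivl1)

lemma ac_on_continuous:
  assumes "ac_on S F f" "convex S" "a \<in> S" "b \<in> S"
  shows "continuous_on {a..b} F"
proof (cases "a \<le> b")
  case True
  have eq: "F x = F a + integral {a..x} f" if "x \<in> {a..b}" for x
    using ac_onD(3)[OF assms(1,3), of x] convex_interval_subset[OF assms(2-4)] that by auto
  have "continuous_on {a..b} (\<lambda>x. F a + integral {a..x} f)"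
    by (intro continuous_intros indefinite_integral_continuous_1 ac_onD(2)[OF assms(1,3,4) True])
  then show ?thesis by (rule continuous_on_eq) (rule eq[symmetric])
qed simp

lemma ac_on_add:
  assumes "ac_on S F f" "ac_on S G g"
  shows "ac_on S (\<lambda>x. F x + G x) (\<lambda>x. f x + g x)"
  unfolding ac_on_def
proof (intro ballI impI conjI)
  fix a b assume ab: "a \<in> S" "b \<in> S" "a \<le> b"
  note f = ac_onD[OF assms(1) ab] and g = ac_onD[OF assms(2) ab]
  show "(\<lambda>x. f x + g x) absolutely_integrable_on {a..b}" by (rule set_integral_add(1)[OF f(1) g(1)])
  show "integral {a..b} (\<lambda>x. f x + g x) = F b + G b - (F a + G a)"
    using integral_add[OF f(2) g(2)] f(3) g(3) by simp
qed

lemma ac_on_const: "ac_on S (\<lambda>_. c) (\<lambda>_. 0)"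
  unfolding ac_on_def by simp

lemma ac_on_cnj: 
  assumes "ac_on S F f" shows "ac_on S (\<lambda>x. cnj (F x)) (\<lambda>x. cnj (f x))"
  unfolding ac_on_def
proof (intro ballI impI conjI)
  fix a b assume ab: "a \<in> S" "b \<in> S" "a \<le> b"
  show "(\<lambda>x. cnj (f x)) absolutely_integrable_on {a..b}"
    using absolutely_integrable_linear[OF ac_onD(1)[OF assms ab] bounded_linear_cnj] by (simp add: o_def)
  show "integral {a..b} (\<lambda>x. cnj (f x)) = cnj (F b) - cnj (F a)"
    using integral_cnj[of "{a..b}" f] ac_onD(3)[OF assms ab] by simp
qed

text \<open>Chaining steps of length \<open>d / 2\<close> turns the local estimate into a global
  one: the increments of \<open>M\<close> telescope, so the number of steps does not enter the
  bound.\<close>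

lemma norm_increment_le:
  fixes \<Phi> :: "real \<Rightarrow> 'a :: real_normed_vector" and M :: "real \<Rightarrow> real"
  assumes d: "d > 0" and ab: "a \<le> b"
    and le: "\<And>x y. a \<le> x \<Longrightarrow> x \<le> y \<Longrightarrow> y \<le> b \<Longrightarrow> y - x < d \<Longrightarrow> norm (\<Phi> y - \<Phi> x) \<le> M y - M x"
  shows "norm (\<Phi> b - \<Phi> a) \<le> M b - M a"
proof -
  have *: "a \<le> y \<Longrightarrow> y \<le> b \<Longrightarrow> y - a \<le> real n * (d / 2) \<Longrightarrow> norm (\<Phi> y - \<Phi> a) \<le> M y - M a" for n y
  proof (induction n arbitrary: y)
    case 0
    then show ?case by auto
  next
    case (Suc n)
    show ?case
    proof (cases "y - a < d")
      case True
      then show ?thesis using le[of a y] Suc.prems by auto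
    next
      case False
      define x where "x = y - d / 2"
      have "norm (\<Phi> x - \<Phi> a) \<le> M x - M a"
        by (rule Suc.IH) (use False Suc.prems d in \<open>auto simp: x_def algebra_simps\<close>)
      moreover have "norm (\<Phi> y - \<Phi> x) \<le> M y - M x"
        by (rule le) (use False Suc.prems d in \<open>auto simp: x_def\<close>)
      ultimately show ?thesis using norm_triangle_ineq[of "\<Phi> y - \<Phi> x" "\<Phi> x - \<Phi> a"] by simp
    qed
  qed
  obtain n where "(b - a) / (d / 2) \<le> real n" using real_arch_simple by blast
  then have "b - a \<le> real n * (d / 2)" using d by (simp add: pos_divide_le_eq)
  then show ?thesis using * ab by blast
qed

lemma absolutely_integrable_mult_continuous:
  fixes f G :: "real \<Rightarrow> complex"
  assumes "f absolutely_integrable_on {a..b}" "continuous_on {a..b} G"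
  shows "(\<lambda>x. f x * G x) absolutely_integrable_on {a..b}"
proof -
  have "(\<lambda>x. G x * f x) absolutely_integrable_on {a..b}"
  proof (rule absolutely_integrable_bounded_measurable_product[OF bilinear_times])
    show "G \<in> borel_measurable (lebesgue_on {a..b})"
      by (rule continuous_imp_measurable_on_sets_lebesgue[OF assms(2)]) auto
    show "bounded (G ` {a..b})"
      by (intro compact_imp_bounded compact_continuous_image assms(2) compact_Icc)
    show "{a..b} \<in> sets lebesgue" by simp
    show "f absolutely_integrable_on {a..b}" by (rule assms(1))
  qed
  then show ?thesis by (simp add: mult.commute)
qed

text \<open>Over an interval of length below the modulus of continuity for \<open>\<epsilon>\<close>, the increment of \<open>F G\<close> differs from the
  claimed integral by at most \<open>\<epsilon>\<close> times the integral of \<open>norm f + norm g\<close>; these errors add up along a partition.\<close>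

lemma ac_on_mult:
  assumes S: "convex S" and F: "ac_on S F f" and G: "ac_on S G g"
  shows "ac_on S (\<lambda>x. F x * G x) (\<lambda>x. f x * G x + F x * g x)"
  unfolding ac_on_def
proof (intro ballI impI conjI)
  fix a b assume ab: "a \<in> S" "b \<in> S" "a \<le> b"
  define w where "w = (\<lambda>x. f x * G x + F x * g x)"
  have sub: "x \<in> S" if "a \<le> x" "x \<le> b" for x
    using convex_interval_subset[OF S ab(1,2)] that by auto
  have cF: "continuous_on {a..b} F" and cG: "continuous_on {a..b} G"
    using ac_on_continuous[OF F S ab(1,2)] ac_on_continuous[OF G S ab(1,2)] .
  have iw: "w absolutely_integrable_on {a..b}"
    unfolding w_def
    using absolutely_integrable_mult_continuous[OF ac_onD(1)[OF F ab] cG]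
      absolutely_integrable_mult_continuous[OF ac_onD(1)[OF G ab] cF]
    by (intro set_integral_add) (auto simp: mult.commute)
  then show "(\<lambda>x. f x * G x + F x * g x) absolutely_integrable_on {a..b}" by (simp add: w_def)
  define \<Phi> where "\<Phi> y = F y * G y - integral {a..y} w" for y
  define C where "C = integral {a..b} (\<lambda>s. norm (f s) + norm (g s))"
  have ifg: "(\<lambda>s. norm (f s) + norm (g s)) integrable_on {x..y}" if "a \<le> x" "x \<le> y" "y \<le> b" for x y
    using ac_onD(1)[OF F sub[of x] sub[of y]] ac_onD(1)[OF G sub[of x] sub[of y]] that
    by (intro integrable_add) (auto simp: absolutely_integrable_on_def)
  have bound: "norm (\<Phi> b - \<Phi> a) \<le> \<epsilon> * C" if \<epsilon>: "\<epsilon> > 0" for \<epsilon>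
  proof -
    obtain d1 where d1: "d1 > 0" "\<And>x y. x \<in> {a..b} \<Longrightarrow> y \<in> {a..b} \<Longrightarrow> dist y x < d1 \<Longrightarrow> dist (F y) (F x) < \<epsilon>"
      using uniformly_continuous_on_def[THEN iffD1, OF compact_uniformly_continuous[OF cF compact_Icc], rule_format, OF \<epsilon>] by blast
    obtain d2 where d2: "d2 > 0" "\<And>x y. x \<in> {a..b} \<Longrightarrow> y \<in> {a..b} \<Longrightarrow> dist y x < d2 \<Longrightarrow> dist (G y) (G x) < \<epsilon>"
      using uniformly_continuous_on_def[THEN iffD1, OF compact_uniformly_continuous[OF cG compact_Icc], rule_format, OF \<epsilon>] by blast
    define M where "M y = \<epsilon> * integral {a..y} (\<lambda>s. norm (f s) + norm (g s))" for y
    have "norm (\<Phi> b - \<Phi> a) \<le> M b - M a"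
    proof (rule norm_increment_le[of "min d1 d2"])
      fix x y assume xy: "a \<le> x" "x \<le> y" "y \<le> b" "y - x < min d1 d2"
      have sx: "x \<in> S" and sy: "y \<in> S" using sub xy by auto
      have comb: "integral {a..y} h = integral {a..x} h + integral {x..y} h"
        if "h integrable_on {a..b}" for h :: "real \<Rightarrow> 'b :: banach"
      proof -
        have "h integrable_on {a..y}" using integrable_on_subinterval[OF that, of a y] xy by auto
        then show ?thesis using Henstock_Kurzweil_Integration.integral_combine[of a x y h] xy by simp
      qed
      have if1: "(\<lambda>s. f s * G y) integrable_on {x..y}" "(\<lambda>s. F x * g s) integrable_on {x..y}"
        using ac_onD(2)[OF F sx sy xy(2)] ac_onD(2)[OF G sx sy xy(2)] by (auto intro: integrable_on_mult_left integrable_on_mult_right)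
      have iw': "w integrable_on {a..b}" using iw set_lebesgue_integral_eq_integral(1) by blast
      have iwxy: "w integrable_on {x..y}" using integrable_on_subinterval[OF iw', of x y] xy by auto
      have eq: "\<Phi> y - \<Phi> x = integral {x..y} (\<lambda>s. f s * G y + F x * g s - w s)"
      proof -
        have "integral {x..y} (\<lambda>s. f s * G y + F x * g s - w s)
          = integral {x..y} (\<lambda>s. f s * G y) + integral {x..y} (\<lambda>s. F x * g s) - integral {x..y} w"
          using if1 iwxy by (simp add: integral_diff integral_add integrable_add)
        also have "\<dots> = (F y - F x) * G y + F x * (G y - G x) - integral {x..y} w"
          using ac_onD(3)[OF F sx sy xy(2)] ac_onD(3)[OF G sx sy xy(2)] by simp
        also have "\<dots> = \<Phi> y - \<Phi> x"
          using comb[OF iw'] by (simp add: \<Phi>_def algebra_simps)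
        finally show ?thesis by simp
      qed
      have "norm (\<Phi> y - \<Phi> x) \<le> integral {x..y} (\<lambda>s. \<epsilon> * (norm (f s) + norm (g s)))"
        unfolding eq
      proof (rule integral_norm_bound_integral)
        show "(\<lambda>s. f s * G y + F x * g s - w s) integrable_on {x..y}"
          using if1 iwxy by (intro integrable_diff integrable_add)
        show "(\<lambda>s. \<epsilon> * (norm (f s) + norm (g s))) integrable_on {x..y}"
          by (rule integrable_on_mult_right) (rule ifg[OF xy(1-3)])
        fix s assume s: "s \<in> {x..y}"
        have "norm (G y - G s) \<le> \<epsilon>" "norm (F x - F s) \<le> \<epsilon>"
          using d1(2)[of s x] d2(2)[of s y] s xy by (auto simp: dist_norm dist_real_def)
        then have "norm (f s) * norm (G y - G s) \<le> norm (f s) * \<epsilon>" "norm (F x - F s) * norm (g s) \<le> \<epsilon> * norm (g s)"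
          by (auto intro: mult_left_mono mult_right_mono)
        moreover have "norm (f s * G y + F x * g s - w s) \<le> norm (f s) * norm (G y - G s) + norm (F x - F s) * norm (g s)"
        proof -
          have "f s * G y + F x * g s - w s = f s * (G y - G s) + (F x - F s) * g s"
            by (simp add: w_def algebra_simps)
          then show ?thesis
            using norm_triangle_ineq[of "f s * (G y - G s)" "(F x - F s) * g s"] by (simp add: norm_mult)
        qed
        ultimately show "norm (f s * G y + F x * g s - w s) \<le> \<epsilon> * (norm (f s) + norm (g s))"
          unfolding distrib_left mult.commute[of \<epsilon> "norm (f s)"] by linarith
      qed
      also have "\<dots> = M y - M x"
        unfolding M_def comb[OF ifg[OF order_refl ab(3) order_refl]]
        by (simp only: distrib_left[of \<epsilon> "integral _ _"] add_diff_cancel_left' integral_mult_right)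
      finally show "norm (\<Phi> y - \<Phi> x) \<le> M y - M x" .
    qed (use d1(1) d2(1) ab in auto)
    then show ?thesis by (simp add: M_def C_def)
  qed
  have "C \<ge> 0" unfolding C_def by (rule integral_nonneg) (use ifg ab in auto)
  have "norm (\<Phi> b - \<Phi> a) \<le> 0"
  proof (rule field_le_epsilon)
    fix e :: real assume "e > 0"
    then have "norm (\<Phi> b - \<Phi> a) \<le> e / (C + 1) * C" using \<open>C \<ge> 0\<close> by (intro bound) auto
    also have "\<dots> \<le> 0 + e" using \<open>C \<ge> 0\<close> \<open>e > 0\<close> by (simp add: field_simps)
    finally show "norm (\<Phi> b - \<Phi> a) \<le> 0 + e" .
  qed
  then show "integral {a..b} (\<lambda>x. f x * G x + F x * g x) = F b * G b - F a * G a"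
    by (simp add: \<Phi>_def w_def algebra_simps)
qed

text \<open>The finite set \<open>K\<close> absorbs the corners of piecewise linear functions,
  across which continuity of \<open>F\<close> is enough for the fundamental theorem.\<close>

lemma ac_on_from_derivative:
  fixes F f :: "real \<Rightarrow> complex"
  assumes S: "convex S" and K: "finite K" and cont: "continuous_on S F"
    and der: "\<And>x. x \<in> S - K \<Longrightarrow> (F has_vector_derivative f x) (at x)"
    and f: "f \<in> borel_measurable borel" and bd: "\<And>a b. bounded (f ` {a..b})"
  shows "ac_on S F f"
  unfolding ac_on_def
proof (intro ballI impI conjI)
  fix a b assume ab: "a \<in> S" "b \<in> S" "a \<le> b"
  have sub: "{a..b} \<subseteq> S" by (rule convex_interval_subset[OF S ab(1,2)])
  obtain B where B: "\<And>x. x \<in> {a..b} \<Longrightarrow> norm (f x) \<le> B"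
    using bd[of a b] unfolding bounded_iff by (metis image_eqI)
  show "f absolutely_integrable_on {a..b}"
  proof (rule measurable_bounded_by_integrable_imp_absolutely_integrable)
    show "f \<in> borel_measurable (lebesgue_on {a..b})"
      using f by (simp add: measurable_completion measurable_restrict_space1)
    show "(\<lambda>_. B) integrable_on {a..b}" by (rule integrable_const_ivl)
  qed (use B in auto)
  have "(f has_integral F b - F a) {a..b}"
    by (rule fundamental_theorem_of_calculus_interior_strong[OF K ab(3)])
      (use der sub continuous_on_subset[OF cont sub] in \<open>auto simp: subset_iff\<close>)
  then show "integral {a..b} f = F b - F a" by (rule integral_unique)
qed

text \<open>Measurability provides continuous functions that converge off a negligible set.
  Truncation at level \<open>B\<close> does not change the limit, and Weierstrass replaces each
  truncated function by a polynomial with error at most 1, whence \<open>B + 1\<close>. The bound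
  uniform in \<open>n\<close> is what later allows dominated convergence.\<close>

lemma bounded_measurable_AE_limit_polynomials:
  fixes f :: "real \<Rightarrow> real"
  assumes f: "f \<in> borel_measurable (lebesgue_on {a..b})" and B: "\<And>x. \<bar>f x\<bar> \<le> B"
  obtains p where "\<And>n::nat. real_polynomial_function (p n)" "\<And>n x. x \<in> {a..b} \<Longrightarrow> \<bar>p n x\<bar> \<le> B + 1"
    "AE x in lebesgue_on {a..b}. (\<lambda>n. p n x) \<longlonglongrightarrow> f x"
proof -
  have "f measurable_on {a..b}"
    using f by (simp add: measurable_on_iff_borel_measurable)
  then obtain N g where N: "negligible N" and g: "\<And>n. continuous_on UNIV (g n)"
    "\<And>x. x \<notin> N \<Longrightarrow> (\<lambda>n. g n x) \<longlonglongrightarrow> (if x \<in> {a..b} then f x else 0)"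
    unfolding measurable_on_def by blast
  define h where "h n x = max (-B) (min B (g n x))" for n and x :: real
  have B0: "B \<ge> 0" using B[of 0] by linarith
  have hB: "\<bar>h n x\<bar> \<le> B" for n x using B0 by (auto simp: h_def)
  have "\<exists>p. real_polynomial_function p \<and> (\<forall>x\<in>{a..b}. \<bar>h n x - p x\<bar> < 1 / real (Suc n))" for n
  proof -
    have "continuous_on {a..b} (h n)" unfolding h_def
      by (intro continuous_intros continuous_on_subset[OF g(1)]) auto
    then obtain p where "real_polynomial_function p" "\<And>x. x \<in> {a..b} \<Longrightarrow> \<bar>h n x - p x\<bar> < 1 / real (Suc n)"
      by (rule Stone_Weierstrass_real_polynomial_function[of "{a..b}" "h n" "1 / real (Suc n)", rotated]) auto
    then show ?thesis by blast
  qed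
  then obtain p where p: "\<And>n. real_polynomial_function (p n)" "\<And>n x. x \<in> {a..b} \<Longrightarrow> \<bar>h n x - p n x\<bar> < 1 / real (Suc n)"
    by metis
  have "\<bar>p n x\<bar> \<le> B + 1" if "x \<in> {a..b}" for n x
  proof -
    have "1 / real (Suc n) \<le> 1" by simp
    then show ?thesis using p(2)[OF that, of n] hB[of n x] by linarith
  qed
  moreover have "AE x in lebesgue_on {a..b}. (\<lambda>n. p n x) \<longlonglongrightarrow> f x"
  proof -
    have lim: "(\<lambda>n. p n x) \<longlonglongrightarrow> f x" if x: "x \<in> {a..b}" "x \<notin> N" for x
    proof -
      have "(\<lambda>n. h n x) \<longlonglongrightarrow> max (-B) (min B (f x))" unfolding h_def
        by (intro tendsto_intros) (use g(2)[OF x(2)] x(1) in auto)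
      moreover have "max (-B) (min B (f x)) = f x" using B[of x] by auto
      moreover have "(\<lambda>n. p n x - h n x) \<longlonglongrightarrow> 0"
      proof (rule Lim_null_comparison)
        show "\<forall>\<^sub>F n in sequentially. norm (p n x - h n x) \<le> 1 / real (Suc n)"
          using p(2)[OF x(1)] by (auto intro!: always_eventually simp: abs_minus_commute less_imp_le)
        show "(\<lambda>n. 1 / real (Suc n)) \<longlonglongrightarrow> 0"
          using LIMSEQ_inverse_real_of_nat by (simp add: inverse_eq_divide)
      qed
      ultimately show ?thesis using tendsto_add[of "\<lambda>n. p n x - h n x" 0 _ "\<lambda>n. h n x"] by force
    qed
    have "AE x in lebesgue_on {a..b}. x \<notin> N"
      using N by (subst AE_restrict_space_iff) (auto simp: negligible_iff_null_sets dest!: AE_not_in elim!: AE_mp)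
    moreover have "AE x in lebesgue_on {a..b}. x \<in> {a..b}" by (rule AE_I2) simp
    ultimately show ?thesis by eventually_elim (rule lim)
  qed
  ultimately show ?thesis using p(1) that by blast
qed

section \<open>Smooth functions and weak derivatives\<close>

lemma has_vector_derivative_of_real_iff_real:
  "(f has_real_derivative f') F \<Longrightarrow> ((\<lambda>x. complex_of_real (f x)) has_vector_derivative complex_of_real f') F"
  using bounded_linear.has_vector_derivative[OF bounded_linear_of_real, of f f' F]
  by (simp add: has_real_derivative_iff_has_vector_derivative)

lemma ac_on_of_real:
  assumes der: "\<And>x. (f has_real_derivative f' x) (at x)" and cont: "continuous_on UNIV f'" and S: "convex S"
  shows "ac_on S (\<lambda>x. complex_of_real (f x)) (\<lambda>x. complex_of_real (f' x))"
proof (rule ac_on_from_derivative[OF S, of "{}"])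
  show "continuous_on S (\<lambda>x. complex_of_real (f x))"
    by (intro continuous_on_of_real continuous_on_subset[OF DERIV_continuous_on[of UNIV f f'] subset_UNIV]) (use der in auto)
  show "(\<lambda>x. complex_of_real (f' x)) \<in> borel_measurable borel"
    using borel_measurable_continuous_onI[OF cont] by measurable
  show "bounded ((\<lambda>x. complex_of_real (f' x)) ` {a..b})" for a b
    by (intro compact_imp_bounded compact_continuous_image compact_Icc continuous_on_of_real
        continuous_on_subset[OF cont]) auto
qed (use der has_vector_derivative_of_real_iff_real in auto)

text \<open>Dominated convergence extends orthogonality from polynomials to bounded measurable
  weights. The weights sgn(Re w) and sgn(Im w) then show that the integrals of |Re w| and |Im w|
  vanish.\<close>

lemma orthogonal_polynomials_imp_AE_zero:
  fixes w :: "real \<Rightarrow> complex"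
  assumes w: "integrable (lebesgue_on {a..b}) w"
    and orth: "\<And>p. real_polynomial_function p \<Longrightarrow> (LINT x|lebesgue_on {a..b}. w x * of_real (p x)) = 0"
  shows "AE x in lebesgue_on {a..b}. w x = 0"
proof -
  have [measurable]: "w \<in> borel_measurable (lebesgue_on {a..b})" using w by auto
  have orth_bounded: "(LINT x|lebesgue_on {a..b}. w x * of_real (f x)) = 0"
    if hf[measurable]: "f \<in> borel_measurable (lebesgue_on {a..b})" and f1: "\<And>x. \<bar>f x\<bar> \<le> 1" for f :: "real \<Rightarrow> real"
  proof -
    obtain p where p: "\<And>n::nat. real_polynomial_function (p n)" "\<And>n x. x \<in> {a..b} \<Longrightarrow> \<bar>p n x\<bar> \<le> 1 + 1"
      "AE x in lebesgue_on {a..b}. (\<lambda>n. p n x) \<longlonglongrightarrow> f x"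
      using bounded_measurable_AE_limit_polynomials[OF hf f1] by blast
    have [measurable]: "p n \<in> borel_measurable (lebesgue_on {a..b})" for n
      by (intro continuous_imp_measurable_on_sets_lebesgue continuous_on_polymonial_function)
        (use p(1) in \<open>auto simp: real_polynomial_function_eq[symmetric]\<close>)
    have "(\<lambda>n. LINT x|lebesgue_on {a..b}. w x * of_real (p n x)) \<longlonglongrightarrow> (LINT x|lebesgue_on {a..b}. w x * of_real (f x))"
    proof (rule integral_dominated_convergence[where w="\<lambda>x. 2 * norm (w x)"])
      show "AE x in lebesgue_on {a..b}. (\<lambda>n. w x * of_real (p n x)) \<longlonglongrightarrow> w x * of_real (f x)"
        using p(3) by eventually_elim (intro tendsto_intros)
      show "AE x in lebesgue_on {a..b}. norm (w x * of_real (p n x)) \<le> 2 * norm (w x)" for n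
      proof (rule AE_I2)
        fix x assume "x \<in> space (lebesgue_on {a..b})"
        then have "\<bar>p n x\<bar> \<le> 2" using p(2)[of x n] by simp
        then show "norm (w x * of_real (p n x)) \<le> 2 * norm (w x)"
          using mult_left_mono[of "\<bar>p n x\<bar>" 2 "norm (w x)"] by (simp add: norm_mult)
      qed
      show "integrable (lebesgue_on {a..b}) (\<lambda>x. 2 * norm (w x))" using w by auto
    qed measurable
    then show ?thesis using orth[OF p(1)] by (simp add: LIMSEQ_const_iff)
  qed
  have int: "integrable (lebesgue_on {a..b}) (\<lambda>x. w x * of_real (sgn (h x)))"
    if [measurable]: "h \<in> borel_measurable (lebesgue_on {a..b})" for h :: "real \<Rightarrow> real"
    by (rule Bochner_Integration.integrable_bound[OF w]) (auto simp: norm_mult sgn_real_def intro!: AE_I2)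
  have "(LINT x|lebesgue_on {a..b}. \<bar>Re (w x)\<bar>) = Re (LINT x|lebesgue_on {a..b}. w x * of_real (sgn (Re (w x))))"
    using int[of "\<lambda>x. Re (w x)"] by (subst integral_Re[symmetric]) (auto simp: abs_sgn)
  moreover have "\<dots> = 0" by (subst orth_bounded) (auto simp: sgn_real_def)
  ultimately have "AE x in lebesgue_on {a..b}. \<bar>Re (w x)\<bar> = 0"
    using w by (subst integral_nonneg_eq_0_iff_AE[symmetric]) auto
  moreover have "(LINT x|lebesgue_on {a..b}. \<bar>Im (w x)\<bar>) = Im (LINT x|lebesgue_on {a..b}. w x * of_real (sgn (Im (w x))))"
    using int[of "\<lambda>x. Im (w x)"] by (subst integral_Im[symmetric]) (auto simp: abs_sgn)
  moreover have "\<dots> = 0" by (subst orth_bounded) (auto simp: sgn_real_def)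
  ultimately have "AE x in lebesgue_on {a..b}. \<bar>Re (w x)\<bar> = 0" "AE x in lebesgue_on {a..b}. \<bar>Im (w x)\<bar> = 0"
    using w by (auto simp: integral_nonneg_eq_0_iff_AE)
  then show ?thesis by eventually_elim (auto simp: complex_eq_iff)
qed

text \<open>An open set is covered by its compact subintervals with rational end points; there are
  only countably many of them, so the exceptional null sets may be united.\<close>

lemma AE_lebesgue_on_open_interval:
  fixes S :: "real set"
  assumes S: "open S" and ae: "\<And>a b. {a..b} \<subseteq> S \<Longrightarrow> AE x in lebesgue_on {a..b}. P x"
  shows "AE x in lebesgue_on S. P x"
proof -
  have "AE x in lebesgue. \<forall>q\<in>{(a, b). a \<in> \<rat> \<and> b \<in> \<rat> \<and> {a..b} \<subseteq> S}. x \<in> {fst q..snd q} \<longrightarrow> P x"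
  proof (subst AE_ball_countable)
    have "countable (\<rat> \<times> \<rat> :: (real \<times> real) set)" by (intro countable_SIGMA countable_rat)
    then show "countable {(a, b). a \<in> \<rat> \<and> b \<in> \<rat> \<and> {a..b} \<subseteq> S}"
      by (rule countable_subset[rotated]) auto
    show "\<forall>q\<in>{(a, b). a \<in> \<rat> \<and> b \<in> \<rat> \<and> {a..b} \<subseteq> S}. AE x in lebesgue. x \<in> {fst q..snd q} \<longrightarrow> P x"
      using ae by (auto simp: AE_restrict_space_iff)
  qed
  then have "AE x in lebesgue. x \<in> S \<longrightarrow> P x"
  proof (rule AE_mp, intro AE_I2 impI)
    fix x assume *: "\<forall>q\<in>{(a, b). a \<in> \<rat> \<and> b \<in> \<rat> \<and> {a..b} \<subseteq> S}. x \<in> {fst q..snd q} \<longrightarrow> P x" and x: "x \<in> S"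
    obtain e where e: "e > 0" "\<And>y. \<bar>y - x\<bar> < e \<Longrightarrow> y \<in> S"
      using S x unfolding open_dist dist_real_def by blast
    obtain a where a: "a \<in> \<rat>" "x - e < a" "a < x" using Rats_dense_in_real[of "x - e" x] e by auto
    obtain b where b: "b \<in> \<rat>" "x < b" "b < x + e" using Rats_dense_in_real[of x "x + e"] e by auto
    have "{a..b} \<subseteq> S" using a b by (auto intro!: e(2))
    then show "P x" using *[rule_format, of "(a, b)"] a b by auto
  qed
  then show ?thesis using S by (simp add: AE_restrict_space_iff)
qed

section \<open>Smooth functions and the construction of smooth cutoffs\<close>

definition smooth :: "(real \<Rightarrow> real) \<Rightarrow> bool" where
  "smooth f \<longleftrightarrow> (\<forall>n. (deriv ^^ n) f differentiable_on UNIV)"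

text \<open>Iterates of \<open>deriv\<close> stay inside any class that is closed under
  differentiation. Smoothness proofs thus reduce to exhibiting such a class, without formulas for
  higher derivatives.\<close>

lemma smooth_coinduct:
  assumes "P f" and step: "\<And>f. P f \<Longrightarrow> \<exists>f'. (\<forall>x. (f has_real_derivative f' x) (at x)) \<and> P f'"
  shows "smooth f"
proof -
  have "\<exists>g. P g \<and> (deriv ^^ n) f = g" for n
  proof (induction n)
    case (Suc n)
    then obtain g where g: "P g" "(deriv ^^ n) f = g" by auto
    obtain g' where g': "\<And>x. (g has_real_derivative g' x) (at x)" "P g'" using step[OF g(1)] by auto
    have "deriv g = g'" using g'(1) DERIV_imp_deriv by blast
    then show ?case using g g'(2) by auto
  qed (use assms in auto)
  moreover have "g differentiable_on UNIV" if "P g" for g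
    using step[OF that] real_differentiable_def differentiable_at_imp_differentiable_on by blast
  ultimately show ?thesis unfolding smooth_def by metis
qed

lemma smooth_deriv: "smooth f \<Longrightarrow> smooth (deriv f)"
  unfolding smooth_def by (metis funpow_swap1 funpow.simps(2) o_apply)

lemma smooth_has_derivative:
  assumes "smooth f" shows "(f has_real_derivative deriv f x) (at x)"
proof -
  have "f differentiable_on UNIV" using assms unfolding smooth_def by (metis funpow_0)
  then have "f differentiable (at x)" by (simp add: differentiable_on_def)
  then show ?thesis using DERIV_deriv_iff_real_differentiable by blast
qed

lemma smooth_continuous: "smooth f \<Longrightarrow> continuous_on A f"
  using smooth_has_derivative DERIV_continuous_on has_field_derivative_at_within by metis

lemma smooth_antiderivative:
  assumes der: "\<And>x. (F has_real_derivative f x) (at x)" and "smooth f"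
  shows "smooth F"
proof (rule smooth_coinduct[of "\<lambda>h. h = F \<or> smooth h"])
  fix h assume "h = F \<or> smooth h"
  then show "\<exists>h'. (\<forall>x. (h has_real_derivative h' x) (at x)) \<and> (h' = F \<or> smooth h')"
    using assms smooth_has_derivative smooth_deriv by blast
qed simp

lemma smooth_polynomial: "real_polynomial_function p \<Longrightarrow> smooth p"
  by (rule smooth_coinduct[of real_polynomial_function]) (use has_real_derivative_polynomial_function in blast)+

lemma smooth_const: "smooth (\<lambda>_. c)"
  by (intro smooth_polynomial real_polynomial_function.intros)

text \<open>The product and chain rules produce sums of products of members, so sums, products and
  affine substitutions are closed off simultaneously; only then is the class stable under
  differentiation.\<close>

inductive smooth_closure :: "(real \<Rightarrow> real) \<Rightarrow> bool" where
  base: "smooth f \<Longrightarrow> smooth_closure f"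
| add: "smooth_closure f \<Longrightarrow> smooth_closure g \<Longrightarrow> smooth_closure (\<lambda>x. f x + g x)"
| mult: "smooth_closure f \<Longrightarrow> smooth_closure g \<Longrightarrow> smooth_closure (\<lambda>x. f x * g x)"
| affine: "smooth_closure f \<Longrightarrow> smooth_closure (\<lambda>x. f (a * x + b))"

lemma smooth_closure_smooth: "smooth_closure f \<Longrightarrow> smooth f"
proof (rule smooth_coinduct[of smooth_closure])
  show "\<exists>f'. (\<forall>x. (f has_real_derivative f' x) (at x)) \<and> smooth_closure f'" if "smooth_closure f" for f
    using that
  proof induction
    case (base f)
    then show ?case using smooth_has_derivative smooth_deriv smooth_closure.base by blast
  next
    case (add f g)
    then obtain f' g' where "\<And>x. (f has_real_derivative f' x) (at x)" "smooth_closure f'"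
      "\<And>x. (g has_real_derivative g' x) (at x)" "smooth_closure g'" by blast
    then show ?case
      by (intro exI[of _ "\<lambda>x. f' x + g' x"]) (auto intro: smooth_closure.add DERIV_add)
  next
    case (mult f g)
    then obtain f' g' where "\<And>x. (f has_real_derivative f' x) (at x)" "smooth_closure f'"
      "\<And>x. (g has_real_derivative g' x) (at x)" "smooth_closure g'" by blast
    with mult.hyps show ?case
      by (intro exI[of _ "\<lambda>x. f' x * g x + g' x * f x"])
        (auto intro!: smooth_closure.add smooth_closure.mult DERIV_mult)
  next
    case (affine f a b)
    then obtain f' where f': "\<And>x. (f has_real_derivative f' x) (at x)" "smooth_closure f'" by blast
    have "((\<lambda>x. f (a * x + b)) has_real_derivative f' (a * x + b) * a) (at x)" for x
      by (rule DERIV_chain'[of "\<lambda>x. a * x + b" a x UNIV f]) (auto intro!: derivative_eq_intros f')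
    moreover have "smooth_closure (\<lambda>x. f' (a * x + b) * a)"
      by (rule smooth_closure.mult[OF smooth_closure.affine[OF f'(2)] smooth_closure.base[OF smooth_const]])
    ultimately show ?case by (intro exI[of _ "\<lambda>x. f' (a * x + b) * a"] conjI allI)
  qed
qed

lemma smooth_add: "smooth f \<Longrightarrow> smooth g \<Longrightarrow> smooth (\<lambda>x. f x + g x)"
  by (rule smooth_closure_smooth, rule smooth_closure.add; rule smooth_closure.base)

lemma smooth_mult: "smooth f \<Longrightarrow> smooth g \<Longrightarrow> smooth (\<lambda>x. f x * g x)"
  by (rule smooth_closure_smooth, rule smooth_closure.mult; rule smooth_closure.base)

lemma smooth_affine: "smooth f \<Longrightarrow> smooth (\<lambda>x. f (a * x + b))"
  by (rule smooth_closure_smooth, rule smooth_closure.affine, rule smooth_closure.base)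

text \<open>The flat function exp(-1/x), extended by zero, with the factors that its derivatives
  bring in: polynomials in 1/x.\<close>

definition exp_flat :: "real poly \<Rightarrow> real \<Rightarrow> real" where
  "exp_flat p x = (if x > 0 then poly p (inverse x) * exp (- inverse x) else 0)"

lemma poly_times_exp_minus_tendsto_0:
  fixes p :: "real poly"
  shows "((\<lambda>y. poly p y * exp (- y)) \<longlongrightarrow> 0) at_top"
proof -
  have "((\<lambda>y. y ^ k * poly p y * exp (- y)) \<longlongrightarrow> 0) at_top" for k
  proof (induction p arbitrary: k)
    case (pCons a p)
    have "((\<lambda>y. a * (y ^ k / exp y) + y ^ Suc k * poly p y * exp (- y)) \<longlongrightarrow> a * 0 + 0) at_top"
      by (intro tendsto_intros tendsto_power_div_exp_0 pCons)
    then show ?case by (simp add: algebra_simps exp_minus divide_inverse)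
  qed simp
  from this[of 0] show ?thesis by simp
qed

lemma exp_flat_tendsto_0: "(exp_flat p \<longlongrightarrow> 0) (at 0)"
proof (rule filterlim_split_at)
  have "\<forall>\<^sub>F x in at_left 0. exp_flat p x = 0"
    unfolding exp_flat_def by (auto simp: eventually_at_left_field intro: exI[of _ "-1"])
  then show "(exp_flat p \<longlongrightarrow> 0) (at_left 0)" by (rule tendsto_eventually)
  have "((\<lambda>x. poly p (inverse x) * exp (- inverse x)) \<longlongrightarrow> 0) (at_right 0)"
    by (rule filterlim_compose[OF poly_times_exp_minus_tendsto_0 filterlim_inverse_at_top_right])
  moreover have "\<forall>\<^sub>F x in at_right 0. poly p (inverse x) * exp (- inverse x) = exp_flat p x"
    unfolding exp_flat_def by (auto simp: eventually_at_right_field intro: exI[of _ 1])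
  ultimately show "(exp_flat p \<longlongrightarrow> 0) (at_right 0)" by (rule Lim_transform_eventually)
qed

text \<open>In the variable t = 1/x the derivative in x is -t^2 d/dt, which maps p(t) exp(-t) to t^2
  (p - p')(t) exp(-t); the two leading \<open>pCons 0\<close> are the factor t^2. At the origin the
  difference quotient belongs to the same family, with \<open>p\<close> replaced by
  \<open>pCons 0 p\<close>, and tends to zero.\<close>

lemma exp_flat_has_derivative:
  "(exp_flat p has_real_derivative exp_flat (pCons 0 (pCons 0 (p - pderiv p))) x) (at x)"
proof -
  consider "x > 0" | "x < 0" | "x = 0" by linarith
  then show ?thesis
  proof cases
    case 1
    have "((\<lambda>x. poly p (inverse x) * exp (- inverse x)) has_real_derivative
        exp_flat (pCons 0 (pCons 0 (p - pderiv p))) x) (at x)"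
      using 1 by (auto intro!: derivative_eq_intros DERIV_chain'[OF _ poly_DERIV]
          simp: exp_flat_def field_simps power2_eq_square)
    then show ?thesis
      by (rule has_field_derivative_transform_within_open[of _ _ _ "{0<..}"]) (use 1 in \<open>auto simp: exp_flat_def\<close>)
  next
    case 2
    have "((\<lambda>x. 0) has_real_derivative exp_flat (pCons 0 (pCons 0 (p - pderiv p))) x) (at x)"
      using 2 by (simp add: exp_flat_def)
    then show ?thesis
      by (rule has_field_derivative_transform_within_open[of _ _ _ "{..<0}"]) (use 2 in \<open>auto simp: exp_flat_def\<close>)
  next
    case 3
    have "((\<lambda>y. (exp_flat p y - exp_flat p 0) / (y - 0)) \<longlongrightarrow> 0) (at 0)"
    proof (rule Lim_transform_eventually[OF exp_flat_tendsto_0[of "pCons 0 p"]])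
      show "\<forall>\<^sub>F y in at 0. exp_flat (pCons 0 p) y = (exp_flat p y - exp_flat p 0) / (y - 0)"
        by (auto simp: exp_flat_def eventually_at_filter field_simps)
    qed
    then show ?thesis using 3 by (simp add: has_field_derivative_iff exp_flat_def)
  qed
qed

lemma smooth_exp_flat: "smooth (exp_flat p)"
  by (rule smooth_coinduct[of "\<lambda>f. \<exists>p. f = exp_flat p"]) (use exp_flat_has_derivative in blast)+

lemma continuous_antiderivative:
  fixes f :: "real \<Rightarrow> real"
  assumes "continuous_on UNIV f"
  obtains F where "\<And>x. (F has_real_derivative f x) (at x)"
proof -
  have "\<exists>F. \<forall>x. -\<infinity> < ereal x \<longrightarrow> ereal x < \<infinity> \<longrightarrow> (F has_vector_derivative f x) (at x)"
    by (rule einterval_antiderivative) (use assms in \<open>auto simp: continuous_on_eq_continuous_at\<close>)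
  then show ?thesis using that by (auto simp: has_real_derivative_iff_has_vector_derivative)
qed

lemma smooth_step:
  obtains s :: "real \<Rightarrow> real" where "smooth s" "\<And>x. x \<le> 0 \<Longrightarrow> s x = 0" "\<And>x. x \<ge> 1 \<Longrightarrow> s x = 1"
    "\<And>x. 0 \<le> s x" "\<And>x. s x \<le> 1"
proof -
  \<comment> \<open>\<open>b\<close> is a bump that is positive exactly on (0, 1). Its primitive is
    constant on both sides of this interval and becomes the step after normalisation.\<close>
  define b where "b x = exp_flat 1 x * exp_flat 1 (-1 * x + 1)" for x
  have b: "smooth b" unfolding b_def by (rule smooth_mult[OF smooth_exp_flat smooth_affine[OF smooth_exp_flat]])
  have b0: "b x \<ge> 0" for x by (simp add: b_def exp_flat_def)
  have bz: "b x = 0" if "x \<le> 0 \<or> x \<ge> 1" for x using that by (auto simp: b_def exp_flat_def)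
  have bpos: "b x > 0" if "0 < x" "x < 1" for x using that by (auto simp: b_def exp_flat_def)
  obtain F where F: "\<And>x. (F has_real_derivative b x) (at x)"
    using continuous_antiderivative[OF smooth_continuous[OF b]] by blast
  have mono: "F x \<le> F y" if "x \<le> y" for x y
    by (rule DERIV_nonneg_imp_nondecreasing[OF that]) (use F b0 in blast)
  have left: "F x = F 0" if "x \<le> 0" for x
    by (rule antisym[OF mono[OF that] DERIV_nonpos_imp_nonincreasing[OF that]])
      (use F bz in \<open>metis order_refl\<close>)
  have right: "F x = F 1" if "x \<ge> 1" for x
    by (rule antisym[OF DERIV_nonpos_imp_nonincreasing[OF that] mono[OF that]])
      (use F bz in \<open>metis order_refl\<close>)
  have "F 0 < F 1"
  proof -
    have "F 0 \<le> F (1/4)" "F (3/4) \<le> F 1" by (auto intro: mono)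
    moreover have "F (1/4) < F (3/4)"
    proof (rule DERIV_pos_imp_increasing[of "1/4" "3/4" F])
      fix x :: real assume "1/4 \<le> x" "x \<le> 3/4"
      then show "\<exists>y. (F has_real_derivative y) (at x) \<and> 0 < y"
        by (intro exI[of _ "b x"] conjI F bpos) auto
    qed simp
    ultimately show ?thesis by linarith
  qed
  define s where "s x = (1 / (F 1 - F 0)) * (F x + - F 0)" for x
  have "smooth s" unfolding s_def
    by (rule smooth_mult[OF smooth_const smooth_add[OF smooth_antiderivative[OF F b] smooth_const]])
  moreover have "0 \<le> s x" "s x \<le> 1" for x
    using mono[of 0 x] left[of x] mono[of x 1] right[of x] \<open>F 0 < F 1\<close>
    by (cases "x \<le> 0"; cases "x \<ge> 1"; auto simp: s_def divide_simps)+
  moreover have "s x = 0" if "x \<le> 0" for x using left[OF that] by (simp add: s_def)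
  moreover have "s x = 1" if "x \<ge> 1" for x using right[OF that] \<open>F 0 < F 1\<close> by (simp add: s_def)
  ultimately show ?thesis using that by blast
qed

text \<open>Two ramps of width 1/n at the ends. The uniform bounds and the pointwise limit are
  tailored to dominated convergence; the statement makes no claim on the size of the
  derivatives.\<close>

lemma smooth_cutoffs:
  fixes a b :: real
  obtains \<theta> :: "nat \<Rightarrow> real \<Rightarrow> real" where "\<And>n. smooth (\<theta> n)" "\<And>n x. 0 \<le> \<theta> n x" "\<And>n x. \<theta> n x \<le> 1"
    "\<And>n x. x \<notin> {a..b} \<Longrightarrow> \<theta> n x = 0" "\<And>x. a < x \<Longrightarrow> x < b \<Longrightarrow> (\<lambda>n. \<theta> n x) \<longlonglongrightarrow> 1"
proof -
  obtain s :: "real \<Rightarrow> real" where s: "smooth s" "\<And>x. x \<le> 0 \<Longrightarrow> s x = 0" "\<And>x. x \<ge> 1 \<Longrightarrow> s x = 1"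
    "\<And>x. 0 \<le> s x" "\<And>x. s x \<le> 1" by (rule smooth_step) blast
  define \<theta> where "\<theta> n x = s (real n * x + - real n * a) * s (- real n * x + real n * b)" for n x
  have "smooth (\<theta> n)" for n unfolding \<theta>_def by (rule smooth_mult[OF smooth_affine[OF s(1)] smooth_affine[OF s(1)]])
  moreover have "0 \<le> \<theta> n x" "\<theta> n x \<le> 1" for n x using s(4,5) by (auto simp: \<theta>_def intro: mult_le_one)
  moreover have "\<theta> n x = 0" if "x \<notin> {a..b}" for n x
  proof -
    have "real n * (x - a) \<le> 0 \<or> real n * (b - x) \<le> 0" using that by (auto simp: mult_le_0_iff)
    then show ?thesis unfolding \<theta>_def using s(2) by (auto simp: algebra_simps)
  qed
  moreover have "(\<lambda>n. \<theta> n x) \<longlonglongrightarrow> 1" if x: "a < x" "x < b" for x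
  proof (rule tendsto_eventually)
    obtain N where N: "1 / min (x - a) (b - x) \<le> real N" using real_arch_simple by blast
    have "\<theta> n x = 1" if "n \<ge> N" for n
    proof -
      have "1 / min (x - a) (b - x) \<le> real n" using N that by linarith
      then have "1 \<le> real n * min (x - a) (b - x)" using x by (simp add: pos_divide_le_eq)
      moreover have "real n * min (x - a) (b - x) \<le> real n * (x - a)" "real n * min (x - a) (b - x) \<le> real n * (b - x)"
        by (intro mult_left_mono; simp)+
      ultimately have "1 \<le> real n * (x - a)" "1 \<le> real n * (b - x)" by linarith+
      then show ?thesis unfolding \<theta>_def using s(3) by (auto simp: algebra_simps)
    qed
    then show "\<forall>\<^sub>F n in sequentially. \<theta> n x = 1" by (auto simp: eventually_sequentially)
  qed
  ultimately show ?thesis using that by blast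
qed

section \<open>Integrals over nested domains and compactly supported test functions\<close>

lemma lebesgue_on_zero_outside:
  fixes f :: "real \<Rightarrow> 'a::{banach, second_countable_topology}"
  assumes "S \<in> sets lebesgue" "T \<in> sets lebesgue" "S \<subseteq> T" and z: "\<And>x. x \<in> T \<Longrightarrow> x \<notin> S \<Longrightarrow> f x = 0"
  shows "(LINT x|lebesgue_on T. f x) = (LINT x|lebesgue_on S. f x)"
    and "integrable (lebesgue_on T) f \<longleftrightarrow> integrable (lebesgue_on S) f"
proof -
  have "(\<lambda>x. indicator T x *\<^sub>R f x) = (\<lambda>x. indicator S x *\<^sub>R f x)"
    using assms(3) z by (fastforce simp: indicator_def)
  then show "(LINT x|lebesgue_on T. f x) = (LINT x|lebesgue_on S. f x)"
    "integrable (lebesgue_on T) f \<longleftrightarrow> integrable (lebesgue_on S) f"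
    using assms by (simp_all add: integral_restrict_space integrable_restrict_space)
qed

lemma integrable_lebesgue_on_mono:
  fixes f :: "real \<Rightarrow> 'a::{banach, second_countable_topology}"
  assumes "integrable (lebesgue_on T) f" "S \<subseteq> T" "S \<in> sets lebesgue" "T \<in> sets lebesgue"
  shows "integrable (lebesgue_on S) f"
proof -
  have "set_integrable lebesgue T f"
    using assms by (simp add: set_integrable_def integrable_restrict_space)
  then have "set_integrable lebesgue S f" by (rule set_integrable_subset) (use assms in auto)
  then show ?thesis using assms by (simp add: set_integrable_def integrable_restrict_space)
qed

lemma AE_lebesgue_on_subset:
  assumes "AE x in lebesgue_on T. P x" "S \<subseteq> T" "S \<in> sets lebesgue" "T \<in> sets lebesgue"
  shows "AE x in lebesgue_on S. P x"
  using assms by (auto simp: AE_restrict_space_iff elim!: AE_mp)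

lemma absolutely_integrable_iff_lebesgue_on:
  fixes f :: "real \<Rightarrow> complex"
  assumes "S \<in> sets lebesgue"
  shows "f absolutely_integrable_on S \<longleftrightarrow> integrable (lebesgue_on S) f"
  using assms by (simp add: set_integrable_def integrable_restrict_space)

lemma L2_absolutely_integrable_on_interval:
  assumes f: "f \<in> L2 \<Omega>" and sub: "{a..b} \<subseteq> \<Omega>" and \<Omega>: "\<Omega> \<in> sets lebesgue"
  shows "f absolutely_integrable_on {a..b}"
proof -
  have m: "f \<in> borel_measurable (lebesgue_on {a..b})"
    using f sub measurable_restrict_mono by (auto simp: L2_def)
  have "integrable (lebesgue_on {a..b}) (\<lambda>x. (cmod (f x))\<^sup>2)"
    using f by (intro integrable_lebesgue_on_mono[OF _ sub _ \<Omega>]) (auto simp: L2_def)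
  moreover have "integrable (lebesgue_on {a..b}) (\<lambda>x. 1 :: real)"
    by (rule absolutely_integrable_imp_integrable) (auto intro: absolutely_integrable_continuous_real)
  ultimately have "integrable (lebesgue_on {a..b}) (\<lambda>x. 1 + (cmod (f x))\<^sup>2)" by (rule Bochner_Integration.integrable_add[rotated])
  then have "integrable (lebesgue_on {a..b}) f"
  proof (rule Bochner_Integration.integrable_bound[OF _ m], intro AE_I2)
    fix x
    have "2 * cmod (f x) \<le> 1 + (cmod (f x))\<^sup>2" using sum_squares_bound[of 1 "cmod (f x)"] by simp
    then have "norm (f x) \<le> 1 + (cmod (f x))\<^sup>2" using norm_ge_zero[of "f x"] by linarith
    then show "norm (f x) \<le> norm (1 + (cmod (f x))\<^sup>2)" by simp
  qed
  then show ?thesis by (simp add: absolutely_integrable_iff_lebesgue_on)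
qed

lemma deriv_zero_outside:
  fixes \<phi> :: "real \<Rightarrow> real"
  assumes z: "\<And>x. x \<notin> {a..b} \<Longrightarrow> \<phi> x = 0" and x: "x \<notin> {a..b}"
  shows "deriv \<phi> x = 0"
proof -
  have "((\<lambda>_. 0) has_real_derivative 0) (at x)" by simp
  then have "(\<phi> has_real_derivative 0) (at x)"
    by (rule has_field_derivative_transform_within_open[of _ _ _ "- {a..b}"]) (use z x in auto)
  then show ?thesis by (rule DERIV_imp_deriv)
qed

lemma test_functionI:
  assumes "smooth \<phi>" and z: "\<And>x. x \<notin> {a..b} \<Longrightarrow> \<phi> x = 0" and sub: "{a..b} \<subseteq> \<Omega>"
  shows "test_function \<Omega> \<phi>"
proof -
  have cl: "closure {x. \<phi> x \<noteq> 0} \<subseteq> {a..b}" using z by (intro closure_minimal) (blast, simp)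
  moreover have "compact (closure {x. \<phi> x \<noteq> 0})"
    using bounded_subset[OF bounded_closed_interval[of a b] cl]
    by (simp add: compact_eq_bounded_closed)
  ultimately show ?thesis using assms(1) sub unfolding test_function_def smooth_def by auto
qed

lemma test_functionE:
  assumes "test_function \<Omega> \<phi>" "convex \<Omega>" "\<Omega> \<noteq> {}"
  obtains a b where "a \<le> b" "a \<in> \<Omega>" "b \<in> \<Omega>" "\<And>x. x \<notin> {a..b} \<Longrightarrow> \<phi> x = 0" "smooth \<phi>"
proof -
  define K where "K = closure {x. \<phi> x \<noteq> 0}"
  have K: "compact K" "K \<subseteq> \<Omega>" and sm: "smooth \<phi>"
    using assms(1) unfolding test_function_def K_def smooth_def by auto
  have z: "\<phi> x = 0" if "x \<notin> K" for x using that closure_subset[of "{x. \<phi> x \<noteq> 0}"] unfolding K_def by blast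
  show ?thesis
  proof (cases "K = {}")
    case True
    obtain a where "a \<in> \<Omega>" using assms(3) by auto
    then show ?thesis using that[of a a] z sm True by auto
  next
    case False
    obtain a where a: "a \<in> K" "\<And>x. x \<in> K \<Longrightarrow> a \<le> x" using compact_attains_inf[OF K(1) False] by auto
    obtain b where b: "b \<in> K" "\<And>x. x \<in> K \<Longrightarrow> x \<le> b" using compact_attains_sup[OF K(1) False] by auto
    show ?thesis by (rule that[of a b]) (use a b z sm K(2) in \<open>auto intro: z\<close>)
  qed
qed

text \<open>With a fixed bump \<open>\<eta>\<close> of integral \<open>I\<close>, every test function \<open>\<zeta>\<close> of integral \<open>J\<close> gives the derivative
  \<open>\<zeta> - (J / I) \<eta>\<close> of a test function, so \<open>w - c\<close> annihilates \<open>\<zeta>\<close>; taking polynomials times cutoffs for \<open>\<zeta>\<close> forces \<open>w = c\<close>.\<close>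

lemma zero_weak_derivative_imp_AE_const:
  fixes w :: "real \<Rightarrow> complex"
  assumes \<Omega>: "open \<Omega>" "convex \<Omega>" "\<Omega> \<noteq> {}"
    and w: "\<And>a b. {a..b} \<subseteq> \<Omega> \<Longrightarrow> w absolutely_integrable_on {a..b}"
    and weak: "\<And>\<phi>. test_function \<Omega> \<phi> \<Longrightarrow> (LINT x|lebesgue_on \<Omega>. deriv \<phi> x *\<^sub>R w x) = 0"
  shows "\<exists>c. AE x in lebesgue_on \<Omega>. w x = c"
proof -
  have \<Omega>s: "\<Omega> \<in> sets lebesgue" using \<Omega>(1) by simp
  have wint: "integrable (lebesgue_on {a..b}) w" if "{a..b} \<subseteq> \<Omega>" for a b
    using w[OF that] by (simp add: absolutely_integrable_iff_lebesgue_on)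
  have bint: "integrable (lebesgue_on {a..b}) (\<lambda>x. f x *\<^sub>R w x)" if "{a..b} \<subseteq> \<Omega>" "continuous_on {a..b} f" for a b f
  proof -
    have "(\<lambda>x. w x * of_real (f x)) absolutely_integrable_on {a..b}"
      by (intro absolutely_integrable_mult_continuous w that continuous_on_of_real)
    then show ?thesis by (simp add: absolutely_integrable_iff_lebesgue_on scaleR_conv_of_real mult.commute)
  qed
  obtain x0 where "x0 \<in> \<Omega>" using \<Omega>(3) by auto
  then obtain r where r: "r > 0" "cball x0 r \<subseteq> \<Omega>" using \<Omega>(1) open_contains_cball by blast
  define a0 b0 where "a0 = x0 - r" and "b0 = x0 + r"
  have ab0: "a0 < b0" "{a0..b0} \<subseteq> \<Omega>" using r by (auto simp: a0_def b0_def cball_eq_atLeastAtMost)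
  obtain \<theta> :: "nat \<Rightarrow> real \<Rightarrow> real" where \<theta>: "\<And>n. smooth (\<theta> n)" "\<And>n x. 0 \<le> \<theta> n x"
    "\<And>n x. x \<notin> {a0..b0} \<Longrightarrow> \<theta> n x = 0" "\<And>x. a0 < x \<Longrightarrow> x < b0 \<Longrightarrow> (\<lambda>n. \<theta> n x) \<longlonglongrightarrow> 1"
    using smooth_cutoffs[of a0 b0] by metis
  have "(\<lambda>n. \<theta> n x0) \<longlonglongrightarrow> 1" by (rule \<theta>(4)) (use r in \<open>auto simp: a0_def b0_def\<close>)
  then have "\<forall>\<^sub>F n in sequentially. \<theta> n x0 > 1/2" by (rule order_tendstoD) simp
  then obtain n where n: "\<theta> n x0 > 1/2" by (auto simp: eventually_sequentially)
  define \<eta> where "\<eta> = \<theta> n"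
  have \<eta>: "smooth \<eta>" "\<And>x. \<eta> x \<ge> 0" "\<And>x. x \<notin> {a0..b0} \<Longrightarrow> \<eta> x = 0" using \<theta> by (auto simp: \<eta>_def)
  define I where "I = integral {a0..b0} \<eta>"
  have "I \<noteq> 0" unfolding I_def
  proof
    have x0: "x0 \<in> {a0..b0}" using r by (auto simp: a0_def b0_def)
    assume "integral {a0..b0} \<eta> = 0"
    then have "\<eta> x0 = 0"
      using integral_eq_0_iff[OF smooth_continuous[OF \<eta>(1)] ab0(1) \<eta>(2)] x0 by blast
    then show False using n by (simp add: \<eta>_def)
  qed
  \<comment> \<open>The weighted mean of \<open>w\<close> against \<eta>, the only value that the
    constant can have.\<close>
  define c where "c = (LINT x|lebesgue_on \<Omega>. \<eta> x *\<^sub>R w x) / of_real I"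
  have key: "(LINT x|lebesgue_on {a..b}. \<zeta> x *\<^sub>R (w x - c)) = 0"
    if ab: "a \<le> a0" "b0 \<le> b" "{a..b} \<subseteq> \<Omega>" and \<zeta>: "smooth \<zeta>" "\<And>x. x \<notin> {a..b} \<Longrightarrow> \<zeta> x = 0" for a b \<zeta>
  proof -
    define J where "J = integral {a..b} \<zeta>"
    \<comment> \<open>This multiple of \<eta> makes the integral of \<open>g\<close> vanish. A
      primitive of \<open>g\<close> then takes the same constant value on both sides of [a, b], and
      subtracting that value gives a test function.\<close>
    define g where "g x = \<zeta> x + (- J / I) * \<eta> x" for x
    have g: "smooth g" unfolding g_def by (rule smooth_add[OF \<zeta>(1) smooth_mult[OF smooth_const \<eta>(1)]])
    have gz: "g x = 0" if "x \<notin> {a..b}" for x using that \<zeta>(2) \<eta>(3) ab by (auto simp: g_def)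
    have cg: "continuous_on A g" for A by (rule smooth_continuous[OF g])
    have c\<eta>: "continuous_on A \<eta>" and c\<zeta>: "continuous_on A \<zeta>" for A using smooth_continuous \<eta>(1) \<zeta>(1) by blast+
    obtain F where F: "\<And>x. (F has_real_derivative g x) (at x)"
      using continuous_antiderivative[OF cg] by blast
    have "integral {a..b} \<eta> = I"
    proof -
      have "(LINT x|lebesgue_on {a..b}. \<eta> x) = (LINT x|lebesgue_on {a0..b0}. \<eta> x)"
        by (rule lebesgue_on_zero_outside) (use ab \<eta> in auto)
      then show ?thesis unfolding I_def using c\<eta>
        by (subst (asm) (1 2) lebesgue_integral_eq_integral)
          (auto intro!: absolutely_integrable_imp_integrable absolutely_integrable_continuous_real)
    qed
    have ig: "(g has_integral F b - F a) {a..b}"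
      using ab ab0 F by (intro fundamental_theorem_of_calculus)
        (auto simp: has_real_derivative_iff_has_vector_derivative intro: has_vector_derivative_at_within)
    have "integral {a..b} g = J + (- J / I) * integral {a..b} \<eta>"
      unfolding g_def J_def using \<open>I \<noteq> 0\<close> c\<eta>[of "{a..b}"] c\<zeta>[of "{a..b}"]
      by (subst integral_add) (auto intro!: integrable_continuous_real continuous_intros)
    then have Fab: "F b = F a" using ig \<open>integral {a..b} \<eta> = I\<close> \<open>I \<noteq> 0\<close> by (simp add: integral_unique)
    have contF: "continuous_on A F" for A using F DERIV_continuous_on has_field_derivative_at_within by metis
    define \<phi> where "\<phi> x = F x + - F a" for x
    have \<phi>: "smooth \<phi>" unfolding \<phi>_def by (rule smooth_add[OF smooth_antiderivative[OF F g] smooth_const])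
    have F0: "(F has_real_derivative 0) (at x)" if "x \<notin> {a..b}" for x using F[of x] gz[OF that] by simp
    have \<phi>z: "\<phi> x = 0" if "x \<notin> {a..b}" for x
    proof (cases "x < a")
      case True
      then have "F a = F x" by (intro DERIV_isconst_end contF F0) auto
      then show ?thesis by (simp add: \<phi>_def)
    next
      case False
      then have "b < x" using that by auto
      then have "F x = F b" by (intro DERIV_isconst_end contF F0) auto
      then show ?thesis using Fab by (simp add: \<phi>_def)
    qed
    have d\<phi>: "deriv \<phi> x = g x" for x
      unfolding \<phi>_def by (rule DERIV_imp_deriv) (auto intro!: derivative_eq_intros F)
    have "0 = (LINT x|lebesgue_on \<Omega>. g x *\<^sub>R w x)"
      using weak[OF test_functionI[OF \<phi> \<phi>z ab(3)]] by (simp add: d\<phi>)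
    also have "\<dots> = (LINT x|lebesgue_on {a..b}. g x *\<^sub>R w x)"
      by (rule lebesgue_on_zero_outside) (use ab \<Omega>s gz in auto)
    also have "\<dots> = (LINT x|lebesgue_on {a..b}. \<zeta> x *\<^sub>R w x) - of_real (J / I) * (LINT x|lebesgue_on {a..b}. \<eta> x *\<^sub>R w x)"
    proof -
      have "(LINT x|lebesgue_on {a..b}. g x *\<^sub>R w x) = (LINT x|lebesgue_on {a..b}. \<zeta> x *\<^sub>R w x - of_real (J / I) * (\<eta> x *\<^sub>R w x))"
        by (intro Bochner_Integration.integral_cong) (auto simp: g_def algebra_simps scaleR_conv_of_real)
      also have "\<dots> = (LINT x|lebesgue_on {a..b}. \<zeta> x *\<^sub>R w x) - (LINT x|lebesgue_on {a..b}. of_real (J / I) * (\<eta> x *\<^sub>R w x))"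
        by (intro Bochner_Integration.integral_diff integrable_mult_right bint[OF ab(3)] c\<eta> c\<zeta>)
      finally show ?thesis by (simp only: integral_mult_right_zero)
    qed
    also have "(LINT x|lebesgue_on {a..b}. \<eta> x *\<^sub>R w x) = (LINT x|lebesgue_on \<Omega>. \<eta> x *\<^sub>R w x)"
      by (rule lebesgue_on_zero_outside[symmetric]) (use ab \<Omega>s \<eta>(3) in auto)
    also have "of_real (J / I) * \<dots> = of_real J * c" using \<open>I \<noteq> 0\<close> by (simp add: c_def)
    finally have 1: "(LINT x|lebesgue_on {a..b}. \<zeta> x *\<^sub>R w x) = of_real J * c" by simp
    have i\<zeta>: "integrable (lebesgue_on {a..b}) \<zeta>"
      by (intro absolutely_integrable_imp_integrable absolutely_integrable_continuous_real c\<zeta>) auto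
    then have "(LINT x|lebesgue_on {a..b}. \<zeta> x *\<^sub>R c) = of_real J * c"
      by (simp add: J_def lebesgue_integral_eq_integral scaleR_conv_of_real)
    then show ?thesis using 1 bint[OF ab(3) c\<zeta>] i\<zeta>
      by (simp add: scaleR_diff_right)
  qed
  have main: "AE x in lebesgue_on {a..b}. w x = c" if ab: "a \<le> a0" "b0 \<le> b" "{a..b} \<subseteq> \<Omega>" for a b
  proof -
    have "AE x in lebesgue_on {a..b}. w x - c = 0"
    proof (rule orthogonal_polynomials_imp_AE_zero)
      have ci: "integrable (lebesgue_on {a..b}) (\<lambda>x. c)"
        by (intro absolutely_integrable_imp_integrable absolutely_integrable_continuous_real) auto
      show wc: "integrable (lebesgue_on {a..b}) (\<lambda>x. w x - c)" using wint[OF ab(3)] ci by simp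
      fix p :: "real \<Rightarrow> real" assume p: "real_polynomial_function p"
      have cp: "continuous_on A p" for A by (rule smooth_continuous[OF smooth_polynomial[OF p]])
      obtain P where P: "\<And>x. x \<in> {a..b} \<Longrightarrow> \<bar>p x\<bar> \<le> P"
        using compact_imp_bounded[OF compact_continuous_image[OF cp compact_Icc[of a b]]]
        unfolding bounded_iff by (metis image_eqI real_norm_def)
      obtain \<theta> :: "nat \<Rightarrow> real \<Rightarrow> real" where \<theta>: "\<And>n. smooth (\<theta> n)" "\<And>n x. 0 \<le> \<theta> n x" "\<And>n x. \<theta> n x \<le> 1"
        "\<And>n x. x \<notin> {a..b} \<Longrightarrow> \<theta> n x = 0" "\<And>x. a < x \<Longrightarrow> x < b \<Longrightarrow> (\<lambda>n. \<theta> n x) \<longlonglongrightarrow> 1"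
        using smooth_cutoffs[of a b] by metis
      have zero: "(LINT x|lebesgue_on {a..b}. (p x * \<theta> n x) *\<^sub>R (w x - c)) = 0" for n
        by (rule key[OF ab smooth_mult[OF smooth_polynomial[OF p] \<theta>(1)]]) (use \<theta>(4) in auto)
      have [measurable]: "p \<in> borel_measurable (lebesgue_on {a..b})" "\<theta> n \<in> borel_measurable (lebesgue_on {a..b})" for n
        by (auto intro!: continuous_imp_measurable_on_sets_lebesgue cp smooth_continuous \<theta>(1))
      have [measurable]: "w \<in> borel_measurable (lebesgue_on {a..b})" using wint[OF ab(3)] by auto
      have "(\<lambda>n. LINT x|lebesgue_on {a..b}. (p x * \<theta> n x) *\<^sub>R (w x - c)) \<longlonglongrightarrow> (LINT x|lebesgue_on {a..b}. p x *\<^sub>R (w x - c))"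
      proof (rule integral_dominated_convergence[where w="\<lambda>x. P * norm (w x - c)"])
        have "AE x in lebesgue. x \<notin> {a, b}"
          by (rule AE_not_in) (auto simp: negligible_iff_null_sets[symmetric])
        then have "AE x in lebesgue_on {a..b}. x \<noteq> a \<and> x \<noteq> b"
          by (subst AE_restrict_space_iff) (auto elim!: AE_mp)
        then show "AE x in lebesgue_on {a..b}. (\<lambda>n. (p x * \<theta> n x) *\<^sub>R (w x - c)) \<longlonglongrightarrow> p x *\<^sub>R (w x - c)"
        proof (rule AE_mp, intro AE_I2 impI)
          fix x assume "x \<in> space (lebesgue_on {a..b})" "x \<noteq> a \<and> x \<noteq> b"
          then have "(\<lambda>n. \<theta> n x) \<longlonglongrightarrow> 1" by (intro \<theta>(5)) auto
          then have "(\<lambda>n. (p x * \<theta> n x) *\<^sub>R (w x - c)) \<longlonglongrightarrow> (p x * 1) *\<^sub>R (w x - c)" by (intro tendsto_intros)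
          then show "(\<lambda>n. (p x * \<theta> n x) *\<^sub>R (w x - c)) \<longlonglongrightarrow> p x *\<^sub>R (w x - c)" by simp
        qed
        show "AE x in lebesgue_on {a..b}. norm ((p x * \<theta> n x) *\<^sub>R (w x - c)) \<le> P * norm (w x - c)" for n
        proof (rule AE_I2)
          fix x assume "x \<in> space (lebesgue_on {a..b})"
          then have "\<bar>p x\<bar> * \<theta> n x \<le> P * 1" using P[of x] \<theta>(2,3)[of n x] by (intro mult_mono) auto
          then show "norm ((p x * \<theta> n x) *\<^sub>R (w x - c)) \<le> P * norm (w x - c)"
            using \<theta>(2)[of n x] by (auto simp: abs_mult intro!: mult_right_mono)
        qed
        show "integrable (lebesgue_on {a..b}) (\<lambda>x. P * norm (w x - c))" using wc by auto
      qed measurable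
      then have "(LINT x|lebesgue_on {a..b}. p x *\<^sub>R (w x - c)) = 0"
        unfolding zero by (simp add: LIMSEQ_const_iff)
      then show "(LINT x|lebesgue_on {a..b}. (w x - c) * of_real (p x)) = 0"
        by (simp add: scaleR_conv_of_real mult.commute)
    qed
    then show ?thesis by simp
  qed
  have "AE x in lebesgue_on {a..b}. w x = c" if ab: "{a..b} \<subseteq> \<Omega>" for a b
  proof (cases "a \<le> b")
    case True
    \<comment> \<open>\<open>key\<close> needs the support of \<eta> inside the interval, so an
      arbitrary interval is first enlarged to contain [a0, b0].\<close>
    have "min a a0 \<in> \<Omega>" "max b b0 \<in> \<Omega>"
      using ab ab0 True by (auto simp: min_def max_def subset_iff)
    then have "{min a a0..max b b0} \<subseteq> \<Omega>" by (rule convex_interval_subset[OF \<Omega>(2)])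
    then have "AE x in lebesgue_on {min a a0..max b b0}. w x = c" by (intro main) auto
    then show ?thesis by (rule AE_lebesgue_on_subset) auto
  qed (auto simp: AE_restrict_space_iff)
  then show ?thesis using AE_lebesgue_on_open_interval[OF \<Omega>(1)] by blast
qed

section \<open>Absolutely continuous representatives of Sobolev functions\<close>

lemma ac_on_indefinite_integral:
  fixes f :: "real \<Rightarrow> complex"
  assumes S: "convex S" and f: "\<And>a b. {a..b} \<subseteq> S \<Longrightarrow> f absolutely_integrable_on {a..b}"
  shows "\<exists>F. ac_on S F f"
proof (cases "S = {}")
  case False
  then obtain z where z: "z \<in> S" by auto
  define F where "F x = (if z \<le> x then integral {z..x} f else - integral {x..z} f)" for x
  have "ac_on S F f" unfolding ac_on_def
  proof (intro ballI impI conjI)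
    fix a b assume ab: "a \<in> S" "b \<in> S" "a \<le> b"
    have fi: "f integrable_on {x..y}" if "x \<in> S" "y \<in> S" for x y
      using f[OF convex_interval_subset[OF S that]] set_lebesgue_integral_eq_integral(1) by blast
    show "f absolutely_integrable_on {a..b}" by (rule f[OF convex_interval_subset[OF S ab(1,2)]])
    have comb: "integral {x..y} f + integral {y..t} f = integral {x..t} f"
      if "x \<le> y" "y \<le> t" "x \<in> S" "t \<in> S" for x y t
      by (rule Henstock_Kurzweil_Integration.integral_combine[OF that(1,2) fi[OF that(3,4)]])
    consider "z \<le> a" | "a < z" "z \<le> b" | "b < z" using ab(3) by linarith
    then show "integral {a..b} f = F b - F a"
    proof cases
      case 1
      then show ?thesis using comb[of z a b] ab z by (simp add: F_def algebra_simps)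
    next
      case 2
      then show ?thesis using comb[of a z b] ab z by (simp add: F_def algebra_simps)
    next
      case 3
      then show ?thesis using comb[of a b z] ab z by (simp add: F_def algebra_simps)
    qed
  qed
  then show ?thesis by blast
qed (auto simp: ac_on_def)

lemma ac_on_integration_by_parts_compact_support:
  fixes \<phi> :: "real \<Rightarrow> real"
  assumes \<Omega>: "\<Omega> \<in> sets lebesgue" "convex \<Omega>" and ac: "ac_on \<Omega> U u'"
    and ab: "a \<in> \<Omega>" "b \<in> \<Omega>" "a \<le> b" and \<phi>: "smooth \<phi>" "\<And>x. x \<notin> {a..b} \<Longrightarrow> \<phi> x = 0"
  shows "(LINT x|lebesgue_on \<Omega>. deriv \<phi> x *\<^sub>R U x) = - (LINT x|lebesgue_on \<Omega>. \<phi> x *\<^sub>R u' x)"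
    and "integrable (lebesgue_on \<Omega>) (\<lambda>x. deriv \<phi> x *\<^sub>R U x)"
    and "integrable (lebesgue_on \<Omega>) (\<lambda>x. \<phi> x *\<^sub>R u' x)"
proof -
  have sub: "{a..b} \<subseteq> \<Omega>" by (rule convex_interval_subset[OF \<Omega>(2) ab(1,2)])
  have ac\<phi>: "ac_on UNIV (\<lambda>x. complex_of_real (\<phi> x)) (\<lambda>x. complex_of_real (deriv \<phi> x))"
    by (rule ac_on_of_real[OF smooth_has_derivative[OF \<phi>(1)] smooth_continuous[OF smooth_deriv[OF \<phi>(1)]]]) simp
  have d0: "deriv \<phi> x = 0" if "x \<notin> {a..b}" for x by (rule deriv_zero_outside[OF \<phi>(2) that]) 
  \<comment> \<open>The hypothesis only speaks of points outside [a, b]; at the end points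
    themselves \<phi> vanishes by continuity.\<close>
  have closed: "\<phi> a * 1 = 0 \<and> \<phi> b * 1 = 0"
  proof -
    have "continuous_on UNIV \<phi>" by (rule smooth_continuous[OF \<phi>(1)])
    then have ct: "isCont \<phi> x" for x by (simp add: continuous_on_eq_continuous_at)
    have "\<forall>\<^sub>F x in at_left a. \<phi> x = 0" using \<phi>(2) by (auto simp: eventually_at_left_field intro: exI[of _ "a - 1"])
    then have "(\<phi> \<longlongrightarrow> 0) (at_left a)" by (rule tendsto_eventually)
    moreover have "(\<phi> \<longlongrightarrow> \<phi> a) (at_left a)" using ct[of a] isContD filterlim_at_split by blast
    ultimately have "\<phi> a = 0" using tendsto_unique[OF trivial_limit_at_left_real] by blast
    have "\<forall>\<^sub>F x in at_right b. \<phi> x = 0" using \<phi>(2) by (auto simp: eventually_at_right_field intro: exI[of _ "b + 1"])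
    then have "(\<phi> \<longlongrightarrow> 0) (at_right b)" by (rule tendsto_eventually)
    moreover have "(\<phi> \<longlongrightarrow> \<phi> b) (at_right b)" using ct[of b] isContD filterlim_at_split by blast
    ultimately have "\<phi> b = 0" using tendsto_unique[OF trivial_limit_at_right_real] by blast
    with \<open>\<phi> a = 0\<close> show ?thesis by simp
  qed
  have prod: "ac_on {a..b} (\<lambda>x. complex_of_real (\<phi> x) * U x) (\<lambda>x. complex_of_real (deriv \<phi> x) * U x + complex_of_real (\<phi> x) * u' x)"
    by (rule ac_on_mult[OF _ ac_on_subset[OF ac\<phi>] ac_on_subset[OF ac sub]]) auto
  have i1: "integrable (lebesgue_on {a..b}) (\<lambda>x. deriv \<phi> x *\<^sub>R U x)"
    unfolding scaleR_conv_of_real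
    by (intro absolutely_integrable_imp_integrable absolutely_integrable_continuous_real continuous_intros
        smooth_continuous[OF smooth_deriv[OF \<phi>(1)]] ac_on_continuous[OF ac \<Omega>(2) ab(1,2)]) auto
  have i2: "integrable (lebesgue_on {a..b}) (\<lambda>x. \<phi> x *\<^sub>R u' x)"
    using absolutely_integrable_mult_continuous[OF ac_onD(1)[OF ac ab] continuous_on_of_real[OF smooth_continuous[OF \<phi>(1)]]]
    by (auto simp: scaleR_conv_of_real mult.commute intro: absolutely_integrable_imp_integrable)
  have "(LINT x|lebesgue_on {a..b}. deriv \<phi> x *\<^sub>R U x) + (LINT x|lebesgue_on {a..b}. \<phi> x *\<^sub>R u' x)
      = (LINT x|lebesgue_on {a..b}. complex_of_real (deriv \<phi> x) * U x + complex_of_real (\<phi> x) * u' x)"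
    using i1 i2 by (simp add: scaleR_conv_of_real)
  also have "\<dots> = integral {a..b} (\<lambda>x. complex_of_real (deriv \<phi> x) * U x + complex_of_real (\<phi> x) * u' x)"
    using i1 i2 by (intro lebesgue_integral_eq_integral) (auto simp: scaleR_conv_of_real)
  also have "\<dots> = 0" using ac_onD(3)[OF prod] ab closed by auto
  finally have "(LINT x|lebesgue_on {a..b}. deriv \<phi> x *\<^sub>R U x) = - (LINT x|lebesgue_on {a..b}. \<phi> x *\<^sub>R u' x)"
    by (simp add: eq_neg_iff_add_eq_0)
  moreover have "(LINT x|lebesgue_on \<Omega>. deriv \<phi> x *\<^sub>R U x) = (LINT x|lebesgue_on {a..b}. deriv \<phi> x *\<^sub>R U x)"
    "integrable (lebesgue_on \<Omega>) (\<lambda>x. deriv \<phi> x *\<^sub>R U x) = integrable (lebesgue_on {a..b}) (\<lambda>x. deriv \<phi> x *\<^sub>R U x)"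
    by (rule lebesgue_on_zero_outside; use sub \<Omega>(1) d0 in simp)+
  moreover have "(LINT x|lebesgue_on \<Omega>. \<phi> x *\<^sub>R u' x) = (LINT x|lebesgue_on {a..b}. \<phi> x *\<^sub>R u' x)"
    "integrable (lebesgue_on \<Omega>) (\<lambda>x. \<phi> x *\<^sub>R u' x) = integrable (lebesgue_on {a..b}) (\<lambda>x. \<phi> x *\<^sub>R u' x)"
    by (rule lebesgue_on_zero_outside; use sub \<Omega>(1) \<phi>(2) in simp)+
  ultimately show "(LINT x|lebesgue_on \<Omega>. deriv \<phi> x *\<^sub>R U x) = - (LINT x|lebesgue_on \<Omega>. \<phi> x *\<^sub>R u' x)"
    "integrable (lebesgue_on \<Omega>) (\<lambda>x. deriv \<phi> x *\<^sub>R U x)"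
    "integrable (lebesgue_on \<Omega>) (\<lambda>x. \<phi> x *\<^sub>R u' x)"
    using i1 i2 by simp_all
qed

text \<open>The criterion by which nontrivial elements of H^1 are produced later: truncated
  functions, linear combinations and smooth functions all come with an explicit absolutely
  continuous representative.\<close>

lemma H1_deriv_if_ac_on:
  assumes \<Omega>: "open \<Omega>" "convex \<Omega>" "\<Omega> \<noteq> {}" and L2: "u \<in> L2 \<Omega>" "u' \<in> L2 \<Omega>"
    and ac: "ac_on \<Omega> U u'" and ae: "AE x in lebesgue_on \<Omega>. u x = U x"
  shows "H1_deriv \<Omega> u u'"
  unfolding H1_deriv_def
proof (intro conjI L2 allI impI)
  fix \<phi> assume t: "test_function \<Omega> \<phi>"
  obtain a b where ab: "a \<le> b" "a \<in> \<Omega>" "b \<in> \<Omega>" and \<phi>: "\<And>x. x \<notin> {a..b} \<Longrightarrow> \<phi> x = 0" "smooth \<phi>"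
    using test_functionE[OF t \<Omega>(2,3)] by blast
  have \<Omega>s: "\<Omega> \<in> sets lebesgue" using \<Omega>(1) by simp
  note ibp = ac_on_integration_by_parts_compact_support[OF \<Omega>s \<Omega>(2) ac ab(2,3,1) \<phi>(2,1)]
  have [measurable]: "u \<in> borel_measurable (lebesgue_on \<Omega>)" using L2 by (auto simp: L2_def)
  have [measurable]: "deriv \<phi> \<in> borel_measurable (lebesgue_on \<Omega>)"
    by (intro continuous_imp_measurable_on_sets_lebesgue smooth_continuous smooth_deriv \<phi>(2) \<Omega>s)
  have "(LINT x|lebesgue_on \<Omega>. deriv \<phi> x *\<^sub>R u x) = (LINT x|lebesgue_on \<Omega>. deriv \<phi> x *\<^sub>R U x)"
    using ae ibp(2) by (intro integral_cong_AE) (auto elim!: AE_mp)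
  then show "(LINT x|lebesgue_on \<Omega>. deriv \<phi> x *\<^sub>R u x) = - (LINT x|lebesgue_on \<Omega>. \<phi> x *\<^sub>R u' x)"
    using ibp(1) by simp
qed

text \<open>An indefinite integral \<open>G\<close> of \<open>u'\<close> has the same weak
  derivative as \<open>u\<close>, so \<open>u - G\<close> has weak derivative zero and is constant
  almost everywhere.\<close>

lemma H1_ac_representative:
  assumes \<Omega>: "open \<Omega>" "convex \<Omega>" "\<Omega> \<noteq> {}" and H: "H1_deriv \<Omega> u u'"
  obtains U where "ac_on \<Omega> U u'" "AE x in lebesgue_on \<Omega>. u x = U x"
proof -
  have \<Omega>s: "\<Omega> \<in> sets lebesgue" using \<Omega>(1) by simp
  have L2: "u \<in> L2 \<Omega>" "u' \<in> L2 \<Omega>" using H by (auto simp: H1_deriv_def)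
  have ui: "u absolutely_integrable_on {a..b}" "u' absolutely_integrable_on {a..b}" if "{a..b} \<subseteq> \<Omega>" for a b
    using L2_absolutely_integrable_on_interval[OF _ that \<Omega>s] L2 by auto
  obtain G where G: "ac_on \<Omega> G u'" using ac_on_indefinite_integral[OF \<Omega>(2), of u'] ui(2) by blast
  have "\<exists>c. AE x in lebesgue_on \<Omega>. u x - G x = c"
  proof (rule zero_weak_derivative_imp_AE_const[OF \<Omega>])
    show "(\<lambda>x. u x - G x) absolutely_integrable_on {a..b}" if ab: "{a..b} \<subseteq> \<Omega>" for a b
    proof (cases "a \<le> b")
      case True
      then have "a \<in> \<Omega>" "b \<in> \<Omega>" using ab by auto
      then show ?thesis
        by (intro set_integral_diff ui(1)[OF ab] absolutely_integrable_continuous_real ac_on_continuous[OF G \<Omega>(2)])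
    qed simp
    fix \<phi> assume t: "test_function \<Omega> \<phi>"
    obtain a b where ab: "a \<le> b" "a \<in> \<Omega>" "b \<in> \<Omega>" and \<phi>: "\<And>x. x \<notin> {a..b} \<Longrightarrow> \<phi> x = 0" "smooth \<phi>"
      using test_functionE[OF t \<Omega>(2,3)] by blast
    have sub: "{a..b} \<subseteq> \<Omega>" by (rule convex_interval_subset[OF \<Omega>(2) ab(2,3)])
    note ibp = ac_on_integration_by_parts_compact_support[OF \<Omega>s \<Omega>(2) G ab(2,3,1) \<phi>(2,1)]
    have d0: "deriv \<phi> x = 0" if "x \<notin> {a..b}" for x by (rule deriv_zero_outside[OF \<phi>(1) that])
    have "(\<lambda>x. u x * of_real (deriv \<phi> x)) absolutely_integrable_on {a..b}"
      by (intro absolutely_integrable_mult_continuous ui(1)[OF sub] continuous_on_of_real smooth_continuous smooth_deriv \<phi>(2))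
    then have "integrable (lebesgue_on {a..b}) (\<lambda>x. deriv \<phi> x *\<^sub>R u x)"
      by (simp add: absolutely_integrable_iff_lebesgue_on scaleR_conv_of_real mult.commute)
    moreover have "integrable (lebesgue_on \<Omega>) (\<lambda>x. deriv \<phi> x *\<^sub>R u x) = integrable (lebesgue_on {a..b}) (\<lambda>x. deriv \<phi> x *\<^sub>R u x)"
      by (rule lebesgue_on_zero_outside(2)) (use sub \<Omega>s d0 in auto)
    ultimately have iu: "integrable (lebesgue_on \<Omega>) (\<lambda>x. deriv \<phi> x *\<^sub>R u x)" by simp
    show "(LINT x|lebesgue_on \<Omega>. deriv \<phi> x *\<^sub>R (u x - G x)) = 0"
      using iu ibp(1,2) H t by (simp add: scaleR_diff_right H1_deriv_def)
  qed
  then obtain c where c: "AE x in lebesgue_on \<Omega>. u x - G x = c" by blast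
  show ?thesis
  proof
    show "ac_on \<Omega> (\<lambda>x. G x + c) u'" using ac_on_add[OF G ac_on_const[of \<Omega> c]] by simp
    show "AE x in lebesgue_on \<Omega>. u x = G x + c" using c by eventually_elim (auto simp: algebra_simps)
  qed
qed

section \<open>Square integrable functions\<close>

lemma L2_norm_nonneg [simp]: "0 \<le> L2_norm \<Omega> f"
  by (simp add: L2_norm_def)

lemma L2_norm_squared: "(L2_norm \<Omega> f)\<^sup>2 = (LINT x|lebesgue_on \<Omega>. (cmod (f x))\<^sup>2)"
  by (simp add: L2_norm_def)

lemma L2D:
  assumes "f \<in> L2 \<Omega>"
  shows "f \<in> borel_measurable (lebesgue_on \<Omega>)" "integrable (lebesgue_on \<Omega>) (\<lambda>x. (cmod (f x))\<^sup>2)"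
  using assms by (auto simp: L2_def)

lemma L2_bound:
  assumes "h \<in> borel_measurable (lebesgue_on \<Omega>)" "integrable (lebesgue_on \<Omega>) B"
    "\<And>x. (cmod (h x))\<^sup>2 \<le> B x"
  shows "h \<in> L2 \<Omega>"
proof -
  have "integrable (lebesgue_on \<Omega>) (\<lambda>x. (cmod (h x))\<^sup>2)"
    by (rule Bochner_Integration.integrable_bound[OF assms(2)])
      (use assms(1,3) in \<open>auto intro!: AE_I2 intro: order_trans[OF _ abs_ge_self]\<close>)
  then show ?thesis using assms(1) by (simp add: L2_def)
qed

lemma cmod_add_squared_le: "(cmod (a + b))\<^sup>2 \<le> 2 * (cmod a)\<^sup>2 + 2 * (cmod b)\<^sup>2"
proof -
  have "(cmod (a + b))\<^sup>2 \<le> (cmod a + cmod b)\<^sup>2" by (intro power_mono norm_triangle_ineq) auto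
  also have "\<dots> \<le> 2 * (cmod a)\<^sup>2 + 2 * (cmod b)\<^sup>2"
    using sum_squares_bound[of "cmod a" "cmod b"] by (simp add: power2_sum)
  finally show ?thesis .
qed

lemma L2_add:
  assumes "f \<in> L2 \<Omega>" "g \<in> L2 \<Omega>" shows "(\<lambda>x. f x + g x) \<in> L2 \<Omega>"
  by (rule L2_bound[where B="\<lambda>x. 2 * (cmod (f x))\<^sup>2 + 2 * (cmod (g x))\<^sup>2"])
    (use L2D[OF assms(1)] L2D[OF assms(2)] in \<open>auto intro: cmod_add_squared_le\<close>)

lemma L2_cmult: "f \<in> L2 \<Omega> \<Longrightarrow> (\<lambda>x. c * f x) \<in> L2 \<Omega>"
  by (auto simp: L2_def norm_mult power_mult_distrib)

lemma L2_zero: "(\<lambda>_. 0) \<in> L2 \<Omega>"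
  by (auto simp: L2_def)

lemma L2_diff: "f \<in> L2 \<Omega> \<Longrightarrow> g \<in> L2 \<Omega> \<Longrightarrow> (\<lambda>x. f x - g x) \<in> L2 \<Omega>"
  using L2_add[of f \<Omega> "\<lambda>x. - 1 * g x"] L2_cmult[of g \<Omega> "-1"] by simp

lemma L2_sum: "(\<And>n::nat. n < N \<Longrightarrow> f n \<in> L2 \<Omega>) \<Longrightarrow> (\<lambda>x. \<Sum>n<N. f n x) \<in> L2 \<Omega>"
  by (induction N) (auto intro: L2_add L2_zero)

lemma L2_norm_cmult: "L2_norm \<Omega> (\<lambda>x. c * f x) = cmod c * L2_norm \<Omega> f"
  by (simp add: L2_norm_def norm_mult power_mult_distrib real_sqrt_mult)

lemma L2_norm_cong_AE:
  assumes "f \<in> L2 \<Omega>" "g \<in> L2 \<Omega>" "AE x in lebesgue_on \<Omega>. f x = g x"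
  shows "L2_norm \<Omega> f = L2_norm \<Omega> g"
  unfolding L2_norm_def
  by (rule arg_cong[where f=sqrt], rule integral_cong_AE)
    (use assms(3) L2D(1)[OF assms(1)] L2D(1)[OF assms(2)] in \<open>auto elim!: AE_mp\<close>)

lemma L2_product_integrable:
  assumes "f \<in> L2 \<Omega>" "g \<in> L2 \<Omega>"
  shows "integrable (lebesgue_on \<Omega>) (\<lambda>x. cmod (f x) * cmod (g x))"
proof (rule Bochner_Integration.integrable_bound[where f="\<lambda>x. (cmod (f x))\<^sup>2 + (cmod (g x))\<^sup>2"])
  show "AE x in lebesgue_on \<Omega>. norm (cmod (f x) * cmod (g x)) \<le> norm ((cmod (f x))\<^sup>2 + (cmod (g x))\<^sup>2)"
  proof (rule AE_I2)
    fix x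
    have "0 \<le> cmod (f x) * cmod (g x)" by simp
    then have "cmod (f x) * cmod (g x) \<le> (cmod (f x))\<^sup>2 + (cmod (g x))\<^sup>2"
      using sum_squares_bound[of "cmod (f x)" "cmod (g x)"] by linarith
    then show "norm (cmod (f x) * cmod (g x)) \<le> norm ((cmod (f x))\<^sup>2 + (cmod (g x))\<^sup>2)" by simp
  qed
qed (use L2D[OF assms(1)] L2D[OF assms(2)] in auto)

text \<open>The integral of (t |f| - |g|)^2 is a nonnegative quadratic in \<open>t\<close>. If its
  leading coefficient \<open>A\<close> is positive, \<open>t = B / A\<close> is the minimiser; if
  \<open>A = 0\<close>, a suitable \<open>t\<close> would make it negative unless
  \<open>B = 0\<close>.\<close>

lemma L2_Cauchy_Schwarz:
  assumes f: "f \<in> L2 \<Omega>" and g: "g \<in> L2 \<Omega>"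
  shows "(LINT x|lebesgue_on \<Omega>. cmod (f x) * cmod (g x)) \<le> L2_norm \<Omega> f * L2_norm \<Omega> g"
proof -
  define A where "A = (LINT x|lebesgue_on \<Omega>. (cmod (f x))\<^sup>2)"
  define B where "B = (LINT x|lebesgue_on \<Omega>. cmod (f x) * cmod (g x))"
  define C where "C = (LINT x|lebesgue_on \<Omega>. (cmod (g x))\<^sup>2)"
  note i = L2D(2)[OF f] L2D(2)[OF g] L2_product_integrable[OF f g]
  have nn: "A \<ge> 0" "B \<ge> 0" "C \<ge> 0" unfolding A_def B_def C_def by (auto intro!: Bochner_Integration.integral_nonneg)
  have quad: "0 \<le> t\<^sup>2 * A - 2 * t * B + C" for t
  proof -
    have "0 \<le> (LINT x|lebesgue_on \<Omega>. (t * cmod (f x) - cmod (g x))\<^sup>2)" by (rule Bochner_Integration.integral_nonneg) simp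
    also have "\<dots> = (LINT x|lebesgue_on \<Omega>. t\<^sup>2 * (cmod (f x))\<^sup>2 - (2 * t) * (cmod (f x) * cmod (g x)) + (cmod (g x))\<^sup>2)"
      by (intro Bochner_Integration.integral_cong) (auto simp: power2_eq_square algebra_simps)
    also have "\<dots> = t\<^sup>2 * A - 2 * t * B + C"
      unfolding A_def B_def C_def using i by simp
    finally show ?thesis .
  qed
  have "B\<^sup>2 \<le> A * C"
  proof (cases "A = 0")
    case True
    have "B = 0"
    proof (rule ccontr)
      assume "B \<noteq> 0"
      then have "2 * ((C + 1) / (2 * B)) * B = C + 1" by (simp add: field_simps)
      then show False using quad[of "(C + 1) / (2 * B)"] True by simp
    qed
    then show ?thesis using nn by simp
  next
    case False
    then have "A > 0" using nn by simp
    have "(B / A)\<^sup>2 * A - 2 * (B / A) * B + C = C - B\<^sup>2 / A"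
      using False by (simp add: power2_eq_square field_simps)
    then have "B\<^sup>2 / A \<le> C" using quad[of "B / A"] by linarith
    then show ?thesis using \<open>A > 0\<close> by (simp add: pos_divide_le_eq mult.commute)
  qed
  then have "B \<le> sqrt (A * C)" using nn real_le_rsqrt by blast
  then show ?thesis unfolding L2_norm_def A_def[symmetric] B_def[symmetric] C_def[symmetric]
    by (simp add: real_sqrt_mult)
qed

lemma L2_norm_triangle:
  assumes f: "f \<in> L2 \<Omega>" and g: "g \<in> L2 \<Omega>"
  shows "L2_norm \<Omega> (\<lambda>x. f x + g x) \<le> L2_norm \<Omega> f + L2_norm \<Omega> g"
proof -
  note i = L2D(2)[OF f] L2D(2)[OF g] L2_product_integrable[OF f g]
  have "(L2_norm \<Omega> (\<lambda>x. f x + g x))\<^sup>2 \<le> (LINT x|lebesgue_on \<Omega>. (cmod (f x))\<^sup>2 + 2 * (cmod (f x) * cmod (g x)) + (cmod (g x))\<^sup>2)"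
    unfolding L2_norm_squared
  proof (rule Bochner_Integration.integral_mono)
    fix x
    have "(cmod (f x + g x))\<^sup>2 \<le> (cmod (f x) + cmod (g x))\<^sup>2" by (intro power_mono norm_triangle_ineq) auto
    then show "(cmod (f x + g x))\<^sup>2 \<le> (cmod (f x))\<^sup>2 + 2 * (cmod (f x) * cmod (g x)) + (cmod (g x))\<^sup>2"
      by (simp add: power2_sum algebra_simps)
  qed (use i L2D(2)[OF L2_add[OF f g]] in auto)
  also have "\<dots> = (L2_norm \<Omega> f)\<^sup>2 + 2 * (LINT x|lebesgue_on \<Omega>. cmod (f x) * cmod (g x)) + (L2_norm \<Omega> g)\<^sup>2"
    unfolding L2_norm_squared using i by simp
  also have "\<dots> \<le> (L2_norm \<Omega> f + L2_norm \<Omega> g)\<^sup>2"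
    using L2_Cauchy_Schwarz[OF f g] by (simp add: power2_sum)
  finally show ?thesis by (rule power2_le_imp_le) simp
qed

section \<open>Decay of semigroups from resolvent bounds\<close>

lemma DFT_Parseval:
  fixes c :: "nat \<Rightarrow> complex"
  assumes N: "N > 0"
  shows "(\<Sum>j<N. (cmod (\<Sum>n<N. cis (- 2 * pi * real j * real n / real N) * c n))\<^sup>2) = real N * (\<Sum>n<N. (cmod (c n))\<^sup>2)"
proof -
  define e where "e j n = cis (- 2 * pi * real j * real n / real N)" for j n :: nat
  have orth: "(\<Sum>j<N. e j n * cnj (e j m)) = (if n = m then of_nat N else 0)" if nm: "n < N" "m < N" for n m
  proof -
    define z where "z = cis (2 * pi * (real m - real n) / real N)"
    have ez: "e j n * cnj (e j m) = z ^ j" for j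
      unfolding e_def z_def cis_cnj cis_mult Complex.DeMoivre
      by (rule arg_cong[where f=cis]) (use N in \<open>simp add: field_simps\<close>)
    have zN: "z ^ N = 1"
    proof -
      have "z ^ N = cis (2 * pi * (real m - real n))" using N by (simp add: z_def Complex.DeMoivre)
      also have "\<dots> = 1" using cis_multiple_2pi[of "real m - real n"] by simp
      finally show ?thesis .
    qed
    show ?thesis
    proof (cases "n = m")
      case True
      then show ?thesis unfolding ez by (simp add: z_def)
    next
      case False
      \<comment> \<open>If \<open>z\<close> were 1, then \<open>N\<close> would divide
        \<open>m - n\<close>, impossible for distinct indices below \<open>N\<close>. The geometric
        sum of the powers of \<open>z\<close> therefore vanishes.\<close>
      have "z \<noteq> 1"
      proof
        assume "z = 1"
        then have "cos (2 * pi * (real m - real n) / real N) = 1" by (simp add: z_def complex_eq_iff)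
        then obtain i :: int where "2 * pi * (real m - real n) / real N = of_int i * 2 * pi"
          using cos_one_2pi_int by auto
        then have "(2 * pi) * ((real m - real n) / real N) = (2 * pi) * of_int i" by simp
        then have "(real m - real n) / real N = of_int i" by (subst (asm) mult_left_cancel) auto
        then have "real m - real n = of_int i * real N" using N by (simp add: divide_eq_eq)
        then have *: "int m - int n = i * int N" by (metis of_int_diff of_int_eq_iff of_int_mult of_int_of_nat_eq)
        have "i = 0"
        proof (rule ccontr)
          assume "i \<noteq> 0"
          then have "1 \<le> \<bar>i\<bar>" by linarith
          then have "int N \<le> \<bar>i * int N\<bar>" using mult_right_mono[of 1 "\<bar>i\<bar>" "int N"] by (simp add: abs_mult)
          then show False using nm unfolding *[symmetric] by linarith
        qed
        then show False using * False by simp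
      qed
      then show ?thesis unfolding ez using False zN by (simp add: sum_gp_strict)
    qed
  qed
  have "complex_of_real (\<Sum>j<N. (cmod (\<Sum>n<N. e j n * c n))\<^sup>2) = (\<Sum>j<N. (\<Sum>n<N. e j n * c n) * cnj (\<Sum>m<N. e j m * c m))"
    unfolding of_real_sum by (intro sum.cong refl) (rule complex_norm_square)
  also have "\<dots> = (\<Sum>j<N. \<Sum>n<N. \<Sum>m<N. c n * cnj (c m) * (e j n * cnj (e j m)))"
    by (simp add: sum_product mult_ac)
  also have "\<dots> = (\<Sum>n<N. \<Sum>m<N. \<Sum>j<N. c n * cnj (c m) * (e j n * cnj (e j m)))"
    by (subst sum.swap) (intro sum.cong refl sum.swap)
  also have "\<dots> = (\<Sum>n<N. \<Sum>m<N. c n * cnj (c m) * (if n = m then of_nat N else 0))"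
    by (intro sum.cong refl) (simp add: sum_distrib_left[symmetric] orth del: sum_distrib_left)
  also have "\<dots> = (\<Sum>n<N. c n * cnj (c n) * of_nat N)"
    by (intro sum.cong refl) (simp add: if_distrib[of "\<lambda>x. _ * x"] sum.delta cong: if_cong)
  also have "\<dots> = complex_of_real (real N * (\<Sum>n<N. (cmod (c n))\<^sup>2))"
    by (simp add: complex_norm_square[symmetric] sum_distrib_left mult.commute)
  finally show ?thesis unfolding e_def of_real_eq_iff .
qed

text \<open>The discrete Fourier transform turns the cyclic backward difference into multiplication by
  \<open>z = (1 - \<omega>) / \<tau>\<close> with \<open>\<omega>\<close> a root of unity; \<open>Re z \<ge> 0\<close>, so the resolvent bound applies to each mode.
  Working with finitely many times avoids integrating functions with values in \<open>L\<^sup>2\<close>.\<close>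

lemma cyclic_energy_estimate:
  fixes Rel :: "(real \<Rightarrow> complex) \<Rightarrow> (real \<Rightarrow> complex) \<Rightarrow> bool"
  assumes L2: "\<And>g h. Rel g h \<Longrightarrow> g \<in> L2 \<Omega> \<and> h \<in> L2 \<Omega>"
    and lin: "\<And>N a g h. (\<And>n::nat. n < N \<Longrightarrow> Rel (g n) (h n)) \<Longrightarrow>
        Rel (\<lambda>x. \<Sum>n<N. a n * g n x) (\<lambda>x. \<Sum>n<N. a n * h n x)"
    and res: "\<And>g h z. Rel g h \<Longrightarrow> 0 \<le> Re z \<Longrightarrow> \<Psi> * L2_norm \<Omega> g \<le> L2_norm \<Omega> (\<lambda>x. h x + z * g x)"
    and \<Psi>: "\<Psi> \<ge> 0" and \<tau>: "\<tau> > 0" and f: "\<And>n::nat. n < N \<Longrightarrow> Rel (f n) (k n)"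
  shows "\<Psi>\<^sup>2 * (\<Sum>n<N. (L2_norm \<Omega> (f n))\<^sup>2) \<le>
    (\<Sum>n<N. (L2_norm \<Omega> (\<lambda>x. (f n x - f (if n = 0 then N - 1 else n - 1) x) / of_real \<tau> + k n x))\<^sup>2)"
proof (cases "N = 0")
  case False
  then obtain M where N: "N = Suc M" using not0_implies_Suc by auto
  define e where "e j n = cis (- 2 * pi * real j * real n / real N)" for j n :: nat
  define p where "p n x = (f n x - f (if n = 0 then N - 1 else n - 1) x) / of_real \<tau> + k n x" for n x
  define z where "z j = (1 - e j 1) / complex_of_real \<tau>" for j
  define u where "u j x = (\<Sum>n<N. e j n * f n x)" for j x
  define q where "q j x = (\<Sum>n<N. e j n * p n x)" for j x
  have fL: "f n \<in> L2 \<Omega>" "k n \<in> L2 \<Omega>" if "n < N" for n using L2[OF f[OF that]] by auto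
  have pL: "p n \<in> L2 \<Omega>" if "n < N" for n
  proof -
    have "(\<lambda>x. (1 / of_real \<tau>) * (f n x - f (if n = 0 then N - 1 else n - 1) x) + k n x) \<in> L2 \<Omega>"
      using that by (intro L2_add L2_cmult L2_diff fL) auto
    then show ?thesis by (simp add: p_def[abs_def])
  qed
  have uL: "u j \<in> L2 \<Omega>" and qL: "q j \<in> L2 \<Omega>" for j
    unfolding u_def[abs_def] q_def[abs_def] by (intro L2_sum L2_cmult fL pL; assumption)+
  \<comment> \<open>The predecessor of index 0 is \<open>N - 1\<close>, so the shift is a cyclic
    permutation and acts on the \<open>j\<close>-th mode as multiplication by \<open>e j 1\<close>.
    The relation \<open>e j N = 1\<close> closes the circle.\<close>
  have shift: "(\<Sum>n<N. e j n * f (if n = 0 then N - 1 else n - 1) x) = e j 1 * u j x" for j x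
  proof -
    have e1: "e j (Suc n) = e j 1 * e j n" for n
      unfolding e_def cis_mult by (rule arg_cong[where f=cis]) (use False in \<open>simp add: field_simps\<close>)
    have "e j N = cis (2 * pi * (- real j))" using False by (simp add: e_def)
    also have "\<dots> = 1" using cis_multiple_2pi[of "- real j"] by simp
    finally have eN: "e j (Suc M) = 1" using N by simp
    have "(\<Sum>n<N. e j n * f (if n = 0 then N - 1 else n - 1) x) = e j 0 * f M x + (\<Sum>n<M. e j (Suc n) * f n x)"
      unfolding N sum.lessThan_Suc_shift by simp
    also have "\<dots> = (\<Sum>n<Suc M. e j (Suc n) * f n x)"
      using eN by (simp add: e_def[of j 0])
    finally show ?thesis unfolding u_def N e1 by (simp only: sum_distrib_left mult.assoc)
  qed
  have q_eq: "q j x = (\<Sum>n<N. e j n * k n x) + z j * u j x" for j x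
  proof -
    have "q j x = ((\<Sum>n<N. e j n * f n x) - (\<Sum>n<N. e j n * f (if n = 0 then N - 1 else n - 1) x)) / of_real \<tau> + (\<Sum>n<N. e j n * k n x)"
      unfolding q_def p_def
      by (simp only: distrib_left sum.distrib sum_subtractf[symmetric] sum_divide_distrib times_divide_eq_right right_diff_distrib)
    then show ?thesis unfolding shift u_def[symmetric] z_def by (simp add: algebra_simps diff_divide_distrib)
  qed
  have Rez: "0 \<le> Re (z j)" for j
    using \<tau> cos_le_one[of "- 2 * pi * real j / real N"] by (simp add: z_def e_def)
  have step: "\<Psi>\<^sup>2 * (LINT x|lebesgue_on \<Omega>. (cmod (u j x))\<^sup>2) \<le> (LINT x|lebesgue_on \<Omega>. (cmod (q j x))\<^sup>2)" for j
  proof -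
    have "\<Psi> * L2_norm \<Omega> (u j) \<le> L2_norm \<Omega> (q j)"
      unfolding u_def[abs_def] q_eq[abs_def] using res[OF lin[OF f] Rez] by simp
    then have "(\<Psi> * L2_norm \<Omega> (u j))\<^sup>2 \<le> (L2_norm \<Omega> (q j))\<^sup>2" using \<Psi> by (intro power_mono) auto
    then show ?thesis by (simp add: power_mult_distrib L2_norm_squared)
  qed
  have parseval: "(\<Sum>j<N. (LINT x|lebesgue_on \<Omega>. (cmod (\<Sum>n<N. e j n * w n x))\<^sup>2)) = real N * (\<Sum>n<N. (L2_norm \<Omega> (w n))\<^sup>2)"
    if w: "\<And>n. n < N \<Longrightarrow> w n \<in> L2 \<Omega>" for w
  proof -
    have wL: "(\<lambda>x. \<Sum>n<N. e j n * w n x) \<in> L2 \<Omega>" for j by (intro L2_sum L2_cmult w)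
    have "(\<Sum>j<N. (LINT x|lebesgue_on \<Omega>. (cmod (\<Sum>n<N. e j n * w n x))\<^sup>2)) = (LINT x|lebesgue_on \<Omega>. (\<Sum>j<N. (cmod (\<Sum>n<N. e j n * w n x))\<^sup>2))"
      by (rule Bochner_Integration.integral_sum[symmetric]) (rule L2D(2)[OF wL])
    also have "\<dots> = (LINT x|lebesgue_on \<Omega>. real N * (\<Sum>n<N. (cmod (w n x))\<^sup>2))"
      using False unfolding e_def by (subst DFT_Parseval) auto
    also have "\<dots> = real N * (\<Sum>n<N. (L2_norm \<Omega> (w n))\<^sup>2)"
      unfolding L2_norm_squared using L2D(2)[OF w] by (simp add: Bochner_Integration.integral_sum)
    finally show ?thesis .
  qed
  have "real N * (\<Psi>\<^sup>2 * (\<Sum>n<N. (L2_norm \<Omega> (f n))\<^sup>2)) = (\<Sum>j<N. \<Psi>\<^sup>2 * (LINT x|lebesgue_on \<Omega>. (cmod (u j x))\<^sup>2))"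
    using parseval[of f, OF fL(1)] unfolding u_def sum_distrib_left[symmetric] by simp
  also have "\<dots> \<le> (\<Sum>j<N. (LINT x|lebesgue_on \<Omega>. (cmod (q j x))\<^sup>2))" by (rule sum_mono) (rule step)
  also have "\<dots> = real N * (\<Sum>n<N. (L2_norm \<Omega> (p n))\<^sup>2)"
    unfolding q_def by (rule parseval[OF pL])
  finally show ?thesis using False by (simp add: p_def[abs_def])
qed simp

section \<open>Sampled orbits of a contraction semigroup\<close>

lemma contraction_semigroupD:
  assumes "contraction_semigroup \<Omega> T"
  shows "t \<ge> 0 \<Longrightarrow> f \<in> L2 \<Omega> \<Longrightarrow> T t f \<in> L2 \<Omega>"
    and "t \<ge> 0 \<Longrightarrow> f \<in> L2 \<Omega> \<Longrightarrow> L2_norm \<Omega> (T t f) \<le> L2_norm \<Omega> f"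
    and "t \<ge> 0 \<Longrightarrow> f \<in> L2 \<Omega> \<Longrightarrow> g \<in> L2 \<Omega> \<Longrightarrow>
      AE x in lebesgue_on \<Omega>. T t (\<lambda>y. a * f y + b * g y) x = a * T t f x + b * T t g x"
    and "f \<in> L2 \<Omega> \<Longrightarrow> AE x in lebesgue_on \<Omega>. T 0 f x = f x"
    and "s \<ge> 0 \<Longrightarrow> t \<ge> 0 \<Longrightarrow> f \<in> L2 \<Omega> \<Longrightarrow> AE x in lebesgue_on \<Omega>. T (s + t) f x = T s (T t f) x"
    and "f \<in> L2 \<Omega> \<Longrightarrow> ((\<lambda>t. L2_norm \<Omega> (\<lambda>x. T t f x - f x)) \<longlongrightarrow> 0) (at_right 0)"
  using assms unfolding contraction_semigroup_def by blast+

text \<open>\<open>T s\<close> carries the error of the difference quotient at \<open>f\<close> to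
  the error at \<open>T s f\<close>, and a contraction cannot increase it. Linearity is available
  only almost everywhere and for two summands, so the error is first rearranged into nested
  combinations.\<close>

lemma generator_semigroup_orbit:
  assumes sg: "contraction_semigroup \<Omega> T" and gen: "generator \<Omega> T f h" and s: "s \<ge> 0"
  shows "generator \<Omega> T (T s f) (T s h)"
proof -
  note sgD = contraction_semigroupD[OF sg]
  have f: "f \<in> L2 \<Omega>" and h: "h \<in> L2 \<Omega>"
    and lim: "((\<lambda>t. L2_norm \<Omega> (\<lambda>x. (T t f x - f x) / complex_of_real t - h x)) \<longlongrightarrow> 0) (at_right 0)"
    using gen by (auto simp: generator_def)
  have "((\<lambda>t. L2_norm \<Omega> (\<lambda>x. (T t (T s f) x - T s f x) / complex_of_real t - T s h x)) \<longlongrightarrow> 0) (at_right 0)"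
  proof (rule tendsto_sandwich[OF _ _ tendsto_const lim])
    show "\<forall>\<^sub>F t in at_right 0. L2_norm \<Omega> (\<lambda>x. (T t (T s f) x - T s f x) / complex_of_real t - T s h x)
        \<le> L2_norm \<Omega> (\<lambda>x. (T t f x - f x) / complex_of_real t - h x)"
    proof (rule eventually_mono[OF eventually_at_right_less])
      fix t :: real assume t: "0 < t"
      define c where "c = 1 / complex_of_real t"
      define w where "w x = - c * f x + - 1 * h x" for x
      have w: "w \<in> L2 \<Omega>" unfolding w_def[abs_def] by (intro L2_add L2_cmult f h)
      have Tt: "T t f \<in> L2 \<Omega>" "T t (T s f) \<in> L2 \<Omega>" "T s f \<in> L2 \<Omega>" "T s h \<in> L2 \<Omega>"
        using t s f h by (auto intro!: sgD(1))
      have eq0: "(\<lambda>x. (T t f x - f x) / complex_of_real t - h x) = (\<lambda>x. c * T t f x + 1 * w x)"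
        by (auto simp: w_def c_def diff_divide_distrib)
      have eq1: "(\<lambda>x. (T t (T s f) x - T s f x) / complex_of_real t - T s h x) = (\<lambda>x. c * T t (T s f) x + - c * T s f x + - 1 * T s h x)"
        by (auto simp: c_def diff_divide_distrib)
      have L: "(\<lambda>x. c * T t f x + 1 * w x) \<in> L2 \<Omega>" by (intro L2_add L2_cmult Tt w)
      have "AE x in lebesgue_on \<Omega>. T s (\<lambda>x. c * T t f x + 1 * w x) x = c * T t (T s f) x + - c * T s f x + - 1 * T s h x"
      proof -
        have a: "AE x in lebesgue_on \<Omega>. T s (\<lambda>x. c * T t f x + 1 * w x) x = c * T s (T t f) x + 1 * T s w x"
          by (rule sgD(3)[OF s Tt(1) w])
        have b: "AE x in lebesgue_on \<Omega>. T s w x = - c * T s f x + - 1 * T s h x"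
          unfolding w_def[abs_def] by (rule sgD(3)[OF s f h])
        have d: "AE x in lebesgue_on \<Omega>. T (s + t) f x = T s (T t f) x" by (rule sgD(5)) (use s t f in auto)
        have e: "AE x in lebesgue_on \<Omega>. T (t + s) f x = T t (T s f) x" by (rule sgD(5)) (use s t f in auto)
        show ?thesis using a b d e by eventually_elim (simp add: add.commute)
      qed
      then have "L2_norm \<Omega> (\<lambda>x. c * T t (T s f) x + - c * T s f x + - 1 * T s h x) = L2_norm \<Omega> (T s (\<lambda>x. c * T t f x + 1 * w x))"
        by (intro L2_norm_cong_AE[symmetric] sgD(1) s L L2_add L2_cmult Tt)
      also have "\<dots> \<le> L2_norm \<Omega> (\<lambda>x. c * T t f x + 1 * w x)" by (rule sgD(2)[OF s L])
      finally show "L2_norm \<Omega> (\<lambda>x. (T t (T s f) x - T s f x) / complex_of_real t - T s h x)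
        \<le> L2_norm \<Omega> (\<lambda>x. (T t f x - f x) / complex_of_real t - h x)" unfolding eq0 eq1 .
    qed
  qed simp
  then show ?thesis using sgD(1)[OF s] f h by (simp add: generator_def)
qed

text \<open>The residual of an implicit Euler step at time \<open>s\<close> is \<open>T s\<close>
  applied to the residual at time 0, hence bounded uniformly in \<open>s\<close>. Evaluating
  \<open>q\<close> at the end of the step, as the backward difference requires, costs the second
  term on the right.\<close>

lemma semigroup_Euler_residual:
  assumes sg: "contraction_semigroup \<Omega> T" and g: "g \<in> L2 \<Omega>" and q: "q \<in> L2 \<Omega>" and \<tau>: "\<tau> > 0" and s: "s \<ge> 0"
  shows "L2_norm \<Omega> (\<lambda>x. (T (s + \<tau>) g x - T s g x) / complex_of_real \<tau> - T (s + \<tau>) q x)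
    \<le> L2_norm \<Omega> (\<lambda>x. (T \<tau> g x - g x) / complex_of_real \<tau> - q x) + L2_norm \<Omega> (\<lambda>x. T \<tau> q x - q x)"
proof -
  note sgD = contraction_semigroupD[OF sg]
  define c where "c = 1 / complex_of_real \<tau>"
  define w where "w x = - c * g x + - 1 * T \<tau> q x" for x
  have Tt: "T \<tau> g \<in> L2 \<Omega>" "T \<tau> q \<in> L2 \<Omega>" "T s g \<in> L2 \<Omega>" "T (s + \<tau>) g \<in> L2 \<Omega>" "T (s + \<tau>) q \<in> L2 \<Omega>"
    using \<tau> s g q by (auto intro!: sgD(1))
  have w: "w \<in> L2 \<Omega>" unfolding w_def[abs_def] by (intro L2_add L2_cmult g Tt)
  have L: "(\<lambda>x. c * T \<tau> g x + 1 * w x) \<in> L2 \<Omega>" by (intro L2_add L2_cmult Tt w)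
  have eq1: "(\<lambda>x. (T (s + \<tau>) g x - T s g x) / complex_of_real \<tau> - T (s + \<tau>) q x)
      = (\<lambda>x. c * T (s + \<tau>) g x + - c * T s g x + - 1 * T (s + \<tau>) q x)"
    by (auto simp: c_def diff_divide_distrib)
  have "AE x in lebesgue_on \<Omega>. T s (\<lambda>x. c * T \<tau> g x + 1 * w x) x = c * T (s + \<tau>) g x + - c * T s g x + - 1 * T (s + \<tau>) q x"
  proof -
    have a: "AE x in lebesgue_on \<Omega>. T s (\<lambda>x. c * T \<tau> g x + 1 * w x) x = c * T s (T \<tau> g) x + 1 * T s w x"
      by (rule sgD(3)[OF s Tt(1) w])
    have b: "AE x in lebesgue_on \<Omega>. T s w x = - c * T s g x + - 1 * T s (T \<tau> q) x"
      unfolding w_def[abs_def] by (rule sgD(3)[OF s g Tt(2)])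
    have d: "AE x in lebesgue_on \<Omega>. T (s + \<tau>) g x = T s (T \<tau> g) x" by (rule sgD(5)) (use s \<tau> g in auto)
    have e: "AE x in lebesgue_on \<Omega>. T (s + \<tau>) q x = T s (T \<tau> q) x" by (rule sgD(5)) (use s \<tau> q in auto)
    show ?thesis using a b d e by eventually_elim simp
  qed
  then have "L2_norm \<Omega> (\<lambda>x. c * T (s + \<tau>) g x + - c * T s g x + - 1 * T (s + \<tau>) q x) = L2_norm \<Omega> (T s (\<lambda>x. c * T \<tau> g x + 1 * w x))"
    by (intro L2_norm_cong_AE[symmetric] sgD(1) s L L2_add L2_cmult Tt)
  also have "\<dots> \<le> L2_norm \<Omega> (\<lambda>x. c * T \<tau> g x + 1 * w x)" by (rule sgD(2)[OF s L])
  also have "(\<lambda>x. c * T \<tau> g x + 1 * w x) = (\<lambda>x. (c * T \<tau> g x + - c * g x + - 1 * q x) + - 1 * (T \<tau> q x - q x))"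
    by (auto simp: w_def)
  also have "L2_norm \<Omega> \<dots> \<le> L2_norm \<Omega> (\<lambda>x. c * T \<tau> g x + - c * g x + - 1 * q x) + L2_norm \<Omega> (\<lambda>x. - 1 * (T \<tau> q x - q x))"
    by (intro L2_norm_triangle L2_add L2_cmult L2_diff Tt g q)
  also have "L2_norm \<Omega> (\<lambda>x. - 1 * (T \<tau> q x - q x)) = L2_norm \<Omega> (\<lambda>x. T \<tau> q x - q x)"
    by (subst L2_norm_cmult) simp
  also have "(\<lambda>x. c * T \<tau> g x + - c * g x + - 1 * q x) = (\<lambda>x. (T \<tau> g x - g x) / complex_of_real \<tau> - q x)"
    by (auto simp: c_def diff_divide_distrib)
  finally show ?thesis unfolding eq1 .
qed

text \<open>Ramps of \<open>M\<close> steps at both ends of a period of \<open>7 * M\<close> steps.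
  The formula vanishes at 0 and at \<open>7 * M\<close>, so its periodic continuation has no
  jump.\<close>

definition trapezoid :: "nat \<Rightarrow> nat \<Rightarrow> real" where
  "trapezoid M n = min 1 (min (real n / real M) ((7 * real M - real n) / real M))"

lemma trapezoid_bounds:
  assumes "M > 0" "n \<le> 7 * M"
  shows "0 \<le> trapezoid M n" "trapezoid M n \<le> 1"
proof -
  have "real n \<le> 7 * real M" using assms(2) by (metis of_nat_le_iff of_nat_mult of_nat_numeral)
  then show "0 \<le> trapezoid M n" "trapezoid M n \<le> 1" using assms(1) by (auto simp: trapezoid_def)
qed

lemma trapezoid_increment:
  assumes "M > 0" shows "\<bar>trapezoid M (Suc n) - trapezoid M n\<bar> \<le> 1 / real M"
proof -
  have *: "\<bar>min 1 (min (x + h) (7 - (x + h))) - min 1 (min x (7 - x))\<bar> \<le> h" if "h \<ge> 0" for x h :: real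
    using that by linarith
  have "trapezoid M k = min 1 (min (real k / real M) (7 - real k / real M))" for k
    using assms by (simp add: trapezoid_def diff_divide_distrib)
  then show ?thesis using *[of "1 / real M" "real n / real M"] by (simp add: add_divide_distrib add.commute)
qed

lemma trapezoid_plateau: "M > 0 \<Longrightarrow> M \<le> n \<Longrightarrow> n \<le> 6 * M \<Longrightarrow> trapezoid M n = 1"
proof -
  assume M: "M > 0" "M \<le> n" "n \<le> 6 * M"
  have "real M \<le> real n" "real n \<le> 6 * real M" using M by (simp, metis of_nat_le_iff of_nat_mult of_nat_numeral)
  then have "1 \<le> real n / real M" "1 \<le> (7 * real M - real n) / real M" using M(1) by (simp_all add: le_divide_eq)
  then show ?thesis by (simp add: trapezoid_def)
qed

text \<open>The orbit is sampled at step \<open>\<tau> = 1 / (\<Psi> M)\<close> up to time \<open>7 / \<Psi>\<close> and cut off by a trapezoid, which is constant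
  on a stretch of length \<open>5 / \<Psi>\<close> and has slope at most \<open>\<Psi>\<close> elsewhere.\<close>

lemma semigroup_decay_generator_domain:
  assumes sg: "contraction_semigroup \<Omega> T"
    and Rel: "\<And>f h. generator \<Omega> T f h \<Longrightarrow> Rel f (\<lambda>x. - h x)"
    and L2: "\<And>g h. Rel g h \<Longrightarrow> g \<in> L2 \<Omega> \<and> h \<in> L2 \<Omega>"
    and lin: "\<And>N a g h. (\<And>n::nat. n < N \<Longrightarrow> Rel (g n) (h n)) \<Longrightarrow>
        Rel (\<lambda>x. \<Sum>n<N. a n * g n x) (\<lambda>x. \<Sum>n<N. a n * h n x)"
    and res: "\<And>g h z. Rel g h \<Longrightarrow> 0 \<le> Re z \<Longrightarrow> \<Psi> * L2_norm \<Omega> g \<le> L2_norm \<Omega> (\<lambda>x. h x + z * g x)"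
    and \<Psi>: "\<Psi> > 0" and gen: "generator \<Omega> T g\<^sub>0 q\<^sub>0"
  shows "5 * (L2_norm \<Omega> (T (6 / \<Psi>) g\<^sub>0))\<^sup>2 \<le> 4 * (L2_norm \<Omega> g\<^sub>0)\<^sup>2"
proof -
  note sgD = contraction_semigroupD[OF sg]
  have g0: "g\<^sub>0 \<in> L2 \<Omega>" and q0: "q\<^sub>0 \<in> L2 \<Omega>" using gen by (auto simp: generator_def)
  define \<epsilon> where "\<epsilon> \<tau> = L2_norm \<Omega> (\<lambda>x. (T \<tau> g\<^sub>0 x - g\<^sub>0 x) / complex_of_real \<tau> - q\<^sub>0 x) + L2_norm \<Omega> (\<lambda>x. T \<tau> q\<^sub>0 x - q\<^sub>0 x)" for \<tau>
  have \<epsilon>: "(\<epsilon> \<longlongrightarrow> 0) (at_right 0)"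
    using tendsto_add[of _ 0 "at_right 0" _ 0] gen sgD(6)[OF q0] unfolding \<epsilon>_def[abs_def] generator_def by force
  define A where "A = (L2_norm \<Omega> (T (6 / \<Psi>) g\<^sub>0))\<^sup>2"
  define B where "B = (L2_norm \<Omega> g\<^sub>0)\<^sup>2"
  \<comment> \<open>Origin of the numbers: the \<open>5 * M\<close> plateau samples each carry at
    least \<open>A\<close>. The slope of the cutoff is felt at \<open>2 * M\<close> samples, each
    contributing at most 2 \<Psi>^2 B, and the residual at all \<open>7 * M\<close> samples, each
    contributing at most 2 \<epsilon>^2. Dividing by M \<Psi>^2 gives the claim. The plateau is long
    enough for 4 < 5, which is the source of decay.\<close>
  have main: "5 * A \<le> 14 * (\<epsilon> (1 / (\<Psi> * real M)))\<^sup>2 / \<Psi>\<^sup>2 + 4 * B" if M: "M > 0" for M :: nat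
  proof -
    define N where "N = 7 * M"
    define \<tau> where "\<tau> = 1 / (\<Psi> * real M)"
    have \<tau>: "\<tau> > 0" using M \<Psi> by (simp add: \<tau>_def)
    define g where "g n = T (real n * \<tau>) g\<^sub>0" for n
    define q where "q n = T (real n * \<tau>) q\<^sub>0" for n
    have gL: "g n \<in> L2 \<Omega>" "q n \<in> L2 \<Omega>" for n using \<tau> unfolding g_def q_def by (auto intro!: sgD(1) g0 q0)
    have gB: "(L2_norm \<Omega> (g n))\<^sup>2 \<le> B" for n unfolding g_def B_def
      using \<tau> by (intro power_mono sgD(2) g0) auto
    define a where "a = trapezoid M"
    define f where "f n x = complex_of_real (a n) * g n x" for n x
    define k where "k n x = complex_of_real (a n) * - q n x" for n x
    have RelM: "Rel (\<lambda>x. c * u x) (\<lambda>x. c * w x)" if "Rel u w" for c u w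
      using lin[of 1 "\<lambda>_. u" "\<lambda>_. w" "\<lambda>_. c"] that by simp
    have Relf: "Rel (f n) (k n)" for n
    proof -
      have "generator \<Omega> T (g n) (q n)" unfolding g_def q_def
        by (rule generator_semigroup_orbit[OF sg gen]) (use \<tau> in simp)
      from RelM[OF Rel[OF this]] show ?thesis by (simp add: f_def[abs_def] k_def[abs_def])
    qed
    define p where "p n x = (f n x - f (if n = 0 then N - 1 else n - 1) x) / complex_of_real \<tau> + k n x" for n x
    have est: "\<Psi>\<^sup>2 * (\<Sum>n<N. (L2_norm \<Omega> (f n))\<^sup>2) \<le> (\<Sum>n<N. (L2_norm \<Omega> (p n))\<^sup>2)"
      unfolding p_def[abs_def]
      by (rule cyclic_energy_estimate[where Rel=Rel]) (use L2 lin res \<Psi> \<tau> Relf in auto)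
    define d where "d n = (a n - a (if n = 0 then N - 1 else n - 1)) / \<tau>" for n
    have a0: "a 0 = 0" by (simp add: a_def trapezoid_def)
    \<comment> \<open>The cyclic difference at index 0 compares \<open>a 0 = 0\<close> with the last
      ramp value. That value is \<open>1 / M\<close>, so the wraparound is no steeper than an
      ordinary ramp step.\<close>
    have aN: "a (N - 1) = 1 / real M"
    proof -
      have "real (N - 1) = 7 * real M - 1" using M by (simp add: N_def of_nat_diff)
      then have "(7 * real M - real (N - 1)) / real M = 1 / real M" by simp
      moreover have "1 / real M \<le> 1" using M by simp
      moreover have "1 / real M \<le> real (N - 1) / real M" using M by (intro divide_right_mono) (auto simp: N_def)
      ultimately show ?thesis unfolding a_def trapezoid_def by linarith
    qed
    have d: "\<bar>d n\<bar> \<le> \<Psi>" for n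
    proof -
      have "\<bar>a n - a (if n = 0 then N - 1 else n - 1)\<bar> \<le> 1 / real M"
        using a0 aN trapezoid_increment[OF M, of "n - 1"] by (auto simp: a_def)
      then have "\<bar>d n\<bar> \<le> (1 / real M) / \<tau>"
        unfolding d_def abs_divide abs_of_pos[OF \<tau>] by (rule divide_right_mono[OF _ less_imp_le[OF \<tau>]])
      also have "\<dots> = \<Psi>" using M \<Psi> by (simp add: \<tau>_def)
      finally show ?thesis .
    qed
    \<comment> \<open>The difference is backward, so index \<open>M\<close> still belongs to the
      ramp and \<open>6 * M\<close> to the plateau.\<close>
    have d0: "d n = 0" if "M < n" "n \<le> 6 * M" for n
      using that M trapezoid_plateau[OF M, of n] trapezoid_plateau[OF M, of "n - 1"] by (simp add: d_def a_def)
    have pbound: "(L2_norm \<Omega> (p n))\<^sup>2 \<le> 2 * (\<epsilon> \<tau>)\<^sup>2 + (if M < n \<and> n \<le> 6 * M then 0 else 2 * \<Psi>\<^sup>2 * B)" if n: "n < N" for n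
    proof -
      define m where "m = (if n = 0 then N - 1 else n - 1)"
      \<comment> \<open>Discrete product rule: \<open>p n\<close> is the cutoff times the Euler
        residual plus the slope times the preceding sample. At index 0 the cutoff is zero, so the
        residual may be set to 0 there instead of comparing with the unrelated sample at
        \<open>N - 1\<close>.\<close>
      define r where "r x = (if n = 0 then 0 else (g n x - g m x) / complex_of_real \<tau> - q n x)" for x
      have p_eq: "p n x = complex_of_real (a n) * r x + complex_of_real (d n) * g m x" for x
        using a0 by (cases "n = 0") (auto simp: p_def f_def k_def r_def d_def m_def diff_divide_distrib algebra_simps)
      have rL: "r \<in> L2 \<Omega>"
      proof (cases "n = 0")
        case True
        then show ?thesis using L2_zero by (simp add: r_def[abs_def])
      next
        case False
        have "(\<lambda>x. (1 / complex_of_real \<tau>) * (g n x - g m x) - q n x) \<in> L2 \<Omega>"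
          by (intro L2_diff L2_cmult gL)
        then show ?thesis using False by (simp add: r_def[abs_def])
      qed
      have "L2_norm \<Omega> r \<le> \<epsilon> \<tau>"
      proof (cases "n = 0")
        case True
        then show ?thesis by (simp add: r_def[abs_def] \<epsilon>_def L2_norm_def[of _ "\<lambda>x. 0"])
      next
        case False
        then have "real n * \<tau> = real m * \<tau> + \<tau>" by (simp add: m_def algebra_simps of_nat_diff)
        then show ?thesis using False semigroup_Euler_residual[OF sg g0 q0 \<tau>, of "real m * \<tau>"] \<tau>
          by (simp add: r_def[abs_def] g_def q_def \<epsilon>_def)
      qed
      then have r2: "(L2_norm \<Omega> r)\<^sup>2 \<le> (\<epsilon> \<tau>)\<^sup>2" by (intro power_mono) auto
      have "(L2_norm \<Omega> (p n))\<^sup>2 \<le> (LINT x|lebesgue_on \<Omega>. 2 * (cmod (complex_of_real (a n) * r x))\<^sup>2 + 2 * (cmod (complex_of_real (d n) * g m x))\<^sup>2)"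
        unfolding L2_norm_squared p_eq
        by (intro Bochner_Integration.integral_mono L2D(2) L2_add L2_cmult rL gL cmod_add_squared_le
            Bochner_Integration.integrable_add integrable_mult_right)
      also have "\<dots> = 2 * (L2_norm \<Omega> (\<lambda>x. complex_of_real (a n) * r x))\<^sup>2 + 2 * (L2_norm \<Omega> (\<lambda>x. complex_of_real (d n) * g m x))\<^sup>2"
        unfolding L2_norm_squared using L2D(2)[OF L2_cmult[OF rL]] L2D(2)[OF L2_cmult[OF gL(1)]] by simp
      also have "\<dots> = 2 * ((a n)\<^sup>2 * (L2_norm \<Omega> r)\<^sup>2) + 2 * ((d n)\<^sup>2 * (L2_norm \<Omega> (g m))\<^sup>2)"
        by (simp add: L2_norm_cmult power_mult_distrib)
      also have "\<dots> \<le> 2 * (1 * (\<epsilon> \<tau>)\<^sup>2) + 2 * ((d n)\<^sup>2 * B)"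
      proof -
        have "(a n)\<^sup>2 \<le> 1" using trapezoid_bounds[OF M, of n] n by (simp add: a_def N_def power_le_one)
        then show ?thesis using r2 gB[of m] by (intro add_mono mult_left_mono mult_mono) auto
      qed
      also have "\<dots> \<le> 2 * (\<epsilon> \<tau>)\<^sup>2 + (if M < n \<and> n \<le> 6 * M then 0 else 2 * \<Psi>\<^sup>2 * B)"
      proof -
        have "(d n)\<^sup>2 \<le> \<Psi>\<^sup>2" using d[of n] \<Psi> by (simp add: abs_le_square_iff[symmetric])
        then have "(d n)\<^sup>2 * B \<le> \<Psi>\<^sup>2 * B" by (intro mult_right_mono) (auto simp: B_def)
        then show ?thesis using d0[of n] by auto
      qed
      finally show ?thesis .
    qed
    have "(\<Sum>n<N. (L2_norm \<Omega> (p n))\<^sup>2) \<le> (\<Sum>n<N. 2 * (\<epsilon> \<tau>)\<^sup>2 + (if M < n \<and> n \<le> 6 * M then 0 else 2 * \<Psi>\<^sup>2 * B))"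
      by (rule sum_mono) (use pbound in auto)
    also have "\<dots> = 14 * real M * (\<epsilon> \<tau>)\<^sup>2 + real (card {n. n < N \<and> \<not> (M < n \<and> n \<le> 6 * M)}) * (2 * \<Psi>\<^sup>2 * B)"
    proof -
      have "(\<Sum>n<N. if M < n \<and> n \<le> 6 * M then 0 else 2 * \<Psi>\<^sup>2 * B) = (\<Sum>n\<in>{n. n < N \<and> \<not> (M < n \<and> n \<le> 6 * M)}. 2 * \<Psi>\<^sup>2 * B)"
        by (intro sum.mono_neutral_cong_right) auto
      then show ?thesis unfolding sum.distrib by (simp add: N_def)
    qed
    \<comment> \<open>There are \<open>M + 1\<close> indices up to \<open>M\<close> and
      \<open>M - 1\<close> indices strictly between \<open>6 * M\<close> and
      \<open>7 * M\<close>.\<close>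
    also have "card {n. n < N \<and> \<not> (M < n \<and> n \<le> 6 * M)} = 2 * M"
    proof -
      have "{n. n < N \<and> \<not> (M < n \<and> n \<le> 6 * M)} = {..M} \<union> {6 * M<..<N}" using M by (auto simp: N_def)
      also have "card \<dots> = card {..M} + card {6 * M<..<N}" using M by (intro card_Un_disjoint) auto
      finally show ?thesis using M by (simp add: N_def)
    qed
    finally have up: "(\<Sum>n<N. (L2_norm \<Omega> (p n))\<^sup>2) \<le> real M * (14 * (\<epsilon> \<tau>)\<^sup>2 + 4 * \<Psi>\<^sup>2 * B)"
      by (simp add: algebra_simps)
    \<comment> \<open>The time 6 / \<Psi> is the sampling time of index \<open>6 * M\<close>, no
      earlier than any plateau sample; by contractivity the norm there is at most the norm at each
      of them.\<close>
    have low: "real M * (5 * A) \<le> (\<Sum>n<N. (L2_norm \<Omega> (f n))\<^sup>2)"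
    proof -
      have "A \<le> (L2_norm \<Omega> (f n))\<^sup>2" if n: "n \<in> {M<..6 * M}" for n
      proof -
        have fn: "f n = g n" using trapezoid_plateau[OF M, of n] n by (auto simp: f_def a_def)
        have "6 / \<Psi> = real (6 * M) * \<tau>" using M \<Psi> by (simp add: \<tau>_def)
        also have "\<dots> = real (6 * M - n) * \<tau> + real n * \<tau>" using n by (simp add: of_nat_diff algebra_simps)
        finally have "6 / \<Psi> = real (6 * M - n) * \<tau> + real n * \<tau>" .
        then have "AE x in lebesgue_on \<Omega>. T (6 / \<Psi>) g\<^sub>0 x = T (real (6 * M - n) * \<tau>) (g n) x"
          using sgD(5)[of "real (6 * M - n) * \<tau>" "real n * \<tau>" g\<^sub>0] \<tau> g0 by (simp add: g_def)
        then have "L2_norm \<Omega> (T (6 / \<Psi>) g\<^sub>0) = L2_norm \<Omega> (T (real (6 * M - n) * \<tau>) (g n))"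
          using \<Psi> \<tau> by (intro L2_norm_cong_AE sgD(1) g0 gL) auto
        also have "\<dots> \<le> L2_norm \<Omega> (g n)" using \<tau> by (intro sgD(2) gL) auto
        finally show ?thesis unfolding fn A_def by (intro power_mono) auto
      qed
      then have "(\<Sum>n\<in>{M<..6 * M}. A) \<le> (\<Sum>n\<in>{M<..6 * M}. (L2_norm \<Omega> (f n))\<^sup>2)" by (rule sum_mono)
      also have "\<dots> \<le> (\<Sum>n<N. (L2_norm \<Omega> (f n))\<^sup>2)" using M by (intro sum_mono2) (auto simp: N_def)
      finally show ?thesis using M by (simp add: of_nat_diff algebra_simps)
    qed
    have "\<Psi>\<^sup>2 * (real M * (5 * A)) \<le> real M * (14 * (\<epsilon> \<tau>)\<^sup>2 + 4 * \<Psi>\<^sup>2 * B)"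
      using order_trans[OF order_trans[OF mult_left_mono[OF low] est] up] by simp
    then have "real M * (\<Psi>\<^sup>2 * (5 * A)) \<le> real M * (14 * (\<epsilon> \<tau>)\<^sup>2 + 4 * \<Psi>\<^sup>2 * B)" by (simp add: mult_ac)
    then have "\<Psi>\<^sup>2 * (5 * A) \<le> 14 * (\<epsilon> \<tau>)\<^sup>2 + 4 * \<Psi>\<^sup>2 * B" using M by simp
    then have "5 * A \<le> (14 * (\<epsilon> \<tau>)\<^sup>2 + 4 * \<Psi>\<^sup>2 * B) / \<Psi>\<^sup>2"
      using \<Psi> by (simp add: le_divide_eq mult.commute)
    also have "\<dots> = 14 * (\<epsilon> \<tau>)\<^sup>2 / \<Psi>\<^sup>2 + 4 * B" using \<Psi> by (simp add: add_divide_distrib)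
    finally show ?thesis by (simp add: \<tau>_def)
  qed
  have "(\<lambda>M. 14 * (\<epsilon> (1 / (\<Psi> * real (Suc M))))\<^sup>2 / \<Psi>\<^sup>2 + 4 * B) \<longlonglongrightarrow> 14 * 0\<^sup>2 / \<Psi>\<^sup>2 + 4 * B"
  proof (intro tendsto_intros filterlim_compose[OF \<epsilon>])
    have "(\<lambda>M. (1 / \<Psi>) * (1 / real (Suc M))) \<longlonglongrightarrow> (1 / \<Psi>) * 0"
      using LIMSEQ_inverse_real_of_nat by (intro tendsto_mult tendsto_const) (simp add: inverse_eq_divide)
    then show "filterlim (\<lambda>M. 1 / (\<Psi> * real (Suc M))) (at_right 0) sequentially"
      using \<Psi> by (auto simp: filterlim_at eventually_sequentially)
  qed (use \<Psi> in auto)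
  then have "5 * A \<le> 14 * 0\<^sup>2 / \<Psi>\<^sup>2 + 4 * B"
    by (rule LIMSEQ_le_const) (use main[of "Suc _"] in blast)
  then show ?thesis by (simp add: A_def B_def)
qed

text \<open>Contractivity and density carry the one-step factor \<rho> = sqrt(4/5) per time 6 /
  \<Psi> from the domain to all of L2. With n the integer part of t \<Psi> / 6, \<rho>^n is at most
  \<rho>^(t \<Psi> / 6 - 1): the loss of one step is the factor sqrt(5/4), and -ln \<rho> = ln(5/4)
  / 2 divided by 6 gives ln(5/4) / 12.\<close>

lemma semigroup_exponential_decay:
  assumes sg: "contraction_semigroup \<Omega> T" and \<Psi>: "\<Psi> > 0"
    and dense: "\<And>f e. f \<in> L2 \<Omega> \<Longrightarrow> e > 0 \<Longrightarrow> \<exists>g q. generator \<Omega> T g q \<and> L2_norm \<Omega> (\<lambda>x. f x - g x) < e"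
    and decay: "\<And>g q. generator \<Omega> T g q \<Longrightarrow> 5 * (L2_norm \<Omega> (T (6 / \<Psi>) g))\<^sup>2 \<le> 4 * (L2_norm \<Omega> g)\<^sup>2"
    and f: "f \<in> L2 \<Omega>" and t: "t \<ge> 0"
  shows "L2_norm \<Omega> (T t f) \<le> sqrt (5 / 4) * exp (- (ln (5 / 4) / 12) * \<Psi> * t) * L2_norm \<Omega> f"
proof -
  note sgD = contraction_semigroupD[OF sg]
  define s where "s = 6 / \<Psi>"
  have s: "s > 0" using \<Psi> by (simp add: s_def)
  define \<rho> where "\<rho> = sqrt (4 / 5)"
  have \<rho>: "0 < \<rho>" "\<rho> \<le> 1" by (auto simp: \<rho>_def)
  have gdec: "L2_norm \<Omega> (T s g) \<le> \<rho> * L2_norm \<Omega> g" if "generator \<Omega> T g q" for g q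
  proof -
    have "(L2_norm \<Omega> (T s g))\<^sup>2 \<le> (\<rho> * L2_norm \<Omega> g)\<^sup>2"
      using decay[OF that] by (simp add: s_def \<rho>_def power_mult_distrib)
    then show ?thesis by (rule power2_le_imp_le) (use \<rho> in simp)
  qed
  have one: "L2_norm \<Omega> (T s f) \<le> \<rho> * L2_norm \<Omega> f" if f: "f \<in> L2 \<Omega>" for f
  proof (rule field_le_epsilon)
    fix e :: real assume e: "e > 0"
    then obtain g q where gq: "generator \<Omega> T g q" "L2_norm \<Omega> (\<lambda>x. f x - g x) < e / 2" using dense[OF f, of "e / 2"] by auto
    have g: "g \<in> L2 \<Omega>" using gq by (simp add: generator_def)
    define w where "w x = 1 * f x + - 1 * g x" for x
    have w: "w \<in> L2 \<Omega>" unfolding w_def[abs_def] by (intro L2_add L2_cmult f g)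
    have wn: "L2_norm \<Omega> w < e / 2" using gq(2) by (simp add: w_def[abs_def])
    have TL: "T s f \<in> L2 \<Omega>" "T s g \<in> L2 \<Omega>" "T s w \<in> L2 \<Omega>" using s f g w by (auto intro!: sgD(1))
    have "AE x in lebesgue_on \<Omega>. T s w x = 1 * T s f x + - 1 * T s g x"
      unfolding w_def[abs_def] by (rule sgD(3)) (use s f g in auto)
    then have "AE x in lebesgue_on \<Omega>. T s f x = T s w x + T s g x" by eventually_elim simp
    then have "L2_norm \<Omega> (T s f) = L2_norm \<Omega> (\<lambda>x. T s w x + T s g x)"
      by (intro L2_norm_cong_AE TL L2_add)
    also have "\<dots> \<le> L2_norm \<Omega> (T s w) + L2_norm \<Omega> (T s g)" by (intro L2_norm_triangle TL)
    also have "\<dots> \<le> L2_norm \<Omega> w + \<rho> * L2_norm \<Omega> g"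
      using s by (intro add_mono sgD(2) w gdec[OF gq(1)]) auto
    also have "L2_norm \<Omega> g \<le> L2_norm \<Omega> f + L2_norm \<Omega> w"
    proof -
      have "L2_norm \<Omega> (\<lambda>x. f x + - 1 * w x) \<le> L2_norm \<Omega> f + L2_norm \<Omega> (\<lambda>x. - 1 * w x)"
        by (intro L2_norm_triangle f L2_cmult w)
      moreover have "(\<lambda>x. f x + - 1 * w x) = g" by (auto simp: w_def)
      ultimately show ?thesis by (simp only: L2_norm_cmult) simp
    qed
    also have "L2_norm \<Omega> w + \<rho> * (L2_norm \<Omega> f + L2_norm \<Omega> w) \<le> \<rho> * L2_norm \<Omega> f + 2 * L2_norm \<Omega> w"
      using \<rho> mult_right_mono[of \<rho> 1 "L2_norm \<Omega> w"] by (simp add: algebra_simps)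
    also have "\<dots> \<le> \<rho> * L2_norm \<Omega> f + e" using wn by simp
    finally show "L2_norm \<Omega> (T s f) \<le> \<rho> * L2_norm \<Omega> f + e" using \<rho> by simp
  qed
  have iter: "L2_norm \<Omega> (T (real n * s) f) \<le> \<rho> ^ n * L2_norm \<Omega> f" for n
  proof (induction n)
    case 0
    then show ?case using sgD(2)[OF order_refl f] by simp
  next
    case (Suc n)
    have "AE x in lebesgue_on \<Omega>. T (s + real n * s) f x = T s (T (real n * s) f) x"
      by (rule sgD(5)) (use s f in auto)
    then have "L2_norm \<Omega> (T (s + real n * s) f) = L2_norm \<Omega> (T s (T (real n * s) f))"
      using s by (intro L2_norm_cong_AE sgD(1) f) auto
    also have "\<dots> \<le> \<rho> * L2_norm \<Omega> (T (real n * s) f)" using s by (intro one sgD(1) f) auto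
    also have "\<dots> \<le> \<rho> * (\<rho> ^ n * L2_norm \<Omega> f)" using Suc \<rho> by (intro mult_left_mono) auto
    finally show ?case by (simp add: algebra_simps)
  qed
  define n where "n = nat \<lfloor>t / s\<rfloor>"
  have n: "real n \<le> t / s" "t / s < real n + 1" using t s by (auto simp: n_def)
  then have r: "0 \<le> t - real n * s" using s by (simp add: le_divide_eq)
  have "AE x in lebesgue_on \<Omega>. T ((t - real n * s) + real n * s) f x = T (t - real n * s) (T (real n * s) f) x"
    by (rule sgD(5)) (use s f r in auto)
  then have "L2_norm \<Omega> (T t f) = L2_norm \<Omega> (T (t - real n * s) (T (real n * s) f))"
    using s t r by (intro L2_norm_cong_AE sgD(1) f) auto
  also have "\<dots> \<le> L2_norm \<Omega> (T (real n * s) f)" using s by (intro sgD(2) sgD(1) f r) auto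
  also have "\<dots> \<le> \<rho> ^ n * L2_norm \<Omega> f" by (rule iter)
  also have "\<rho> ^ n \<le> sqrt (5 / 4) * exp (- (ln (5 / 4) / 12) * \<Psi> * t)"
  proof -
    have ln\<rho>: "ln \<rho> = - (ln (5 / 4) / 2)"
    proof -
      have "ln (4 / 5 :: real) = - ln (5 / 4)" by (simp add: ln_div)
      then show ?thesis by (simp add: \<rho>_def ln_sqrt del: ln_divide_pos)
    qed
    have "\<rho> ^ n = exp (real n * ln \<rho>)" using \<rho> by (simp add: exp_of_nat_mult)
    also have "\<dots> \<le> exp (ln (5 / 4) / 2 + - (ln (5 / 4) / 12) * \<Psi> * t)"
    proof -
      have "(t / s - 1) * (ln (5 / 4) / 2) \<le> real n * (ln (5 / 4) / 2)"
        using n by (intro mult_right_mono) auto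
      moreover have "t / s = \<Psi> * t / 6" using \<Psi> by (simp add: s_def)
      ultimately show ?thesis unfolding ln\<rho> by (simp add: algebra_simps)
    qed
    also have "\<dots> = sqrt (5 / 4) * exp (- (ln (5 / 4) / 12) * \<Psi> * t)"
    proof -
      have "exp (ln (5 / 4) / 2) = sqrt (5 / 4 :: real)"
        using exp_ln[of "sqrt (5 / 4)"] by (simp add: ln_sqrt)
      then show ?thesis by (simp only: exp_add)
    qed
    finally show ?thesis .
  qed
  finally show ?thesis by (simp add: mult_right_mono)
qed

section \<open>Multipliers and energy identities\<close>

lemma ac_on_continuous_open:
  assumes "ac_on \<Omega> U u'" "open \<Omega>" "convex \<Omega>"
  shows "continuous_on \<Omega> U"
proof (rule continuous_at_imp_continuous_on, rule ballI)
  fix x assume x: "x \<in> \<Omega>"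
  then obtain r where r: "r > 0" "cball x r \<subseteq> \<Omega>" using assms(2) open_contains_cball by blast
  then have "x - r \<in> \<Omega>" "x + r \<in> \<Omega>" by (auto simp: subset_iff dist_real_def)
  then have "continuous_on {x - r..x + r} U" by (rule ac_on_continuous[OF assms(1,3)])
  then show "isCont U x" by (rule continuous_on_interior) (use r in \<open>simp add: interior_atLeastAtMost_real\<close>)
qed

lemma L2_cnj: "f \<in> L2 \<Omega> \<Longrightarrow> (\<lambda>x. cnj (f x)) \<in> L2 \<Omega>"
proof -
  assume "f \<in> L2 \<Omega>"
  moreover from this have "(\<lambda>x. cnj (f x)) \<in> borel_measurable (lebesgue_on \<Omega>)"
    using borel_measurable_continuous_on[of cnj f] by (auto dest: L2D(1) intro: continuous_intros)
  ultimately show ?thesis by (simp add: L2_def)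
qed

lemma L2_weighted_pairing:
  fixes b :: "real \<Rightarrow> real"
  assumes f: "f \<in> L2 \<Omega>" and g: "g \<in> L2 \<Omega>" and b: "b \<in> borel_measurable (lebesgue_on \<Omega>)"
    and K: "\<And>x. x \<in> \<Omega> \<Longrightarrow> \<bar>b x\<bar> \<le> K"
  shows "integrable (lebesgue_on \<Omega>) (\<lambda>x. of_real (b x) * (f x * cnj (g x)))"
    and "cmod (LINT x|lebesgue_on \<Omega>. of_real (b x) * (f x * cnj (g x))) \<le> K * (L2_norm \<Omega> f * L2_norm \<Omega> g)"
proof -
  note i = L2_product_integrable[OF f g]
  have [measurable]: "f \<in> borel_measurable (lebesgue_on \<Omega>)" "(\<lambda>x. cnj (g x)) \<in> borel_measurable (lebesgue_on \<Omega>)"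
    using L2D(1)[OF f] L2D(1)[OF L2_cnj[OF g]] by auto
  note b[measurable]
  have le: "cmod (of_real (b x) * (f x * cnj (g x))) \<le> K * (cmod (f x) * cmod (g x))"
    if "x \<in> space (lebesgue_on \<Omega>)" for x
    using that K[of x] by (auto simp: norm_mult intro!: mult_right_mono)
  show int: "integrable (lebesgue_on \<Omega>) (\<lambda>x. of_real (b x) * (f x * cnj (g x)))"
  proof (rule Bochner_Integration.integrable_bound[where f="\<lambda>x. K * (cmod (f x) * cmod (g x))"])
    show "AE x in lebesgue_on \<Omega>. norm (of_real (b x) * (f x * cnj (g x))) \<le> norm (K * (cmod (f x) * cmod (g x)))"
      using le by (intro AE_I2) (metis abs_ge_self order_trans real_norm_def)
  qed (use i in auto)
  show "cmod (LINT x|lebesgue_on \<Omega>. of_real (b x) * (f x * cnj (g x))) \<le> K * (L2_norm \<Omega> f * L2_norm \<Omega> g)"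
  \<comment> \<open>A negative \<open>K\<close> is compatible with the bound only for empty
    \<Omega>, where both sides are zero.\<close>
  proof (cases "\<Omega> = {}")
    case True
    have "f \<in> L2 {}" "(LINT x|lebesgue_on {}. h x) = 0" for h :: "real \<Rightarrow> 'b::{banach, second_countable_topology}"
      using f True by (auto simp: integral_restrict_space)
    then show ?thesis using True by (simp add: L2_norm_def)
  next
    case False
    then have K0: "K \<ge> 0" using K by (meson abs_ge_zero all_not_in_conv order_trans)
    have "cmod (LINT x|lebesgue_on \<Omega>. of_real (b x) * (f x * cnj (g x))) \<le> (LINT x|lebesgue_on \<Omega>. cmod (of_real (b x) * (f x * cnj (g x))))"
      by (rule integral_norm_bound)
    also have "\<dots> \<le> (LINT x|lebesgue_on \<Omega>. K * (cmod (f x) * cmod (g x)))"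
      by (rule Bochner_Integration.integral_mono) (use int i le in auto)
    also have "\<dots> \<le> K * (L2_norm \<Omega> f * L2_norm \<Omega> g)"
      using L2_Cauchy_Schwarz[OF f g] K0 by (simp add: mult_left_mono)
    finally show ?thesis .
  qed
qed

lemma integrable_indicator_times:
  fixes f :: "real \<Rightarrow> real"
  assumes f: "integrable (lebesgue_on \<Omega>) f" and S: "S \<in> sets lebesgue"
  shows "integrable (lebesgue_on \<Omega>) (\<lambda>x. indicator S x * f x)"
proof (rule Bochner_Integration.integrable_bound[OF f])
  have "indicator S \<in> borel_measurable (lebesgue_on \<Omega>)"
    by (intro measurable_restrict_space1 borel_measurable_indicator S)
  then show "(\<lambda>x. indicator S x * f x) \<in> borel_measurable (lebesgue_on \<Omega>)"
    using borel_measurable_integrable[OF f] by (rule borel_measurable_times)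
qed (auto simp: indicator_def)

text \<open>The derivative of |U|^2 is at most 2 |U| |u'|, so by Cauchy-Schwarz |U|^2 varies by at
  most 2 |U|_2 |u'|_2 over \<Omega>, where the index 2 marks L2 norms. It also takes arbitrarily
  small values: a positive lower bound on intervals of every length would contradict square
  integrability.\<close>

lemma ac_on_sup_bound:
  assumes \<Omega>: "open \<Omega>" "convex \<Omega>" and unb: "\<And>n::nat. \<exists>a b. a \<in> \<Omega> \<and> b \<in> \<Omega> \<and> b - a = real n"
    and ac: "ac_on \<Omega> U u'" and L2: "U \<in> L2 \<Omega>" "u' \<in> L2 \<Omega>" and x: "x \<in> \<Omega>"
  shows "(cmod (U x))\<^sup>2 \<le> 2 * (L2_norm \<Omega> U * L2_norm \<Omega> u')"
proof (rule field_le_epsilon)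
  fix e :: real assume e: "e > 0"
  have \<Omega>s: "\<Omega> \<in> sets lebesgue" using \<Omega>(1) by simp
  define K where "K = 2 * (L2_norm \<Omega> U * L2_norm \<Omega> u')"
  define w where "w y = u' y * cnj (U y) + U y * cnj (u' y)" for y
  have V: "ac_on \<Omega> (\<lambda>y. U y * cnj (U y)) w" unfolding w_def by (rule ac_on_mult[OF \<Omega>(2) ac ac_on_cnj[OF ac]])
  have diff: "cmod (U b * cnj (U b) - U a * cnj (U a)) \<le> K" if ab: "a \<in> \<Omega>" "b \<in> \<Omega>" "a \<le> b" for a b
  proof -
    have sub: "{a..b} \<subseteq> \<Omega>" by (rule convex_interval_subset[OF \<Omega>(2) ab(1,2)])
    have wi: "integrable (lebesgue_on {a..b}) w"
      using ac_onD(1)[OF V ab] by (simp add: absolutely_integrable_iff_lebesgue_on)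
    note i = L2_product_integrable[OF L2]
    have i': "integrable (lebesgue_on {a..b}) (\<lambda>x. cmod (U x) * cmod (u' x))"
      by (rule integrable_lebesgue_on_mono[OF i sub _ \<Omega>s]) simp
    have "U b * cnj (U b) - U a * cnj (U a) = (LINT y|lebesgue_on {a..b}. w y)"
      using ac_onD(3)[OF V ab] by (simp add: lebesgue_integral_eq_integral[OF wi])
    then have "cmod (U b * cnj (U b) - U a * cnj (U a)) \<le> (LINT y|lebesgue_on {a..b}. cmod (w y))"
      using integral_norm_bound[of "lebesgue_on {a..b}" w] by simp
    also have "\<dots> \<le> (LINT y|lebesgue_on {a..b}. 2 * (cmod (U y) * cmod (u' y)))"
    proof (rule Bochner_Integration.integral_mono)
      show "cmod (w y) \<le> 2 * (cmod (U y) * cmod (u' y))" for y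
        using norm_triangle_ineq[of "u' y * cnj (U y)" "U y * cnj (u' y)"] by (simp add: w_def norm_mult mult.commute)
    qed (use wi i' in auto)
    also have "\<dots> = 2 * (LINT y|lebesgue_on \<Omega>. indicator {a..b} y * (cmod (U y) * cmod (u' y)))"
    proof -
      have "(LINT y|lebesgue_on \<Omega>. indicator {a..b} y * (cmod (U y) * cmod (u' y))) = (LINT y|lebesgue_on {a..b}. indicator {a..b} y * (cmod (U y) * cmod (u' y)))"
        by (rule lebesgue_on_zero_outside) (use sub \<Omega>s in auto)
      also have "\<dots> = (LINT y|lebesgue_on {a..b}. cmod (U y) * cmod (u' y))"
        by (rule Bochner_Integration.integral_cong) auto
      finally show ?thesis by simp
    qed
    also have "\<dots> \<le> 2 * (LINT y|lebesgue_on \<Omega>. cmod (U y) * cmod (u' y))"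
    proof (intro mult_left_mono Bochner_Integration.integral_mono)
      show "integrable (lebesgue_on \<Omega>) (\<lambda>y. indicator {a..b} y * (cmod (U y) * cmod (u' y)))"
        by (rule integrable_indicator_times[OF i]) simp
    qed (use i in \<open>auto simp: indicator_def\<close>)
    also have "\<dots> \<le> K" using L2_Cauchy_Schwarz[OF L2] by (simp add: K_def)
    finally show ?thesis .
  qed
  have "\<exists>y\<in>\<Omega>. (cmod (U y))\<^sup>2 < e"
  proof (rule ccontr)
    assume "\<not> (\<exists>y\<in>\<Omega>. (cmod (U y))\<^sup>2 < e)"
    then have ge: "e \<le> (cmod (U y))\<^sup>2" if "y \<in> \<Omega>" for y using that by force
    obtain n where n: "(L2_norm \<Omega> U)\<^sup>2 / e < real n" using reals_Archimedean2 by blast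
    obtain a b where ab: "a \<in> \<Omega>" "b \<in> \<Omega>" "b - a = real n" using unb by blast
    have sub: "{a..b} \<subseteq> \<Omega>" by (rule convex_interval_subset[OF \<Omega>(2) ab(1,2)])
    have "e * real n = (LINT y|lebesgue_on {a..b}. e)"
      using ab by (subst lebesgue_integral_eq_integral)
        (auto intro!: absolutely_integrable_imp_integrable absolutely_integrable_continuous_real)
    also have "\<dots> \<le> (LINT y|lebesgue_on {a..b}. (cmod (U y))\<^sup>2)"
      using integrable_lebesgue_on_mono[OF L2D(2)[OF L2(1)] sub _ \<Omega>s] ge sub
      by (intro Bochner_Integration.integral_mono)
        (auto intro!: absolutely_integrable_imp_integrable absolutely_integrable_continuous_real)
    also have "\<dots> = (LINT y|lebesgue_on {a..b}. indicator {a..b} y * (cmod (U y))\<^sup>2)"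
      by (rule Bochner_Integration.integral_cong) auto
    also have "\<dots> = (LINT y|lebesgue_on \<Omega>. indicator {a..b} y * (cmod (U y))\<^sup>2)"
      by (rule lebesgue_on_zero_outside[symmetric]) (use sub \<Omega>s in auto)
    also have "\<dots> \<le> (LINT y|lebesgue_on \<Omega>. (cmod (U y))\<^sup>2)"
    proof (rule Bochner_Integration.integral_mono)
      show "integrable (lebesgue_on \<Omega>) (\<lambda>y. indicator {a..b} y * (cmod (U y))\<^sup>2)"
        by (rule integrable_indicator_times[OF L2D(2)[OF L2(1)]]) simp
    qed (use L2D(2)[OF L2(1)] in \<open>auto simp: indicator_def\<close>)
    also have "\<dots> = (L2_norm \<Omega> U)\<^sup>2" by (simp add: L2_norm_squared)
    finally show False using n e by (simp add: divide_less_eq mult.commute)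
  qed
  then obtain y where y: "y \<in> \<Omega>" "(cmod (U y))\<^sup>2 < e" by auto
  have sq: "cmod (U t * cnj (U t)) = (cmod (U t))\<^sup>2" for t by (simp add: norm_mult power2_eq_square)
  have "cmod (U x * cnj (U x) - U y * cnj (U y)) \<le> K"
    using diff[of x y] diff[of y x] x y by (cases "x \<le> y") (auto simp: norm_minus_commute)
  then have "(cmod (U x))\<^sup>2 - (cmod (U y))\<^sup>2 \<le> K"
    using norm_triangle_ineq2[of "U x * cnj (U x)" "U y * cnj (U y)"] unfolding sq by linarith
  then show "(cmod (U x))\<^sup>2 \<le> 2 * (L2_norm \<Omega> U * L2_norm \<Omega> u') + e" using y by (simp add: K_def)
qed

text \<open>Bounded Lipschitz weights on the whole line with a chosen derivative. The bound on
  \<psi>' holds everywhere, not just almost everywhere, so that the product rule places the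
  derivative of a weighted H^1 function in L2 by pointwise estimates. The normalisation |\<psi>|
  \<le> 1 makes the bounds on derivatives add under products.\<close>

definition multiplier :: "(real \<Rightarrow> real) \<Rightarrow> (real \<Rightarrow> real) \<Rightarrow> real \<Rightarrow> bool" where
  "multiplier \<psi> \<psi>' B \<longleftrightarrow> \<psi> \<in> borel_measurable borel \<and> \<psi>' \<in> borel_measurable borel \<and>
     (\<forall>x. \<bar>\<psi> x\<bar> \<le> 1) \<and> (\<forall>x. \<bar>\<psi>' x\<bar> \<le> B) \<and>
     ac_on UNIV (\<lambda>x. complex_of_real (\<psi> x)) (\<lambda>x. complex_of_real (\<psi>' x))"

text \<open>A Lipschitz version of the sign of \<open>x - z\<close>, equal to that sign at distance
  at least \<delta> from \<open>z\<close>.\<close>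

definition clip :: "real \<Rightarrow> real \<Rightarrow> real \<Rightarrow> real" where
  "clip \<delta> z x = max (-1) (min 1 ((x - z) / \<delta>))"

lemma multiplier_const: "\<bar>s\<bar> \<le> 1 \<Longrightarrow> multiplier (\<lambda>_. s) (\<lambda>_. 0) 0"
  using ac_on_const[of UNIV "complex_of_real s"] by (simp add: multiplier_def)

lemma multiplier_mult:
  assumes "multiplier \<psi> \<psi>' B" "multiplier \<eta> \<eta>' C"
  shows "multiplier (\<lambda>x. \<psi> x * \<eta> x) (\<lambda>x. \<psi>' x * \<eta> x + \<psi> x * \<eta>' x) (B + C)"
proof -
  have [measurable]: "\<psi> \<in> borel_measurable borel" "\<psi>' \<in> borel_measurable borel" "\<eta> \<in> borel_measurable borel" "\<eta>' \<in> borel_measurable borel"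
    using assms by (auto simp: multiplier_def)
  have b: "\<bar>\<psi> x\<bar> \<le> 1" "\<bar>\<psi>' x\<bar> \<le> B" "\<bar>\<eta> x\<bar> \<le> 1" "\<bar>\<eta>' x\<bar> \<le> C" for x
    using assms by (auto simp: multiplier_def)
  have "B \<ge> 0" "C \<ge> 0" using b(2)[of 0] b(4)[of 0] by linarith+
  have "\<bar>\<psi> x * \<eta> x\<bar> \<le> 1" for x using b[of x] by (auto simp: abs_mult intro: mult_le_one)
  moreover have "\<bar>\<psi>' x * \<eta> x + \<psi> x * \<eta>' x\<bar> \<le> B + C" for x
  proof -
    have "\<bar>\<psi>' x\<bar> * \<bar>\<eta> x\<bar> \<le> B * 1" "\<bar>\<psi> x\<bar> * \<bar>\<eta>' x\<bar> \<le> 1 * C"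
      by (rule mult_mono; use b[of x] \<open>B \<ge> 0\<close> \<open>C \<ge> 0\<close> in simp)+
    then show ?thesis using abs_triangle_ineq[of "\<psi>' x * \<eta> x" "\<psi> x * \<eta>' x"] by (simp add: abs_mult)
  qed
  moreover have "ac_on UNIV (\<lambda>x. complex_of_real (\<psi> x * \<eta> x)) (\<lambda>x. complex_of_real (\<psi>' x * \<eta> x + \<psi> x * \<eta>' x))"
    using ac_on_mult[of UNIV "\<lambda>x. complex_of_real (\<psi> x)" "\<lambda>x. complex_of_real (\<psi>' x)" "\<lambda>x. complex_of_real (\<eta> x)" "\<lambda>x. complex_of_real (\<eta>' x)"]
      assms by (simp add: multiplier_def)
  ultimately show ?thesis unfolding multiplier_def by auto
qed

lemma multiplier_half_diff:
  assumes "multiplier \<psi> \<psi>' B" "multiplier \<eta> \<eta>' B"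
  shows "multiplier (\<lambda>x. (\<psi> x - \<eta> x) / 2) (\<lambda>x. (\<psi>' x - \<eta>' x) / 2) B"
proof -
  have [measurable]: "\<psi> \<in> borel_measurable borel" "\<psi>' \<in> borel_measurable borel" "\<eta> \<in> borel_measurable borel" "\<eta>' \<in> borel_measurable borel"
    using assms by (auto simp: multiplier_def)
  have b: "\<bar>\<psi> x\<bar> \<le> 1" "\<bar>\<psi>' x\<bar> \<le> B" "\<bar>\<eta> x\<bar> \<le> 1" "\<bar>\<eta>' x\<bar> \<le> B" for x
    using assms by (auto simp: multiplier_def)
  have "\<bar>(\<psi> x - \<eta> x) / 2\<bar> \<le> 1" "\<bar>(\<psi>' x - \<eta>' x) / 2\<bar> \<le> B" for x using b[of x] by auto
  moreover have "ac_on UNIV (\<lambda>x. complex_of_real ((\<psi> x - \<eta> x) / 2)) (\<lambda>x. complex_of_real ((\<psi>' x - \<eta>' x) / 2))"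
  proof -
    have c: "ac_on UNIV (\<lambda>x. c * complex_of_real (f x)) (\<lambda>x. c * complex_of_real (f' x))"
      if "multiplier f f' B" for c f f'
      using ac_on_mult[OF convex_UNIV ac_on_const[of UNIV c], of "\<lambda>x. complex_of_real (f x)" "\<lambda>x. complex_of_real (f' x)"] that
      by (simp add: multiplier_def)
    show ?thesis using ac_on_add[OF c[OF assms(1), of "1/2"] c[OF assms(2), of "-1/2"]] by (simp add: diff_divide_distrib)
  qed
  ultimately show ?thesis unfolding multiplier_def by auto
qed

lemma multiplier_clip:
  assumes \<delta>: "\<delta> > 0"
  shows "multiplier (clip \<delta> z) (\<lambda>x. if \<bar>x - z\<bar> < \<delta> then 1 / \<delta> else 0) (1 / \<delta>)"
  unfolding multiplier_def
proof (intro conjI allI)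
  have cc: "continuous_on UNIV (clip \<delta> z)" unfolding clip_def by (intro continuous_intros) (use \<delta> in auto)
  show "clip \<delta> z \<in> borel_measurable borel" by (rule borel_measurable_continuous_onI[OF cc])
  show "\<bar>clip \<delta> z x\<bar> \<le> 1" for x by (auto simp: clip_def)
  show "(\<lambda>x. if \<bar>x - z\<bar> < \<delta> then 1 / \<delta> else 0) \<in> borel_measurable borel" by measurable
  show "ac_on UNIV (\<lambda>x. complex_of_real (clip \<delta> z x)) (\<lambda>x. complex_of_real (if \<bar>x - z\<bar> < \<delta> then 1 / \<delta> else 0))"
  proof (rule ac_on_from_derivative[of _ "{z - \<delta>, z + \<delta>}"])
    show "continuous_on UNIV (\<lambda>x. complex_of_real (clip \<delta> z x))" by (intro continuous_on_of_real cc)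
    show "(\<lambda>x. complex_of_real (if \<bar>x - z\<bar> < \<delta> then 1 / \<delta> else 0)) \<in> borel_measurable borel" by measurable
    show "bounded ((\<lambda>x. complex_of_real (if \<bar>x - z\<bar> < \<delta> then 1 / \<delta> else 0)) ` {a..b})" for a b
      unfolding bounded_iff using \<delta> by (intro exI[of _ "1 / \<delta>"]) (auto simp: norm_divide)
    show "((\<lambda>x. complex_of_real (clip \<delta> z x)) has_vector_derivative complex_of_real (if \<bar>x - z\<bar> < \<delta> then 1 / \<delta> else 0)) (at x)"
      if x: "x \<in> UNIV - {z - \<delta>, z + \<delta>}" for x
    proof (rule has_vector_derivative_of_real_iff_real)
      consider "x < z - \<delta>" | "z - \<delta> < x" "x < z + \<delta>" | "z + \<delta> < x" using x by fastforce
      then show "(clip \<delta> z has_real_derivative (if \<bar>x - z\<bar> < \<delta> then 1 / \<delta> else 0)) (at x)"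
      proof cases
        case 1
        have "((\<lambda>_. -1) has_real_derivative (if \<bar>x - z\<bar> < \<delta> then 1 / \<delta> else 0)) (at x)" using 1 by auto
        then show ?thesis
          by (rule has_field_derivative_transform_within_open[of _ _ _ "{..<z - \<delta>}"])
            (use 1 \<delta> in \<open>auto simp: clip_def divide_simps\<close>)
      next
        case 2
        have "((\<lambda>x. (x - z) / \<delta>) has_real_derivative (if \<bar>x - z\<bar> < \<delta> then 1 / \<delta> else 0)) (at x)"
          using 2 \<delta> by (auto intro!: derivative_eq_intros)
        then show ?thesis
          by (rule has_field_derivative_transform_within_open[of _ _ _ "{z - \<delta><..<z + \<delta>}"])
            (use 2 \<delta> in \<open>auto simp: clip_def min_def max_def divide_simps\<close>)
      next
        case 3
        have "((\<lambda>_. 1) has_real_derivative (if \<bar>x - z\<bar> < \<delta> then 1 / \<delta> else 0)) (at x)" using 3 by auto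
        then show ?thesis
          by (rule has_field_derivative_transform_within_open[of _ _ _ "{z + \<delta><..}"])
            (use 3 \<delta> in \<open>auto simp: clip_def min_def max_def divide_simps\<close>)
      qed
    qed
  qed auto
qed (use \<delta> in auto)

lemma multiplier_clip_prod:
  assumes "finite Z" "\<delta> > 0"
  shows "\<exists>\<psi>'. multiplier (\<lambda>x. \<Prod>z\<in>Z. clip \<delta> z x) \<psi>' (real (card Z) / \<delta>)"
  using assms(1)
proof induction
  case empty
  then show ?case using multiplier_const[of 1] by auto
next
  case (insert z Z)
  then obtain \<psi>' where \<psi>': "multiplier (\<lambda>x. \<Prod>z\<in>Z. clip \<delta> z x) \<psi>' (real (card Z) / \<delta>)" by auto
  from multiplier_mult[OF multiplier_clip[OF assms(2), of z] \<psi>'] insert.hyps show ?case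
    by (auto simp: add_divide_distrib add.commute)
qed

lemma multiplier_plateau:
  assumes "R > 0"
  obtains \<theta> \<theta>' where "multiplier \<theta> \<theta>' (1 / R)" "\<And>x. 0 \<le> \<theta> x" "\<And>x. \<theta> x \<le> 1" "\<And>x. \<bar>x\<bar> \<le> R \<Longrightarrow> \<theta> x = 1" "\<And>x. \<bar>x\<bar> \<ge> 3 * R \<Longrightarrow> \<theta> x = 0"
proof -
  \<comment> \<open>The smoothed signs centred at -2R and 2R differ by 2 on [-R, R] and agree at
    distance at least 3R from the origin.\<close>
  define \<theta> where "\<theta> x = (clip R (- 2 * R) x - clip R (2 * R) x) / 2" for x
  have a: "(x - - 2 * R) / R = x / R + 2" "(x - 2 * R) / R = x / R - 2" for x
    using assms by (auto simp: field_simps)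
  have \<theta>: "\<theta> x = (max (-1) (min 1 (x / R + 2)) - max (-1) (min 1 (x / R - 2))) / 2" for x
    unfolding \<theta>_def clip_def a ..
  have R: "\<bar>x\<bar> \<le> R \<Longrightarrow> \<bar>x / R\<bar> \<le> 1" "3 * R \<le> \<bar>x\<bar> \<Longrightarrow> 3 \<le> \<bar>x / R\<bar>" for x
    using assms by (auto simp: abs_div pos_le_divide_eq)
  define T :: "real \<Rightarrow> real" where "T t = (max (-1) (min 1 (t + 2)) - max (-1) (min 1 (t - 2))) / 2" for t
  have T: "0 \<le> T t" "T t \<le> 1" "\<bar>t\<bar> \<le> 1 \<Longrightarrow> T t = 1" "3 \<le> \<bar>t\<bar> \<Longrightarrow> T t = 0" for t
    by (auto simp: T_def max_def min_def abs_if split: if_splits)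
  have "0 \<le> \<theta> x" "\<theta> x \<le> 1" "\<bar>x\<bar> \<le> R \<Longrightarrow> \<theta> x = 1" "3 * R \<le> \<bar>x\<bar> \<Longrightarrow> \<theta> x = 0" for x
    unfolding \<theta> T_def[symmetric] using T[of "x / R"] R[of x] by blast+
  moreover have "\<exists>\<theta>'. multiplier \<theta> \<theta>' (1 / R)"
    using multiplier_half_diff[OF multiplier_clip[OF assms, of "- 2 * R"] multiplier_clip[OF assms, of "2 * R"]]
    unfolding \<theta>_def[abs_def] by blast
  ultimately show ?thesis using that by blast
qed

lemma H1_multiplier:
  assumes \<Omega>: "open \<Omega>" "convex \<Omega>" "\<Omega> \<noteq> {}" and ac: "ac_on \<Omega> U u'" and L2: "U \<in> L2 \<Omega>" "u' \<in> L2 \<Omega>"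
    and m: "multiplier \<psi> \<psi>' B"
  shows "H1_deriv \<Omega> (\<lambda>x. of_real (\<psi> x) * U x) (\<lambda>x. of_real (\<psi>' x) * U x + of_real (\<psi> x) * u' x)"
proof (rule H1_deriv_if_ac_on[OF \<Omega>])
  have b: "\<bar>\<psi> x\<bar> \<le> 1" "\<bar>\<psi>' x\<bar> \<le> B" for x using m by (auto simp: multiplier_def)
  have [measurable]: "\<psi> \<in> borel_measurable (lebesgue_on \<Omega>)" "\<psi>' \<in> borel_measurable (lebesgue_on \<Omega>)"
    using m by (auto simp: multiplier_def measurable_completion measurable_restrict_space1)
  have bnd: "(\<lambda>x. of_real (f x) * w x) \<in> L2 \<Omega>"
    if w: "w \<in> L2 \<Omega>" and [measurable]: "f \<in> borel_measurable (lebesgue_on \<Omega>)" and K: "\<And>x. \<bar>f x\<bar> \<le> K" for f K w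
  proof (rule L2_bound[where B="\<lambda>x. K\<^sup>2 * (cmod (w x))\<^sup>2"])
    show "(\<lambda>x. of_real (f x) * w x) \<in> borel_measurable (lebesgue_on \<Omega>)" using L2D(1)[OF w] by measurable
    show "integrable (lebesgue_on \<Omega>) (\<lambda>x. K\<^sup>2 * (cmod (w x))\<^sup>2)" using L2D(2)[OF w] by simp
    show "(cmod (of_real (f x) * w x))\<^sup>2 \<le> K\<^sup>2 * (cmod (w x))\<^sup>2" for x
      using K[of x] by (auto simp: norm_mult power_mult_distrib intro!: mult_right_mono abs_le_square_iff[THEN iffD1])
  qed
  show "(\<lambda>x. of_real (\<psi> x) * U x) \<in> L2 \<Omega>" by (rule bnd[OF L2(1) _ b(1)]) measurable
  show "(\<lambda>x. of_real (\<psi>' x) * U x + of_real (\<psi> x) * u' x) \<in> L2 \<Omega>"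
    by (intro L2_add bnd[OF L2(1) _ b(2)] bnd[OF L2(2) _ b(1)]) measurable
  show "ac_on \<Omega> (\<lambda>x. of_real (\<psi> x) * U x) (\<lambda>x. of_real (\<psi>' x) * U x + of_real (\<psi> x) * u' x)"
    by (rule ac_on_mult[OF \<Omega>(2) ac_on_subset[OF _ subset_UNIV] ac]) (use m in \<open>simp add: multiplier_def\<close>)
qed simp

text \<open>Tests the weak equation with \<open>\<psi> U\<close>; the compact support of \<open>\<psi>\<close> compensates for \<open>v U\<close> not being in \<open>L\<^sup>2\<close>.\<close>

lemma multiplier_energy_identity:
  fixes \<psi> \<psi>' :: "real \<Rightarrow> real" and z :: complex
  assumes \<Omega>: "open \<Omega>" "convex \<Omega>" "\<Omega> \<noteq> {}" and v: "continuous_on (closure \<Omega>) v"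
    and ac: "ac_on \<Omega> U u'" and L2: "U \<in> L2 \<Omega>" "u' \<in> L2 \<Omega>" "h \<in> L2 \<Omega>"
    and weak: "\<And>\<phi> \<phi>'. H1_deriv \<Omega> \<phi> \<phi>' \<Longrightarrow> bounded_support \<Omega> \<phi> \<Longrightarrow>
          complex_of_real \<nu> * (LINT y|lebesgue_on \<Omega>. u' y * cnj (\<phi>' y))
          + \<i> * complex_of_real k * (LINT y|lebesgue_on \<Omega>. complex_of_real (v y) * U y * cnj (\<phi> y))
          = (LINT y|lebesgue_on \<Omega>. h y * cnj (\<phi> y))"
    and m: "multiplier \<psi> \<psi>' B" and bs: "\<And>x. \<bar>x\<bar> \<ge> R \<Longrightarrow> \<psi> x = 0"
  defines "F \<equiv> \<lambda>x. h x + z * U x"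
  shows "integrable (lebesgue_on \<Omega>) (\<lambda>y. v y * \<psi> y * (cmod (U y))\<^sup>2)"
    and "\<nu> * (LINT y|lebesgue_on \<Omega>. \<psi> y * (cmod (u' y))\<^sup>2) + Re z * (LINT y|lebesgue_on \<Omega>. \<psi> y * (cmod (U y))\<^sup>2)
      \<le> L2_norm \<Omega> F * L2_norm \<Omega> U + \<bar>\<nu>\<bar> * B * (L2_norm \<Omega> u' * L2_norm \<Omega> U)"
    and "\<bar>k * (LINT y|lebesgue_on \<Omega>. v y * \<psi> y * (cmod (U y))\<^sup>2) + Im z * (LINT y|lebesgue_on \<Omega>. \<psi> y * (cmod (U y))\<^sup>2)\<bar>
      \<le> L2_norm \<Omega> F * L2_norm \<Omega> U + \<bar>\<nu>\<bar> * B * (L2_norm \<Omega> u' * L2_norm \<Omega> U)"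
proof -
  have \<Omega>s: "\<Omega> \<in> sets lebesgue" using \<Omega>(1) by simp
  have b: "\<bar>\<psi> x\<bar> \<le> 1" "\<bar>\<psi>' x\<bar> \<le> B" for x using m by (auto simp: multiplier_def)
  have [measurable]: "\<psi> \<in> borel_measurable (lebesgue_on \<Omega>)" "\<psi>' \<in> borel_measurable (lebesgue_on \<Omega>)"
    using m by (auto simp: multiplier_def measurable_completion measurable_restrict_space1)
  have [measurable]: "v \<in> borel_measurable (lebesgue_on \<Omega>)"
    by (rule continuous_imp_measurable_on_sets_lebesgue[OF continuous_on_subset[OF v closure_subset] \<Omega>s])
  have "compact (closure \<Omega> \<inter> cball 0 R)" by (intro closed_Int_compact) auto
  then have "bounded (v ` (closure \<Omega> \<inter> cball 0 R))"
    by (intro compact_imp_bounded compact_continuous_image continuous_on_subset[OF v]) auto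
  then obtain K where K: "\<And>x. x \<in> closure \<Omega> \<inter> cball 0 R \<Longrightarrow> \<bar>v x\<bar> \<le> K"
    unfolding bounded_iff by (metis image_eqI real_norm_def)
  have vb: "\<bar>v x * \<psi> x\<bar> \<le> \<bar>K\<bar>" if "x \<in> \<Omega>" for x
  proof (cases "\<bar>x\<bar> \<ge> R")
    case False
    then have "\<bar>v x\<bar> \<le> \<bar>K\<bar>" using K[of x] closure_subset that by (force simp: dist_real_def)
    then have "\<bar>v x\<bar> * \<bar>\<psi> x\<bar> \<le> \<bar>K\<bar> * 1" using b(1)[of x] by (intro mult_mono) auto
    then show ?thesis by (simp add: abs_mult)
  qed (simp add: bs)
  have FL: "F \<in> L2 \<Omega>" unfolding F_def by (intro L2_add L2_cmult L2)
  have m\<psi>: "\<psi> \<in> borel_measurable (lebesgue_on \<Omega>)" "\<psi>' \<in> borel_measurable (lebesgue_on \<Omega>)" "(\<lambda>x. v x * \<psi> x) \<in> borel_measurable (lebesgue_on \<Omega>)"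
    by measurable
  note pP = L2_weighted_pairing[OF L2(2) L2(2) m\<psi>(1) b(1)]
  note pQ = L2_weighted_pairing[OF L2(2) L2(1) m\<psi>(2) b(2)]
  have pS: "integrable (lebesgue_on \<Omega>) (\<lambda>x. complex_of_real (v x * \<psi> x) * (U x * cnj (U x)))"
    by (rule L2_weighted_pairing(1)[OF L2(1) L2(1) m\<psi>(3) vb])
  note pB = L2_weighted_pairing[OF L2(1) L2(1) m\<psi>(1) b(1)]
  note pG = L2_weighted_pairing[OF FL L2(1) m\<psi>(1) b(1)]
  note pH = L2_weighted_pairing[OF L2(3) L2(1) m\<psi>(1) b(1)]
  have sq: "of_real c * (w * cnj w) = complex_of_real (c * (cmod w)\<^sup>2)" for c :: real and w
    by (simp only: complex_norm_square of_real_mult)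
  show iS: "integrable (lebesgue_on \<Omega>) (\<lambda>y. v y * \<psi> y * (cmod (U y))\<^sup>2)"
    using pS unfolding sq complex_of_real_integrable_eq .
  \<comment> \<open>Dissipation \<open>P\<close>, potential energy \<open>S\<close>, mass
    \<open>D\<close>, commutator with the multiplier \<open>Q\<close>, and forcing \<open>G\<close>.
    The tested equation reads \<nu> (P + Q) + i k S + z D = G with \<open>P\<close>,
    \<open>S\<close> and \<open>D\<close> real; its real and imaginary parts give the two
    estimates.\<close>
  define P where "P = (LINT y|lebesgue_on \<Omega>. \<psi> y * (cmod (u' y))\<^sup>2)"
  define S where "S = (LINT y|lebesgue_on \<Omega>. v y * \<psi> y * (cmod (U y))\<^sup>2)"
  define D where "D = (LINT y|lebesgue_on \<Omega>. \<psi> y * (cmod (U y))\<^sup>2)"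
  define Q where "Q = (LINT y|lebesgue_on \<Omega>. of_real (\<psi>' y) * (u' y * cnj (U y)))"
  define G where "G = (LINT y|lebesgue_on \<Omega>. of_real (\<psi> y) * (F y * cnj (U y)))"
  define \<phi> where "\<phi> x = of_real (\<psi> x) * U x" for x
  define \<phi>' where "\<phi>' x = of_real (\<psi>' x) * U x + of_real (\<psi> x) * u' x" for x
  have "bounded_support \<Omega> \<phi>"
    unfolding bounded_support_def
    by (intro exI[of _ "cball 0 R"]) (auto simp: \<phi>_def bs dist_real_def intro!: AE_I2)
  then have eq: "complex_of_real \<nu> * (LINT y|lebesgue_on \<Omega>. u' y * cnj (\<phi>' y))
          + \<i> * complex_of_real k * (LINT y|lebesgue_on \<Omega>. complex_of_real (v y) * U y * cnj (\<phi> y))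
          = (LINT y|lebesgue_on \<Omega>. h y * cnj (\<phi> y))"
    using H1_multiplier[OF \<Omega> ac L2(1,2) m] unfolding \<phi>_def \<phi>'_def by (intro weak) auto
  have e1: "(LINT y|lebesgue_on \<Omega>. u' y * cnj (\<phi>' y)) = of_real P + Q"
  proof -
    have "(LINT y|lebesgue_on \<Omega>. u' y * cnj (\<phi>' y)) = (LINT y|lebesgue_on \<Omega>. of_real (\<psi> y) * (u' y * cnj (u' y)) + of_real (\<psi>' y) * (u' y * cnj (U y)))"
      by (intro Bochner_Integration.integral_cong) (auto simp: \<phi>'_def algebra_simps)
    also have "\<dots> = (LINT y|lebesgue_on \<Omega>. of_real (\<psi> y) * (u' y * cnj (u' y))) + Q"
      unfolding Q_def by (rule Bochner_Integration.integral_add[OF pP(1) pQ(1)])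
    finally show ?thesis unfolding sq P_def integral_complex_of_real .
  qed
  have e2: "(LINT y|lebesgue_on \<Omega>. complex_of_real (v y) * U y * cnj (\<phi> y)) = of_real S"
    unfolding S_def integral_complex_of_real[symmetric] sq[symmetric]
    by (intro Bochner_Integration.integral_cong) (auto simp: \<phi>_def algebra_simps)
  have e3: "(LINT y|lebesgue_on \<Omega>. h y * cnj (\<phi> y)) = G - z * of_real D"
  proof -
    have "G = (LINT y|lebesgue_on \<Omega>. of_real (\<psi> y) * (h y * cnj (U y)) + z * (of_real (\<psi> y) * (U y * cnj (U y))))"
      unfolding G_def F_def by (intro Bochner_Integration.integral_cong) (auto simp: algebra_simps)
    also have "\<dots> = (LINT y|lebesgue_on \<Omega>. of_real (\<psi> y) * (h y * cnj (U y))) + z * (LINT y|lebesgue_on \<Omega>. of_real (\<psi> y) * (U y * cnj (U y)))"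
      using pH(1) pB(1) by (simp only: Bochner_Integration.integral_add integrable_mult_right integral_mult_right_zero)
    also have "(LINT y|lebesgue_on \<Omega>. of_real (\<psi> y) * (U y * cnj (U y))) = of_real D"
      unfolding sq D_def integral_complex_of_real ..
    also have "(LINT y|lebesgue_on \<Omega>. of_real (\<psi> y) * (h y * cnj (U y))) = (LINT y|lebesgue_on \<Omega>. h y * cnj (\<phi> y))"
      by (intro Bochner_Integration.integral_cong) (auto simp: \<phi>_def algebra_simps)
    finally show ?thesis by simp
  qed
  have main: "complex_of_real \<nu> * (of_real P + Q) + \<i> * complex_of_real k * of_real S + z * of_real D = G"
    using eq unfolding e1 e2 e3 by simp
  have "\<nu> * P + Re z * D = Re G - \<nu> * Re Q" "k * S + Im z * D = Im G - \<nu> * Im Q"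
    using arg_cong[OF main, of Re] arg_cong[OF main, of Im] by (auto simp: algebra_simps)
  moreover have "\<bar>Re G\<bar> \<le> L2_norm \<Omega> F * L2_norm \<Omega> U" "\<bar>Im G\<bar> \<le> L2_norm \<Omega> F * L2_norm \<Omega> U"
    using pG(2) abs_Re_le_cmod[of G] abs_Im_le_cmod[of G] unfolding G_def by linarith+
  moreover have "\<bar>\<nu> * Re Q\<bar> \<le> \<bar>\<nu>\<bar> * (B * (L2_norm \<Omega> u' * L2_norm \<Omega> U))" "\<bar>\<nu> * Im Q\<bar> \<le> \<bar>\<nu>\<bar> * (B * (L2_norm \<Omega> u' * L2_norm \<Omega> U))"
    unfolding abs_mult using pQ(2) abs_Re_le_cmod[of Q] abs_Im_le_cmod[of Q] unfolding Q_def by (intro mult_left_mono; linarith)+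
  ultimately show "\<nu> * P + Re z * D \<le> L2_norm \<Omega> F * L2_norm \<Omega> U + \<bar>\<nu>\<bar> * B * (L2_norm \<Omega> u' * L2_norm \<Omega> U)"
    "\<bar>k * S + Im z * D\<bar> \<le> L2_norm \<Omega> F * L2_norm \<Omega> U + \<bar>\<nu>\<bar> * B * (L2_norm \<Omega> u' * L2_norm \<Omega> U)"
    unfolding mult.assoc by linarith+
qed

text \<open>The weak equation sees \<open>u\<close> only through integrals, so its absolutely
  continuous representative solves the same equation. The product rule and pointwise bounds are then
  available.\<close>

lemma neumann_op_ac_representative:
  assumes \<Omega>: "open \<Omega>" "convex \<Omega>" "\<Omega> \<noteq> {}" and v: "continuous_on (closure \<Omega>) v" and op: "neumann_op \<Omega> v \<nu> k u h"
  obtains U u' where "ac_on \<Omega> U u'" "U \<in> L2 \<Omega>" "u' \<in> L2 \<Omega>" "h \<in> L2 \<Omega>" "AE x in lebesgue_on \<Omega>. u x = U x" "u \<in> L2 \<Omega>"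
    "\<And>\<phi> \<phi>'. H1_deriv \<Omega> \<phi> \<phi>' \<Longrightarrow> bounded_support \<Omega> \<phi> \<Longrightarrow>
          complex_of_real \<nu> * (LINT y|lebesgue_on \<Omega>. u' y * cnj (\<phi>' y))
          + \<i> * complex_of_real k * (LINT y|lebesgue_on \<Omega>. complex_of_real (v y) * U y * cnj (\<phi> y))
          = (LINT y|lebesgue_on \<Omega>. h y * cnj (\<phi> y))"
proof -
  have \<Omega>s: "\<Omega> \<in> sets lebesgue" using \<Omega>(1) by simp
  obtain u' where H: "H1_deriv \<Omega> u u'" and h: "h \<in> L2 \<Omega>" and weak: "\<And>\<phi> \<phi>'. H1_deriv \<Omega> \<phi> \<phi>' \<Longrightarrow> bounded_support \<Omega> \<phi> \<Longrightarrow>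
          complex_of_real \<nu> * (LINT y|lebesgue_on \<Omega>. u' y * cnj (\<phi>' y))
          + \<i> * complex_of_real k * (LINT y|lebesgue_on \<Omega>. complex_of_real (v y) * u y * cnj (\<phi> y))
          = (LINT y|lebesgue_on \<Omega>. h y * cnj (\<phi> y))"
    using op unfolding neumann_op_def by blast
  have uL: "u \<in> L2 \<Omega>" "u' \<in> L2 \<Omega>" using H by (auto simp: H1_deriv_def)
  obtain U where U: "ac_on \<Omega> U u'" "AE x in lebesgue_on \<Omega>. u x = U x"
    using H1_ac_representative[OF \<Omega> H] by blast
  have [measurable]: "U \<in> borel_measurable (lebesgue_on \<Omega>)"
    by (rule continuous_imp_measurable_on_sets_lebesgue[OF ac_on_continuous_open[OF U(1) \<Omega>(1,2)] \<Omega>s])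
  have [measurable]: "u \<in> borel_measurable (lebesgue_on \<Omega>)" by (rule L2D(1)[OF uL(1)])
  have [measurable]: "v \<in> borel_measurable (lebesgue_on \<Omega>)"
    by (rule continuous_imp_measurable_on_sets_lebesgue[OF continuous_on_subset[OF v closure_subset] \<Omega>s])
  have "integrable (lebesgue_on \<Omega>) (\<lambda>x. (cmod (u x))\<^sup>2) \<longleftrightarrow> integrable (lebesgue_on \<Omega>) (\<lambda>x. (cmod (U x))\<^sup>2)"
    by (rule integrable_cong_AE) (use U(2) in \<open>auto elim!: AE_mp\<close>)
  then have UL: "U \<in> L2 \<Omega>" using L2D(2)[OF uL(1)] by (simp add: L2_def)
  show ?thesis
  proof (rule that[OF U(1) UL uL(2) h U(2) uL(1)])
    fix \<phi> \<phi>' assume \<phi>: "H1_deriv \<Omega> \<phi> \<phi>'" "bounded_support \<Omega> \<phi>"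
    have "\<phi> \<in> L2 \<Omega>" using \<phi>(1) by (simp add: H1_deriv_def)
    note [measurable] = L2D(1)[OF L2_cnj[OF this]]
    have "(LINT y|lebesgue_on \<Omega>. complex_of_real (v y) * U y * cnj (\<phi> y)) = (LINT y|lebesgue_on \<Omega>. complex_of_real (v y) * u y * cnj (\<phi> y))"
      by (rule integral_cong_AE) (use U(2) in \<open>auto elim!: AE_mp\<close>)
    then show "complex_of_real \<nu> * (LINT y|lebesgue_on \<Omega>. u' y * cnj (\<phi>' y))
          + \<i> * complex_of_real k * (LINT y|lebesgue_on \<Omega>. complex_of_real (v y) * U y * cnj (\<phi> y))
          = (LINT y|lebesgue_on \<Omega>. h y * cnj (\<phi> y))" using weak[OF \<phi>] by simp
  qed
qed

text \<open>Removes the cutoff after an energy estimate: at each point \<theta> n is eventually 1,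
  and |f| dominates.\<close>

lemma plateau_integral_tendsto:
  fixes f :: "real \<Rightarrow> real"
  assumes f: "integrable (lebesgue_on \<Omega>) f"
    and m: "\<And>n. multiplier (\<theta> n) (\<theta>' n) (B n)" and one: "\<And>n x. \<bar>x\<bar> \<le> real (Suc n) \<Longrightarrow> \<theta> n x = 1"
  shows "(\<lambda>n. LINT x|lebesgue_on \<Omega>. \<theta> n x * f x) \<longlonglongrightarrow> (LINT x|lebesgue_on \<Omega>. f x)"
proof (rule integral_dominated_convergence[where w="\<lambda>x. \<bar>f x\<bar>"])
  have [measurable]: "f \<in> borel_measurable (lebesgue_on \<Omega>)" using f by simp
  have [measurable]: "\<theta> n \<in> borel_measurable (lebesgue_on \<Omega>)" for n
    using m[of n] by (auto simp: multiplier_def measurable_completion measurable_restrict_space1)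
  show "f \<in> borel_measurable (lebesgue_on \<Omega>)" "(\<lambda>x. \<theta> n x * f x) \<in> borel_measurable (lebesgue_on \<Omega>)" for n by measurable
  show "integrable (lebesgue_on \<Omega>) (\<lambda>x. \<bar>f x\<bar>)" using f by simp
  show "AE x in lebesgue_on \<Omega>. (\<lambda>n. \<theta> n x * f x) \<longlonglongrightarrow> f x"
  proof (rule AE_I2, rule tendsto_eventually)
    fix x
    obtain N where "\<bar>x\<bar> \<le> real N" using real_arch_simple by blast
    then have "\<theta> n x * f x = f x" if "n \<ge> N" for n using one[of x n] that by auto
    then show "\<forall>\<^sub>F n in sequentially. \<theta> n x * f x = f x" by (auto simp: eventually_sequentially)
  qed
  show "AE x in lebesgue_on \<Omega>. norm (\<theta> n x * f x) \<le> \<bar>f x\<bar>" for n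
    using m[of n] by (intro AE_I2) (auto simp: multiplier_def abs_mult intro: mult_left_le_one_le)
qed

text \<open>Off \<open>Z\<close> the sign of \<open>w\<close> is that of a signed product of factors
  \<open>y - z\<close>, taken over the points where \<open>w\<close> flips. Replacing each factor by
  its clipped version preserves the sign and makes the modulus 1 at distance \<delta> from
  \<open>Z\<close>; every factor adds 1 / \<delta> to the bound on the derivative.\<close>

lemma sign_multiplier:
  fixes w :: "real \<Rightarrow> real"
  assumes \<Omega>: "convex \<Omega>" and w: "continuous_on \<Omega> w" and Z: "finite Z" "\<And>x. x \<in> \<Omega> \<Longrightarrow> w x = 0 \<Longrightarrow> x \<in> Z" and \<delta>: "\<delta> > 0"
  obtains \<sigma> \<sigma>' where "multiplier \<sigma> \<sigma>' (real (card Z) / \<delta>)" "\<And>y. y \<in> \<Omega> - Z \<Longrightarrow> \<sigma> y * w y \<ge> 0"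
    "\<And>y. y \<in> \<Omega> \<Longrightarrow> (\<forall>z\<in>Z. \<delta> \<le> \<bar>y - z\<bar>) \<Longrightarrow> \<sigma> y * w y = \<bar>w y\<bar>"
proof -
  have "\<exists>Z'\<subseteq>Z. \<exists>s\<in>{-1, 1}. \<forall>y\<in>\<Omega> - Z. s * (\<Prod>z\<in>Z'. y - z) * w y > 0"
  proof (rule sign_pattern_product[OF Z(1)])
    fix x y assume xy: "x \<in> \<Omega>" "y \<in> \<Omega>" "x \<le> y" "{x..y} \<inter> Z = {}"
    have sub: "{x..y} \<subseteq> \<Omega>" by (rule convex_interval_subset[OF \<Omega> xy(1,2)])
    show "w x * w y > 0"
      by (rule continuous_nonzero_same_sign[OF xy(3) continuous_on_subset[OF w sub]]) (use Z(2) sub xy(4) in blast)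
  qed
  then obtain Z' s where Z': "Z' \<subseteq> Z" "s \<in> {-1, 1}" "\<And>y. y \<in> \<Omega> - Z \<Longrightarrow> s * (\<Prod>z\<in>Z'. y - z) * w y > 0" by blast
  have fin: "finite Z'" using Z'(1) Z(1) finite_subset by blast
  obtain \<psi>' where \<psi>': "multiplier (\<lambda>x. \<Prod>z\<in>Z'. clip \<delta> z x) \<psi>' (real (card Z') / \<delta>)"
    using multiplier_clip_prod[OF fin \<delta>] by blast
  define \<sigma> where "\<sigma> x = s * (\<Prod>z\<in>Z'. clip \<delta> z x)" for x
  have "\<bar>s\<bar> \<le> 1" using Z'(2) by auto
  from multiplier_mult[OF multiplier_const[OF this] \<psi>']
  obtain \<sigma>' where \<sigma>0: "multiplier \<sigma> \<sigma>' (real (card Z') / \<delta>)" unfolding \<sigma>_def[abs_def] by auto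
  have "real (card Z') / \<delta> \<le> real (card Z) / \<delta>"
    using card_mono[OF Z(1) Z'(1)] \<delta> by (intro divide_right_mono) auto
  then have 1: "multiplier \<sigma> \<sigma>' (real (card Z) / \<delta>)" using \<sigma>0 unfolding multiplier_def by (meson order_trans)
  \<comment> \<open>Clipping only rescales \<open>y - z\<close> by a positive number, so the sign
    pattern of the polynomial product carries over to the clipped product.\<close>
  have ratio: "\<exists>r>0. clip \<delta> z y = r * (y - z)" if "y \<noteq> z" for y z
  proof -
    have "clip \<delta> z y / (y - z) > 0"
    proof (cases "y > z")
      case True
      then have "(y - z) / \<delta> > 0" using \<delta> by simp
      then have "clip \<delta> z y > 0" by (auto simp: clip_def max_def min_def)
      then show ?thesis using True by simp
    next
      case False
      then have "(y - z) / \<delta> < 0" using \<delta> that by (simp add: divide_neg_pos)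
      then have "clip \<delta> z y < 0" by (auto simp: clip_def max_def min_def)
      then show ?thesis using False that by (simp add: divide_neg_neg)
    qed
    then show ?thesis using that by (intro exI[of _ "clip \<delta> z y / (y - z)"]) auto
  qed
  have pos: "\<sigma> y * w y > 0" if y: "y \<in> \<Omega> - Z" for y
  proof -
    obtain r where r: "\<And>z. z \<in> Z' \<Longrightarrow> r z > 0 \<and> clip \<delta> z y = r z * (y - z)"
      using ratio[of y] y Z'(1) by (metis DiffD2 subsetD)
    have eq: "\<sigma> y * w y = (\<Prod>z\<in>Z'. r z) * (s * (\<Prod>z\<in>Z'. y - z) * w y)"
      unfolding \<sigma>_def using r by (simp add: prod.distrib[symmetric] mult_ac cong: prod.cong)
    have "(\<Prod>z\<in>Z'. r z) > 0" using r by (intro prod_pos) auto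
    then show ?thesis unfolding eq by (rule mult_pos_pos[OF _ Z'(3)[OF y]])
  qed
  have 3: "\<sigma> y * w y = \<bar>w y\<bar>" if y: "y \<in> \<Omega>" "\<forall>z\<in>Z. \<delta> \<le> \<bar>y - z\<bar>" for y
  proof -
    have "y \<notin> Z" using y(2) \<delta> by force
    have "\<bar>clip \<delta> z y\<bar> = 1" if z: "z \<in> Z'" for z
    proof -
      have "\<delta> \<le> \<bar>y - z\<bar>" using y(2) z Z'(1) by blast
      then have "1 \<le> (y - z) / \<delta> \<or> (y - z) / \<delta> \<le> -1" using \<delta> by (auto simp: le_divide_eq divide_le_eq)
      then show ?thesis by (auto simp: clip_def)
    qed
    then have "\<bar>\<sigma> y\<bar> = 1" unfolding \<sigma>_def abs_mult abs_prod using Z'(2) by auto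
    then have "\<bar>\<sigma> y * w y\<bar> = \<bar>w y\<bar>" by (simp add: abs_mult)
    then show ?thesis using pos[of y] y(1) \<open>y \<notin> Z\<close> by simp
  qed
  show ?thesis by (rule that[OF 1]) (use pos 3 in \<open>auto intro: less_imp_le\<close>)
qed

section \<open>The resolvent bound\<close>

lemma finite_AE_notin:
  fixes Z :: "real set"
  assumes "finite Z" "\<Omega> \<in> sets lebesgue" shows "AE x in lebesgue_on \<Omega>. x \<notin> Z"
proof -
  have "Z \<in> null_sets lebesgue" using negligible_finite[OF assms(1)] by (simp add: negligible_iff_null_sets)
  from AE_not_in[OF this] show ?thesis
    using assms(2) by (auto simp: AE_restrict_space_iff elim!: AE_mp)
qed

text \<open>\<open>W\<close> is the norm of the derivative of \<open>u\<close>. The first term on the right bounds \<open>u\<close> on the \<open>\<delta>\<close>-neighbourhood of \<open>Z\<close>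
  by its supremum, the second bounds it elsewhere through the multiplier \<open>\<sigma>\<close> that carries the sign of \<open>v - lam\<close>.\<close>

lemma resolvent_estimate_raw:
  fixes z :: complex
  assumes \<Omega>: "open \<Omega>" "convex \<Omega>" "\<Omega> \<noteq> {}" and unb: "\<And>n::nat. \<exists>a b. a \<in> \<Omega> \<and> b \<in> \<Omega> \<and> b - a = real n"
    and v: "continuous_on (closure \<Omega>) v"
    and op: "neumann_op \<Omega> v \<nu> k u h" and \<nu>: "\<nu> > 0" and k: "k \<noteq> 0" and z: "Re z \<ge> 0"
    and \<delta>: "\<delta> > 0" and \<kappa>: "\<kappa> > 0" and Z: "finite Z" "card Z \<le> N" "\<And>x. x \<in> \<Omega> \<Longrightarrow> v x = - Im z / k \<Longrightarrow> x \<in> Z"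
    and far: "\<And>y. y \<in> \<Omega> \<Longrightarrow> (\<forall>z\<in>Z. \<delta> \<le> \<bar>y - z\<bar>) \<Longrightarrow> \<kappa> \<le> \<bar>v y - (- Im z / k)\<bar>"
  defines "X \<equiv> L2_norm \<Omega> (\<lambda>x. h x + z * u x)" and "Y \<equiv> L2_norm \<Omega> u"
  shows "\<exists>W\<ge>0. \<nu> * W\<^sup>2 \<le> X * Y \<and>
    Y\<^sup>2 \<le> 4 * real N * \<delta> * (W * Y) + (X * Y + \<nu> * (real N / \<delta>) * (W * Y)) / (\<bar>k\<bar> * \<kappa>)"
proof -
  have \<Omega>s: "\<Omega> \<in> sets lebesgue" using \<Omega>(1) by simp
  \<comment> \<open>The imaginary part of i k v + z equals k (v - lam), so \<open>lam\<close> is the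
    level at which the potential gives no control.\<close>
  define lam where "lam = - Im z / k"
  obtain U u' where ac: "ac_on \<Omega> U u'" and L2: "U \<in> L2 \<Omega>" "u' \<in> L2 \<Omega>" "h \<in> L2 \<Omega>" and ae: "AE x in lebesgue_on \<Omega>. u x = U x" and uL: "u \<in> L2 \<Omega>"
    and weak: "\<And>\<phi> \<phi>'. H1_deriv \<Omega> \<phi> \<phi>' \<Longrightarrow> bounded_support \<Omega> \<phi> \<Longrightarrow>
          complex_of_real \<nu> * (LINT y|lebesgue_on \<Omega>. u' y * cnj (\<phi>' y))
          + \<i> * complex_of_real k * (LINT y|lebesgue_on \<Omega>. complex_of_real (v y) * U y * cnj (\<phi> y))
          = (LINT y|lebesgue_on \<Omega>. h y * cnj (\<phi> y))"
    using neumann_op_ac_representative[OF \<Omega> v op] by blast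
  define W where "W = L2_norm \<Omega> u'"
  have XU: "L2_norm \<Omega> (\<lambda>x. h x + z * U x) = X"
    unfolding X_def
  proof (rule L2_norm_cong_AE)
    show "AE x in lebesgue_on \<Omega>. h x + z * U x = h x + z * u x" using ae by eventually_elim simp
  qed (intro L2_add L2_cmult L2 uL)+
  have YU: "L2_norm \<Omega> U = Y"
    unfolding Y_def
  proof (rule L2_norm_cong_AE)
    show "AE x in lebesgue_on \<Omega>. U x = u x" using ae by eventually_elim simp
  qed (intro L2 uL)+
  have nn: "X \<ge> 0" "Y \<ge> 0" "W \<ge> 0" by (simp_all add: X_def Y_def W_def)
  have "\<exists>\<theta> \<theta>'. multiplier \<theta> \<theta>' (1 / real (Suc n)) \<and> (\<forall>x. 0 \<le> \<theta> x) \<and> (\<forall>x. \<bar>x\<bar> \<le> real (Suc n) \<longrightarrow> \<theta> x = 1) \<and> (\<forall>x. \<bar>x\<bar> \<ge> 3 * real (Suc n) \<longrightarrow> \<theta> x = 0)" for n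
    by (rule multiplier_plateau[of "real (Suc n)"]) (simp, blast)
  then obtain \<theta> \<theta>' where \<theta>: "\<And>n. multiplier (\<theta> n) (\<theta>' n) (1 / real (Suc n))" "\<And>n x. 0 \<le> \<theta> n x"
    "\<And>n x. \<bar>x\<bar> \<le> real (Suc n) \<Longrightarrow> \<theta> n x = 1" "\<And>n x. \<bar>x\<bar> \<ge> 3 * real (Suc n) \<Longrightarrow> \<theta> n x = 0" by metis
  note identity = multiplier_energy_identity(2,3)[OF \<Omega> v ac L2 weak, where z=z, unfolded XU YU W_def[symmetric]]
  have lim1: "(\<lambda>n. 1 / real (Suc n)) \<longlonglongrightarrow> 0"
    using LIMSEQ_inverse_real_of_nat by (simp add: inverse_eq_divide)
  have U2: "integrable (lebesgue_on \<Omega>) (\<lambda>y. (cmod (U y))\<^sup>2)" by (rule L2D(2)[OF L2(1)])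
  \<comment> \<open>The natural multiplier is the constant 1, whose product with \<open>U\<close>
    need not have bounded support. Plateaus replace it; their slopes 1 / (n + 1) kill the commutator
    term in the limit, and Re z \<ge> 0 allows dropping the mass term.\<close>
  have dissipation: "\<nu> * W\<^sup>2 \<le> X * Y"
  proof -
    have "\<nu> * (LINT y|lebesgue_on \<Omega>. \<theta> n y * (cmod (u' y))\<^sup>2) \<le> X * Y + \<nu> * (1 / real (Suc n)) * (W * Y)" for n
    proof -
      have "\<nu> * (LINT y|lebesgue_on \<Omega>. \<theta> n y * (cmod (u' y))\<^sup>2) + Re z * (LINT y|lebesgue_on \<Omega>. \<theta> n y * (cmod (U y))\<^sup>2)
        \<le> X * Y + \<bar>\<nu>\<bar> * (1 / real (Suc n)) * (W * Y)"
        by (rule identity(1)[OF _ _ \<theta>(1) \<theta>(4)]) auto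
      moreover have "0 \<le> Re z * (LINT y|lebesgue_on \<Omega>. \<theta> n y * (cmod (U y))\<^sup>2)"
        using z \<theta>(2) by (intro mult_nonneg_nonneg Bochner_Integration.integral_nonneg) auto
      ultimately show ?thesis using \<nu> by simp
    qed
    moreover have "(\<lambda>n. \<nu> * (LINT y|lebesgue_on \<Omega>. \<theta> n y * (cmod (u' y))\<^sup>2)) \<longlonglongrightarrow> \<nu> * (LINT y|lebesgue_on \<Omega>. (cmod (u' y))\<^sup>2)"
      by (intro tendsto_mult tendsto_const plateau_integral_tendsto[OF L2D(2)[OF L2(2)] \<theta>(1,3)])
    moreover have "(\<lambda>n. X * Y + \<nu> * (1 / real (Suc n)) * (W * Y)) \<longlonglongrightarrow> X * Y + \<nu> * 0 * (W * Y)"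
      by (intro tendsto_intros lim1)
    ultimately have "\<nu> * (LINT y|lebesgue_on \<Omega>. (cmod (u' y))\<^sup>2) \<le> X * Y + \<nu> * 0 * (W * Y)"
      by (intro LIMSEQ_le) auto
    then show ?thesis by (simp add: W_def L2_norm_squared)
  qed
  define E where "E = (\<Union>z\<in>Z. {z - \<delta><..<z + \<delta>})"
  have "open E" unfolding E_def by auto
  then have Es: "E \<in> sets lebesgue" "- E \<in> sets lebesgue" by (auto simp: closed_Compl)
  have far': "\<forall>z\<in>Z. \<delta> \<le> \<bar>y - z\<bar>" if "y \<notin> E" for y using that unfolding E_def by force
  have ig: "integrable (lebesgue_on \<Omega>) (\<lambda>y. indicator (- E) y * (cmod (U y))\<^sup>2)"
    "integrable (lebesgue_on \<Omega>) (\<lambda>y. indicator E y * (cmod (U y))\<^sup>2)"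
    by (rule integrable_indicator_times[OF U2 Es(2)], rule integrable_indicator_times[OF U2 Es(1)])
  have outside: "\<bar>k\<bar> * \<kappa> * (LINT y|lebesgue_on \<Omega>. indicator (- E) y * (cmod (U y))\<^sup>2) \<le> X * Y + \<nu> * (real N / \<delta>) * (W * Y)"
  proof -
    have cw: "continuous_on \<Omega> (\<lambda>y. v y - lam)"
      by (intro continuous_intros continuous_on_subset[OF v closure_subset])
    obtain \<sigma> \<sigma>' where \<sigma>: "multiplier \<sigma> \<sigma>' (real (card Z) / \<delta>)" "\<And>y. y \<in> \<Omega> - Z \<Longrightarrow> \<sigma> y * (v y - lam) \<ge> 0"
      "\<And>y. y \<in> \<Omega> \<Longrightarrow> (\<forall>z\<in>Z. \<delta> \<le> \<bar>y - z\<bar>) \<Longrightarrow> \<sigma> y * (v y - lam) = \<bar>v y - lam\<bar>"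
      by (rule sign_multiplier[OF \<Omega>(2) cw Z(1) _ \<delta>]) (use Z(3) in \<open>auto simp: lam_def\<close>)
    \<comment> \<open>The sign multiplier need not have bounded support either, so it is tested
      together with a plateau. The price is an additional slope 1 / (n + 1) that disappears in the
      limit.\<close>
    have "\<bar>k\<bar> * (\<kappa> * (LINT y|lebesgue_on \<Omega>. \<theta> n y * (indicator (- E) y * (cmod (U y))\<^sup>2)))
       \<le> X * Y + \<nu> * (real N / \<delta> + 1 / real (Suc n)) * (W * Y)" for n
    proof -
      define \<psi> where "\<psi> y = \<sigma> y * \<theta> n y" for y
      obtain \<psi>' where m: "multiplier \<psi> \<psi>' (real (card Z) / \<delta> + 1 / real (Suc n))"
        using multiplier_mult[OF \<sigma>(1) \<theta>(1)[of n]] unfolding \<psi>_def[abs_def] by blast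
      have bs: "\<psi> y = 0" if "\<bar>y\<bar> \<ge> 3 * real (Suc n)" for y using \<theta>(4)[OF that] by (simp add: \<psi>_def)
      have [measurable]: "\<psi> \<in> borel_measurable (lebesgue_on \<Omega>)" "\<theta> n \<in> borel_measurable (lebesgue_on \<Omega>)"
        using m \<theta>(1)[of n] by (auto simp: multiplier_def measurable_completion measurable_restrict_space1)
      have i1: "integrable (lebesgue_on \<Omega>) (\<lambda>y. v y * \<psi> y * (cmod (U y))\<^sup>2)"
        by (rule multiplier_energy_identity(1)[OF \<Omega> v ac L2 weak m bs])
      have bnd: "integrable (lebesgue_on \<Omega>) (\<lambda>y. f y * w y)"
        if w: "integrable (lebesgue_on \<Omega>) w" and [measurable]: "f \<in> borel_measurable (lebesgue_on \<Omega>)" and "\<And>y. \<bar>f y\<bar> \<le> 1" for f w :: "real \<Rightarrow> real"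
        by (rule Bochner_Integration.integrable_bound[OF w])
          (use w that(3) in \<open>auto intro!: AE_I2 mult_left_le_one_le simp: abs_mult\<close>)
      have i2: "integrable (lebesgue_on \<Omega>) (\<lambda>y. \<psi> y * (cmod (U y))\<^sup>2)"
        by (rule bnd[OF U2]) (use m in \<open>auto simp: multiplier_def\<close>)
      have i3: "integrable (lebesgue_on \<Omega>) (\<lambda>y. \<theta> n y * (indicator (- E) y * (cmod (U y))\<^sup>2))"
        by (rule bnd[OF ig(1)]) (use \<theta>(1)[of n] in \<open>auto simp: multiplier_def\<close>)
      \<comment> \<open>Potential and mass terms have no sign separately. Combined, they form the
        integral of \<psi> (v - lam) |U|^2, which is nonnegative almost everywhere by the choice of
        \<sigma>.\<close>
      define J where "J = (LINT y|lebesgue_on \<Omega>. v y * \<psi> y * (cmod (U y))\<^sup>2 - lam * (\<psi> y * (cmod (U y))\<^sup>2))"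
      have J: "J = (LINT y|lebesgue_on \<Omega>. v y * \<psi> y * (cmod (U y))\<^sup>2) - lam * (LINT y|lebesgue_on \<Omega>. \<psi> y * (cmod (U y))\<^sup>2)"
        unfolding J_def using i1 i2 by simp
      have "k * (LINT y|lebesgue_on \<Omega>. v y * \<psi> y * (cmod (U y))\<^sup>2) + Im z * (LINT y|lebesgue_on \<Omega>. \<psi> y * (cmod (U y))\<^sup>2) = k * J"
        unfolding J lam_def using k by (simp add: algebra_simps)
      moreover have "\<bar>k * (LINT y|lebesgue_on \<Omega>. v y * \<psi> y * (cmod (U y))\<^sup>2) + Im z * (LINT y|lebesgue_on \<Omega>. \<psi> y * (cmod (U y))\<^sup>2)\<bar>
        \<le> X * Y + \<bar>\<nu>\<bar> * (real (card Z) / \<delta> + 1 / real (Suc n)) * (W * Y)"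
        by (rule identity(2)[OF _ _ m bs]) auto
      ultimately have kJ: "\<bar>k\<bar> * \<bar>J\<bar> \<le> X * Y + \<nu> * (real (card Z) / \<delta> + 1 / real (Suc n)) * (W * Y)"
        using \<nu> by (simp add: abs_mult)
      have "\<kappa> * (LINT y|lebesgue_on \<Omega>. \<theta> n y * (indicator (- E) y * (cmod (U y))\<^sup>2)) = (LINT y|lebesgue_on \<Omega>. \<kappa> * (\<theta> n y * (indicator (- E) y * (cmod (U y))\<^sup>2)))" by simp
      also have "\<dots> \<le> J" unfolding J_def
      proof (rule integral_mono_AE)
        show "integrable (lebesgue_on \<Omega>) (\<lambda>y. \<kappa> * (\<theta> n y * (indicator (- E) y * (cmod (U y))\<^sup>2)))" using i3 by simp
        show "integrable (lebesgue_on \<Omega>) (\<lambda>y. v y * \<psi> y * (cmod (U y))\<^sup>2 - lam * (\<psi> y * (cmod (U y))\<^sup>2))" using i1 i2 by simp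
        have "AE y in lebesgue_on \<Omega>. y \<in> \<Omega>" by (rule AE_I2) simp
        with finite_AE_notin[OF Z(1) \<Omega>s]
        show "AE y in lebesgue_on \<Omega>. \<kappa> * (\<theta> n y * (indicator (- E) y * (cmod (U y))\<^sup>2)) \<le> v y * \<psi> y * (cmod (U y))\<^sup>2 - lam * (\<psi> y * (cmod (U y))\<^sup>2)"
        proof eventually_elim
          case (elim y)
          have "v y * \<psi> y * (cmod (U y))\<^sup>2 - lam * (\<psi> y * (cmod (U y))\<^sup>2) = (\<sigma> y * (v y - lam)) * (\<theta> n y * (cmod (U y))\<^sup>2)"
            by (simp add: \<psi>_def algebra_simps)
          \<comment> \<open>Inside \<open>E\<close> only nonnegativity is available and the left
            side is zero; outside, the multiplier has full modulus and |v - lam| is at least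
            \<kappa>.\<close>
          moreover have "\<kappa> * indicator (- E) y \<le> \<sigma> y * (v y - lam)"
          proof (cases "y \<in> E")
            case True
            then show ?thesis using \<sigma>(2)[of y] elim by simp
          next
            case False
            then show ?thesis using \<sigma>(3)[of y] far'[of y] far[of y] elim by (simp add: lam_def)
          qed
          ultimately show ?case
            using mult_right_mono[of "\<kappa> * indicator (- E) y" "\<sigma> y * (v y - lam)" "\<theta> n y * (cmod (U y))\<^sup>2"] \<theta>(2)[of n y]
            by (simp add: mult_ac)
        qed
      qed
      finally have "\<bar>k\<bar> * (\<kappa> * (LINT y|lebesgue_on \<Omega>. \<theta> n y * (indicator (- E) y * (cmod (U y))\<^sup>2))) \<le> \<bar>k\<bar> * \<bar>J\<bar>"
        by (intro mult_left_mono) auto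
      also note kJ
      also have "X * Y + \<nu> * (real (card Z) / \<delta> + 1 / real (Suc n)) * (W * Y) \<le> X * Y + \<nu> * (real N / \<delta> + 1 / real (Suc n)) * (W * Y)"
        using Z(2) \<delta> \<nu> nn by (intro add_mono mult_right_mono mult_left_mono divide_right_mono order_refl) auto
      finally show ?thesis .
    qed
    moreover have "(\<lambda>n. \<bar>k\<bar> * (\<kappa> * (LINT y|lebesgue_on \<Omega>. \<theta> n y * (indicator (- E) y * (cmod (U y))\<^sup>2))))
        \<longlonglongrightarrow> \<bar>k\<bar> * (\<kappa> * (LINT y|lebesgue_on \<Omega>. indicator (- E) y * (cmod (U y))\<^sup>2))"
      by (intro tendsto_mult tendsto_const plateau_integral_tendsto[OF ig(1) \<theta>(1,3)])
    moreover have "(\<lambda>n. X * Y + \<nu> * (real N / \<delta> + 1 / real (Suc n)) * (W * Y)) \<longlonglongrightarrow> X * Y + \<nu> * (real N / \<delta> + 0) * (W * Y)"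
      by (intro tendsto_intros lim1)
    ultimately have "\<bar>k\<bar> * (\<kappa> * (LINT y|lebesgue_on \<Omega>. indicator (- E) y * (cmod (U y))\<^sup>2)) \<le> X * Y + \<nu> * (real N / \<delta> + 0) * (W * Y)"
      by (intro LIMSEQ_le) auto
    then show ?thesis by (simp add: mult.assoc)
  qed
  \<comment> \<open>\<open>E\<close> has measure at most 2 N \<delta>, and |U|^2 is at most 2 W Y by
    the supremum bound; the product of the two is the constant 4.\<close>
  have inside: "(LINT y|lebesgue_on \<Omega>. indicator E y * (cmod (U y))\<^sup>2) \<le> 4 * real N * \<delta> * (W * Y)"
  proof -
    have len: "integrable (lebesgue_on \<Omega>) (\<lambda>y. indicator {z - \<delta><..<z + \<delta>} y :: real)"
      "(LINT y|lebesgue_on \<Omega>. indicator {z - \<delta><..<z + \<delta>} y :: real) \<le> 2 * \<delta>" for z :: real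
    proof -
      have I: "{z - \<delta><..<z + \<delta>} \<inter> \<Omega> \<in> lmeasurable" "{z - \<delta><..<z + \<delta>} \<in> lmeasurable"
        using \<Omega>s by (auto intro!: fmeasurable_Int_fmeasurable)
      show "integrable (lebesgue_on \<Omega>) (\<lambda>y. indicator {z - \<delta><..<z + \<delta>} y :: real)"
        using I(1) \<Omega>s
        by (auto simp: integrable_restrict_space indicator_inter_arith[symmetric] Int_commute fmeasurable_def)
      have "(LINT y|lebesgue_on \<Omega>. indicator {z - \<delta><..<z + \<delta>} y :: real) = measure lebesgue (\<Omega> \<inter> {z - \<delta><..<z + \<delta>})"
        using \<Omega>s by (simp add: measure_restrict_space Int_commute)
      also have "\<dots> \<le> measure lebesgue {z - \<delta><..<z + \<delta>}"
        by (rule measure_mono_fmeasurable) (use I \<Omega>s in auto)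
      also have "\<dots> = 2 * \<delta>" using \<delta> by simp
      finally show "(LINT y|lebesgue_on \<Omega>. indicator {z - \<delta><..<z + \<delta>} y :: real) \<le> 2 * \<delta>" .
    qed
    have "(LINT y|lebesgue_on \<Omega>. indicator E y * (cmod (U y))\<^sup>2) \<le> (LINT y|lebesgue_on \<Omega>. (\<Sum>z\<in>Z. indicator {z - \<delta><..<z + \<delta>} y) * (2 * (Y * W)))"
    proof (rule Bochner_Integration.integral_mono)
      fix y assume "y \<in> space (lebesgue_on \<Omega>)"
      then have "y \<in> \<Omega>" by simp
      from ac_on_sup_bound[OF \<Omega>(1,2) unb ac L2(1,2) this]
      have "(cmod (U y))\<^sup>2 \<le> 2 * (Y * W)" unfolding YU W_def .
      moreover have "indicator E y \<le> (\<Sum>z\<in>Z. indicator {z - \<delta><..<z + \<delta>} y :: real)"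
      proof (cases "y \<in> E")
        case True
        then obtain z where z: "z \<in> Z" "y \<in> {z - \<delta><..<z + \<delta>}" by (auto simp: E_def)
        then have "(1::real) \<le> (\<Sum>z\<in>Z. indicator {z - \<delta><..<z + \<delta>} y)"
          using member_le_sum[OF z(1), of "\<lambda>z. indicator {z - \<delta><..<z + \<delta>} y :: real"] Z(1) by auto
        then show ?thesis using True by simp
      qed (simp add: sum_nonneg)
      ultimately show "indicator E y * (cmod (U y))\<^sup>2 \<le> (\<Sum>z\<in>Z. indicator {z - \<delta><..<z + \<delta>} y) * (2 * (Y * W))"
        by (intro mult_mono sum_nonneg) auto
    qed (use ig len in auto)
    also have "\<dots> = (\<Sum>z\<in>Z. (LINT y|lebesgue_on \<Omega>. indicator {z - \<delta><..<z + \<delta>} y :: real)) * (2 * (Y * W))"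
      using len by (simp add: Bochner_Integration.integral_sum)
    also have "\<dots> \<le> (\<Sum>z\<in>Z. 2 * \<delta>) * (2 * (Y * W))"
      using len(2) nn by (intro mult_right_mono sum_mono) auto
    also have "\<dots> \<le> (real N * (2 * \<delta>)) * (2 * (Y * W))"
      using Z(2) \<delta> nn by (intro mult_right_mono) auto
    finally show ?thesis by (simp add: mult_ac)
  qed
  have "Y\<^sup>2 = (LINT y|lebesgue_on \<Omega>. indicator E y * (cmod (U y))\<^sup>2 + indicator (- E) y * (cmod (U y))\<^sup>2)"
    unfolding YU[symmetric] L2_norm_squared by (intro Bochner_Integration.integral_cong) (auto simp: indicator_def)
  also have "\<dots> = (LINT y|lebesgue_on \<Omega>. indicator E y * (cmod (U y))\<^sup>2) + (LINT y|lebesgue_on \<Omega>. indicator (- E) y * (cmod (U y))\<^sup>2)"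
    by (rule Bochner_Integration.integral_add[OF ig(2,1)])
  also have "\<dots> \<le> 4 * real N * \<delta> * (W * Y) + (X * Y + \<nu> * (real N / \<delta>) * (W * Y)) / (\<bar>k\<bar> * \<kappa>)"
  proof (rule add_mono[OF inside])
    have "\<bar>k\<bar> * \<kappa> > 0" using k \<kappa> by simp
    then show "(LINT y|lebesgue_on \<Omega>. indicator (- E) y * (cmod (U y))\<^sup>2) \<le> (X * Y + \<nu> * (real N / \<delta>) * (W * Y)) / (\<bar>k\<bar> * \<kappa>)"
      using outside by (simp add: le_divide_eq mult.commute)
  qed
  finally show ?thesis using dissipation nn by (intro exI[of _ W]) auto
qed

text \<open>Suppose X < s^2 \<rho> Y. The dissipation bound then gives W \<le> s q Y with q =
  sqrt(\<rho> / \<nu>), and the first and third scale conditions say \<delta> q \<le> 1 and \<nu> q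
  \<le> k \<delta>^(m+1). Together with \<rho> \<le> k \<delta>^m and s^2 \<le> s, they bound the
  three terms on the right of the estimate by s Y^2 times 4 N, 1 / c and N / c. Smallness of
  \<open>s\<close> makes their sum less than Y^2, a contradiction.\<close>

lemma resolvent_algebra:
  fixes X Y W \<nu> k \<delta> c \<rho> s N :: real and m :: nat
  assumes nn: "X \<ge> 0" "Y \<ge> 0" "W \<ge> 0" "N \<ge> 0" and pos: "\<nu> > 0" "k > 0" "\<delta> > 0" "c > 0" "\<rho> > 0" "s > 0" "s \<le> 1"
    and diss: "\<nu> * W\<^sup>2 \<le> X * Y"
    and est: "Y\<^sup>2 \<le> 4 * N * \<delta> * (W * Y) + (X * Y + \<nu> * (N / \<delta>) * (W * Y)) / (k * (c * \<delta> ^ m))"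
    and \<rho>: "\<delta>\<^sup>2 * \<rho> \<le> \<nu>" "\<rho> \<le> k * \<delta> ^ m" "\<nu> * \<rho> \<le> (k * \<delta> ^ (m + 1))\<^sup>2"
    and s: "s * (4 * N + 1 / c + N / c) < 1"
  shows "s\<^sup>2 * \<rho> * Y \<le> X"
proof (rule ccontr)
  assume "\<not> s\<^sup>2 * \<rho> * Y \<le> X"
  then have X: "X < s\<^sup>2 * \<rho> * Y" by simp
  then have Y: "Y > 0" using nn pos by (cases "Y = 0") auto
  define q where "q = sqrt (\<rho> / \<nu>)"
  have q: "q > 0" "q\<^sup>2 * \<nu> = \<rho>" using pos by (auto simp: q_def)
  have "W\<^sup>2 * \<nu> \<le> (s * Y * q)\<^sup>2 * \<nu>"
  proof -
    have "X * Y \<le> s\<^sup>2 * \<rho> * Y * Y" using X Y by (intro mult_right_mono) auto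
    also have "\<dots> = (s * Y * q)\<^sup>2 * \<nu>" unfolding q(2)[symmetric] by (simp add: power2_eq_square mult_ac)
    finally show ?thesis using diss by (simp add: mult.commute)
  qed
  then have "W\<^sup>2 \<le> (s * Y * q)\<^sup>2" using pos by simp
  then have W: "W \<le> s * Y * q" by (rule power2_le_imp_le) (use pos Y q in auto)
  have "(\<delta> * q)\<^sup>2 \<le> 1\<^sup>2" using \<rho>(1) pos by (simp add: q_def power_mult_distrib)
  then have dq: "\<delta> * q \<le> 1" by (rule power2_le_imp_le) simp
  have "(\<nu> * q)\<^sup>2 = \<nu> * \<rho>" unfolding q(2)[symmetric] by (simp add: power2_eq_square mult_ac)
  then have "(\<nu> * q)\<^sup>2 \<le> (k * \<delta> ^ (m + 1))\<^sup>2" using \<rho>(3) by simp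
  then have nq: "\<nu> * q \<le> k * \<delta> ^ (m + 1)" by (rule power2_le_imp_le) (use pos in auto)
  have 1: "4 * N * \<delta> * (W * Y) \<le> 4 * N * s * Y\<^sup>2"
  proof -
    have "4 * N * \<delta> * (W * Y) \<le> 4 * N * \<delta> * ((s * Y * q) * Y)" using W Y nn pos by (intro mult_left_mono mult_right_mono) auto
    also have "\<dots> = (4 * N * s * Y\<^sup>2) * (\<delta> * q)" by (simp add: power2_eq_square mult_ac)
    also have "\<dots> \<le> (4 * N * s * Y\<^sup>2) * 1" using dq nn pos by (intro mult_left_mono) auto
    finally show ?thesis by simp
  qed
  have 2: "X * Y / (k * (c * \<delta> ^ m)) \<le> s * Y\<^sup>2 / c"
  proof -
    have "X * Y \<le> s\<^sup>2 * \<rho> * Y * Y" using X Y by (intro mult_right_mono) auto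
    also have "\<dots> \<le> s\<^sup>2 * (k * \<delta> ^ m) * Y * Y" using \<rho>(2) Y by (intro mult_right_mono mult_left_mono) auto
    also have "\<dots> \<le> s * (k * \<delta> ^ m) * Y * Y"
      using pos Y by (intro mult_right_mono) (auto simp: power2_eq_square)
    finally have "X * Y / (k * (c * \<delta> ^ m)) \<le> s * (k * \<delta> ^ m) * Y * Y / (k * (c * \<delta> ^ m))"
      using pos by (intro divide_right_mono) auto
    also have "\<dots> = s * Y\<^sup>2 / c" using pos by (simp add: power2_eq_square)
    finally show ?thesis .
  qed
  have 3: "\<nu> * (N / \<delta>) * (W * Y) / (k * (c * \<delta> ^ m)) \<le> N * s * Y\<^sup>2 / c"
  proof -
    have "\<nu> * (N / \<delta>) * (W * Y) \<le> \<nu> * (N / \<delta>) * ((s * Y * q) * Y)" using W Y nn pos by (intro mult_left_mono mult_right_mono) auto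
    also have "\<dots> = (N / \<delta>) * s * Y\<^sup>2 * (\<nu> * q)" by (simp add: power2_eq_square mult_ac)
    also have "\<dots> \<le> (N / \<delta>) * s * Y\<^sup>2 * (k * \<delta> ^ (m + 1))" using nq nn pos by (intro mult_left_mono) auto
    finally have "\<nu> * (N / \<delta>) * (W * Y) / (k * (c * \<delta> ^ m)) \<le> (N / \<delta>) * s * Y\<^sup>2 * (k * \<delta> ^ (m + 1)) / (k * (c * \<delta> ^ m))"
      using pos by (intro divide_right_mono) auto
    also have "\<dots> = N * s * Y\<^sup>2 / c" using pos by (simp add: field_simps)
    finally show ?thesis .
  qed
  have "Y\<^sup>2 \<le> 4 * N * s * Y\<^sup>2 + (s * Y\<^sup>2 / c + N * s * Y\<^sup>2 / c)"
    using est 1 2 3 by (simp add: add_divide_distrib)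
  also have "\<dots> = s * (4 * N + 1 / c + N / c) * Y\<^sup>2" using pos by (simp add: field_simps)
  also have "\<dots> < 1 * Y\<^sup>2" using s Y by (intro mult_strict_right_mono) auto
  finally show False by simp
qed

lemma decay_rate_scale:
  assumes \<nu>: "\<nu> > 0" and k: "k \<noteq> 0"
  obtains \<delta> where "0 < \<delta>" "\<delta> \<le> 1" "\<delta>\<^sup>2 * decay_rate m \<nu> k \<le> \<nu>" "decay_rate m \<nu> k \<le> \<bar>k\<bar> * \<delta> ^ m"
    "\<nu> * decay_rate m \<nu> k \<le> (\<bar>k\<bar> * \<delta> ^ (m + 1))\<^sup>2" "decay_rate m \<nu> k > 0"
proof (cases "\<nu> \<le> \<bar>k\<bar>")
  case True
  define \<delta> where "\<delta> = (\<nu> / \<bar>k\<bar>) powr (1 / real (m + 2))"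
  have \<delta>: "0 < \<delta>" "\<delta> \<le> 1" using \<nu> k True by (auto simp: \<delta>_def intro!: powr_le1)
  have \<delta>n: "\<delta> ^ n = (\<nu> / \<bar>k\<bar>) powr (real n / real (m + 2))" for n
    using \<nu> k by (simp add: \<delta>_def powr_realpow[symmetric] powr_powr del: powr_realpow')
  have d: "\<delta> ^ (m + 2) = \<nu> / \<bar>k\<bar>" unfolding \<delta>n using \<nu> k by simp
  have rate: "decay_rate m \<nu> k = \<bar>k\<bar> * \<delta> ^ m"
  proof -
    \<comment> \<open>This rewrites the rate as |k| (\<nu> / |k|)^(m / (m + 2)), that is |k|
      \<delta>^m.\<close>
    have e: "2 / real (m + 2) = 1 - real m / real (m + 2)" by (simp add: field_simps)
    have "\<bar>k\<bar> powr (2 / real (m + 2)) = \<bar>k\<bar> / \<bar>k\<bar> powr (real m / real (m + 2))"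
      unfolding e powr_diff using k by simp
    then show ?thesis using True \<nu> k unfolding \<delta>n decay_rate_def by (simp add: powr_divide)
  qed
  have kd: "\<bar>k\<bar> * \<delta> ^ (m + 2) = \<nu>" using d k by simp
  have "\<delta>\<^sup>2 * decay_rate m \<nu> k = \<bar>k\<bar> * \<delta> ^ (m + 2)" unfolding rate by (simp add: power_add power2_eq_square mult_ac)
  then have 1: "\<delta>\<^sup>2 * decay_rate m \<nu> k \<le> \<nu>" using kd by simp
  have "\<nu> * decay_rate m \<nu> k = (\<bar>k\<bar> * \<delta> ^ (m + 2)) * (\<bar>k\<bar> * \<delta> ^ m)" unfolding rate kd ..
  also have "\<dots> = (\<bar>k\<bar> * \<delta> ^ (m + 1))\<^sup>2" by (simp add: power2_eq_square power_add mult_ac)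
  finally have 2: "\<nu> * decay_rate m \<nu> k \<le> (\<bar>k\<bar> * \<delta> ^ (m + 1))\<^sup>2" by simp
  have "decay_rate m \<nu> k > 0" unfolding rate using k \<delta> by simp
  then show ?thesis using that[OF \<delta> 1 _ 2] rate by simp
next
  case False
  then have rate: "decay_rate m \<nu> k = k\<^sup>2 / \<nu>" by (simp add: decay_rate_def)
  have k2: "k\<^sup>2 = \<bar>k\<bar> * \<bar>k\<bar>" by (simp add: power2_eq_square)
  have a: "\<bar>k\<bar> * \<bar>k\<bar> \<le> \<bar>k\<bar> * \<nu>" using False by (intro mult_left_mono) auto
  also have "\<bar>k\<bar> * \<nu> \<le> \<nu> * \<nu>" using False \<nu> by (intro mult_right_mono) auto
  finally have b: "\<bar>k\<bar> * \<bar>k\<bar> \<le> \<nu> * \<nu>" .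
  have c: "0 < k * k / \<nu>" using \<nu> k by (intro divide_pos_pos) (auto simp: zero_less_mult_iff)
  show ?thesis
    by (rule that[of 1]) (use \<nu> a b c in \<open>auto simp: rate k2 divide_le_eq\<close>)
qed

section \<open>Density of the operator domain\<close>

lemma neumann_op_L2: "neumann_op \<Omega> v \<nu> k u h \<Longrightarrow> u \<in> L2 \<Omega> \<and> h \<in> L2 \<Omega>"
  by (auto simp: neumann_op_def H1_deriv_def)

text \<open>Integrability is what permits splitting the potential integral of a linear combination.
  The indicator of a ball that carries the support of \<phi> replaces the possibly unbounded weight
  \<open>v\<close> by a bounded one.\<close>

lemma potential_term_integrable:
  assumes \<Omega>: "open \<Omega>" and v: "continuous_on (closure \<Omega>) v" and u: "u \<in> L2 \<Omega>"
    and \<phi>: "\<phi> \<in> L2 \<Omega>" "bounded_support \<Omega> \<phi>"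
  shows "integrable (lebesgue_on \<Omega>) (\<lambda>y. complex_of_real (v y) * u y * cnj (\<phi> y))"
proof -
  have \<Omega>s: "\<Omega> \<in> sets lebesgue" using \<Omega> by simp
  obtain B where B: "bounded B" "AE x in lebesgue_on \<Omega>. x \<notin> B \<longrightarrow> \<phi> x = 0" using \<phi>(2) by (auto simp: bounded_support_def)
  obtain R where "\<And>x. x \<in> B \<Longrightarrow> norm x \<le> R" using B(1) unfolding bounded_iff by blast
  then have R: "B \<subseteq> cball 0 R" by (auto simp: dist_norm)
  have [measurable]: "v \<in> borel_measurable (lebesgue_on \<Omega>)"
    by (rule continuous_imp_measurable_on_sets_lebesgue[OF continuous_on_subset[OF v closure_subset] \<Omega>s])
  have [measurable]: "(indicator (cball 0 R) :: real \<Rightarrow> real) \<in> borel_measurable (lebesgue_on \<Omega>)"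
    by (intro measurable_restrict_space1 borel_measurable_indicator) auto
  have "compact (closure \<Omega> \<inter> cball 0 R)" by (intro closed_Int_compact) auto
  then have "bounded (v ` (closure \<Omega> \<inter> cball 0 R))"
    by (intro compact_imp_bounded compact_continuous_image continuous_on_subset[OF v]) auto
  then obtain K where K: "\<And>x. x \<in> closure \<Omega> \<inter> cball 0 R \<Longrightarrow> \<bar>v x\<bar> \<le> K"
    unfolding bounded_iff by (metis image_eqI real_norm_def)
  have vb: "\<bar>v x * indicator (cball 0 R) x\<bar> \<le> \<bar>K\<bar>" if "x \<in> \<Omega>" for x
  proof (cases "x \<in> cball 0 R")
    case True
    then have "\<bar>v x\<bar> \<le> K" using K closure_subset that by blast
    then show ?thesis using True by simp
  qed simp
  have "(\<lambda>x. v x * indicator (cball 0 R) x) \<in> borel_measurable (lebesgue_on \<Omega>)" by measurable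
  from L2_weighted_pairing(1)[OF u \<phi>(1) this vb]
  have *: "integrable (lebesgue_on \<Omega>) (\<lambda>x. complex_of_real (v x * indicator (cball 0 R) x) * (u x * cnj (\<phi> x)))" by simp
  have [measurable]: "u \<in> borel_measurable (lebesgue_on \<Omega>)" "(\<lambda>x. cnj (\<phi> x)) \<in> borel_measurable (lebesgue_on \<Omega>)"
    using L2D(1)[OF u] L2D(1)[OF L2_cnj[OF \<phi>(1)]] by auto
  show ?thesis
  proof (rule integrable_cong_AE[THEN iffD1, OF _ _ _ *])
    show "AE x in lebesgue_on \<Omega>. complex_of_real (v x * indicator (cball 0 R) x) * (u x * cnj (\<phi> x)) = complex_of_real (v x) * u x * cnj (\<phi> x)"
      using B(2) by eventually_elim (use R in \<open>auto simp: indicator_def\<close>)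
  qed measurable
qed

text \<open>Taking combinations of absolutely continuous representatives reduces linearity to the
  criterion for H^1, rather than to splitting the integrals against each test function.\<close>

lemma H1_deriv_linear:
  assumes \<Omega>: "open \<Omega>" "convex \<Omega>" "\<Omega> \<noteq> {}" and H: "H1_deriv \<Omega> f f'" "H1_deriv \<Omega> g g'"
  shows "H1_deriv \<Omega> (\<lambda>x. a * f x + b * g x) (\<lambda>x. a * f' x + b * g' x)"
proof -
  obtain F where F: "ac_on \<Omega> F f'" "AE x in lebesgue_on \<Omega>. f x = F x" by (rule H1_ac_representative[OF \<Omega> H(1)])
  obtain G where G: "ac_on \<Omega> G g'" "AE x in lebesgue_on \<Omega>. g x = G x" by (rule H1_ac_representative[OF \<Omega> H(2)])
  have c: "ac_on \<Omega> (\<lambda>x. a * w x) (\<lambda>x. a * w' x)" if "ac_on \<Omega> w w'" for a w w'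
    using ac_on_mult[OF \<Omega>(2) ac_on_const[of \<Omega> a] that] by simp
  show ?thesis
  proof (rule H1_deriv_if_ac_on[OF \<Omega> _ _ ac_on_add[OF c[OF F(1), of a] c[OF G(1), of b]]])
    show "(\<lambda>x. a * f x + b * g x) \<in> L2 \<Omega>" "(\<lambda>x. a * f' x + b * g' x) \<in> L2 \<Omega>"
      using H by (auto simp: H1_deriv_def intro!: L2_add L2_cmult)
    show "AE x in lebesgue_on \<Omega>. a * f x + b * g x = a * F x + b * G x"
      using F(2) G(2) by eventually_elim simp
  qed
qed

lemma neumann_op_linear:
  assumes \<Omega>: "open \<Omega>" "convex \<Omega>" "\<Omega> \<noteq> {}" and v: "continuous_on (closure \<Omega>) v"
    and op: "neumann_op \<Omega> v \<nu> k f p" "neumann_op \<Omega> v \<nu> k g q"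
  shows "neumann_op \<Omega> v \<nu> k (\<lambda>x. a * f x + b * g x) (\<lambda>x. a * p x + b * q x)"
proof -
  obtain f' where f: "p \<in> L2 \<Omega>" "H1_deriv \<Omega> f f'" and wf: "\<And>\<phi> \<phi>'. H1_deriv \<Omega> \<phi> \<phi>' \<Longrightarrow> bounded_support \<Omega> \<phi> \<Longrightarrow>
          complex_of_real \<nu> * (LINT y|lebesgue_on \<Omega>. f' y * cnj (\<phi>' y))
          + \<i> * complex_of_real k * (LINT y|lebesgue_on \<Omega>. complex_of_real (v y) * f y * cnj (\<phi> y))
          = (LINT y|lebesgue_on \<Omega>. p y * cnj (\<phi> y))" using op(1) unfolding neumann_op_def by blast
  obtain g' where g: "q \<in> L2 \<Omega>" "H1_deriv \<Omega> g g'" and wg: "\<And>\<phi> \<phi>'. H1_deriv \<Omega> \<phi> \<phi>' \<Longrightarrow> bounded_support \<Omega> \<phi> \<Longrightarrow>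
          complex_of_real \<nu> * (LINT y|lebesgue_on \<Omega>. g' y * cnj (\<phi>' y))
          + \<i> * complex_of_real k * (LINT y|lebesgue_on \<Omega>. complex_of_real (v y) * g y * cnj (\<phi> y))
          = (LINT y|lebesgue_on \<Omega>. q y * cnj (\<phi> y))" using op(2) unfolding neumann_op_def by blast
  have L: "f \<in> L2 \<Omega>" "f' \<in> L2 \<Omega>" "g \<in> L2 \<Omega>" "g' \<in> L2 \<Omega>" using f g by (auto simp: H1_deriv_def)
  have pair: "integrable (lebesgue_on \<Omega>) (\<lambda>y. w y * cnj (\<phi> y))" if "w \<in> L2 \<Omega>" "\<phi> \<in> L2 \<Omega>" for w \<phi>
    using L2_weighted_pairing(1)[OF that, of "\<lambda>_. 1" 1] by simp
  show ?thesis
    unfolding neumann_op_def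
  proof (intro conjI exI allI impI)
    show "(\<lambda>x. a * p x + b * q x) \<in> L2 \<Omega>" by (intro L2_add L2_cmult f g)
    show "H1_deriv \<Omega> (\<lambda>x. a * f x + b * g x) (\<lambda>x. a * f' x + b * g' x)" by (rule H1_deriv_linear[OF \<Omega> f(2) g(2)])
    fix \<phi> \<phi>' assume \<phi>: "H1_deriv \<Omega> \<phi> \<phi>'" "bounded_support \<Omega> \<phi>"
    have \<phi>L: "\<phi> \<in> L2 \<Omega>" "\<phi>' \<in> L2 \<Omega>" using \<phi> by (auto simp: H1_deriv_def)
    have lin: "(LINT y|lebesgue_on \<Omega>. a * w1 y + b * w2 y) = a * (LINT y|lebesgue_on \<Omega>. w1 y) + b * (LINT y|lebesgue_on \<Omega>. w2 y)"
      if "integrable (lebesgue_on \<Omega>) w1" "integrable (lebesgue_on \<Omega>) w2" for w1 w2 :: "real \<Rightarrow> complex"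
      using that by simp
    have "(LINT y|lebesgue_on \<Omega>. (a * f' y + b * g' y) * cnj (\<phi>' y)) = a * (LINT y|lebesgue_on \<Omega>. f' y * cnj (\<phi>' y)) + b * (LINT y|lebesgue_on \<Omega>. g' y * cnj (\<phi>' y))"
      by (subst lin[symmetric, OF pair[OF L(2) \<phi>L(2)] pair[OF L(4) \<phi>L(2)]]) (simp add: algebra_simps)
    moreover have "(LINT y|lebesgue_on \<Omega>. complex_of_real (v y) * (a * f y + b * g y) * cnj (\<phi> y))
      = a * (LINT y|lebesgue_on \<Omega>. complex_of_real (v y) * f y * cnj (\<phi> y)) + b * (LINT y|lebesgue_on \<Omega>. complex_of_real (v y) * g y * cnj (\<phi> y))"
      by (subst lin[symmetric, OF potential_term_integrable[OF \<Omega>(1) v L(1) \<phi>L(1) \<phi>(2)] potential_term_integrable[OF \<Omega>(1) v L(3) \<phi>L(1) \<phi>(2)]])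
        (simp add: algebra_simps)
    moreover have "(LINT y|lebesgue_on \<Omega>. (a * p y + b * q y) * cnj (\<phi> y)) = a * (LINT y|lebesgue_on \<Omega>. p y * cnj (\<phi> y)) + b * (LINT y|lebesgue_on \<Omega>. q y * cnj (\<phi> y))"
      by (subst lin[symmetric, OF pair[OF f(1) \<phi>L(1)] pair[OF g(1) \<phi>L(1)]]) (simp add: algebra_simps)
    ultimately show "complex_of_real \<nu> * (LINT y|lebesgue_on \<Omega>. (a * f' y + b * g' y) * cnj (\<phi>' y))
          + \<i> * complex_of_real k * (LINT y|lebesgue_on \<Omega>. complex_of_real (v y) * (a * f y + b * g y) * cnj (\<phi> y))
          = (LINT y|lebesgue_on \<Omega>. (a * p y + b * q y) * cnj (\<phi> y))"
      using wf[OF \<phi>, THEN arg_cong[where f="\<lambda>x. a * x"]] wg[OF \<phi>, THEN arg_cong[where f="\<lambda>x. b * x"]]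
      by (simp add: algebra_simps)
  qed
qed

lemma neumann_op_zero: "neumann_op \<Omega> v \<nu> k (\<lambda>_. 0) (\<lambda>_. 0)"
  unfolding neumann_op_def by (auto simp: L2_zero H1_deriv_def intro!: exI[of _ "\<lambda>_. 0"])

lemma neumann_op_sum:
  assumes \<Omega>: "open \<Omega>" "convex \<Omega>" "\<Omega> \<noteq> {}" and v: "continuous_on (closure \<Omega>) v"
    and op: "\<And>n::nat. n < N \<Longrightarrow> neumann_op \<Omega> v \<nu> k (g n) (h n)"
  shows "neumann_op \<Omega> v \<nu> k (\<lambda>x. \<Sum>n<N. a n * g n x) (\<lambda>x. \<Sum>n<N. a n * h n x)"
  using op
proof (induction N)
  case (Suc N)
  have "neumann_op \<Omega> v \<nu> k (\<lambda>x. 1 * (\<Sum>n<N. a n * g n x) + a N * g N x) (\<lambda>x. 1 * (\<Sum>n<N. a n * h n x) + a N * h N x)"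
    by (rule neumann_op_linear[OF \<Omega> v]) (use Suc in auto)
  then show ?case by simp
qed (simp add: neumann_op_zero)

lemma L2_of_compact_support:
  fixes f :: "real \<Rightarrow> complex"
  assumes f: "continuous_on {a..b} f" "\<And>x. x \<notin> {a..b} \<Longrightarrow> f x = 0" and sub: "{a..b} \<subseteq> \<Omega>" and \<Omega>: "\<Omega> \<in> sets lebesgue"
  shows "f \<in> L2 \<Omega>"
proof -
  have "integrable (lebesgue_on {a..b}) f"
    by (intro absolutely_integrable_imp_integrable absolutely_integrable_continuous_real f) auto
  moreover have "integrable (lebesgue_on {a..b}) (\<lambda>x. (cmod (f x))\<^sup>2)"
    by (intro absolutely_integrable_imp_integrable absolutely_integrable_continuous_real continuous_intros f) auto
  moreover have "integrable (lebesgue_on \<Omega>) f \<longleftrightarrow> integrable (lebesgue_on {a..b}) f"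
    by (rule lebesgue_on_zero_outside(2)) (use sub \<Omega> f(2) in auto)
  moreover have "integrable (lebesgue_on \<Omega>) (\<lambda>x. (cmod (f x))\<^sup>2) \<longleftrightarrow> integrable (lebesgue_on {a..b}) (\<lambda>x. (cmod (f x))\<^sup>2)"
    by (rule lebesgue_on_zero_outside(2)) (use sub \<Omega> f(2) in auto)
  ultimately show ?thesis by (auto simp: L2_def)
qed

text \<open>A smooth function supported in a compact subinterval of the open set has no boundary
  contribution, and \<open>h\<close> is the classical expression -\<nu> \<phi>'' + i k v \<phi>. It
  lies in L2 because \<phi> confines \<open>v\<close> to a compact interval.\<close>

lemma neumann_op_test_function:
  fixes \<phi> v :: "real \<Rightarrow> real"
  assumes \<Omega>: "open \<Omega>" "convex \<Omega>" "\<Omega> \<noteq> {}" and v: "continuous_on (closure \<Omega>) v"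
    and \<phi>: "smooth \<phi>" "\<And>x. x \<notin> {a..b} \<Longrightarrow> \<phi> x = 0" and sub: "{a..b} \<subseteq> \<Omega>"
  shows "\<exists>h. neumann_op \<Omega> v \<nu> k (\<lambda>x. complex_of_real (\<phi> x)) h"
proof -
  have \<Omega>s: "\<Omega> \<in> sets lebesgue" using \<Omega>(1) by simp
  define d1 d2 where "d1 = deriv \<phi>" and "d2 = deriv d1"
  have sm: "smooth d1" "smooth d2" unfolding d1_def d2_def by (intro smooth_deriv \<phi>(1))+
  have z1: "d1 x = 0" if "x \<notin> {a..b}" for x unfolding d1_def by (rule deriv_zero_outside[OF \<phi>(2) that])
  have z2: "d2 x = 0" if "x \<notin> {a..b}" for x unfolding d2_def by (rule deriv_zero_outside[OF z1 that])
  define h where "h x = complex_of_real (- \<nu> * d2 x) + \<i> * complex_of_real k * complex_of_real (v x * \<phi> x)" for x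
  have cv: "continuous_on {a..b} v" using continuous_on_subset[OF v] sub closure_subset by blast
  have L\<phi>: "(\<lambda>x. complex_of_real (\<phi> x)) \<in> L2 \<Omega>"
    by (rule L2_of_compact_support[OF _ _ sub \<Omega>s]) (use \<phi> in \<open>auto intro!: continuous_on_of_real smooth_continuous\<close>)
  have Ld1: "(\<lambda>x. complex_of_real (d1 x)) \<in> L2 \<Omega>"
    by (rule L2_of_compact_support[OF _ _ sub \<Omega>s]) (use sm z1 in \<open>auto intro!: continuous_on_of_real smooth_continuous\<close>)
  have Ld2: "(\<lambda>x. complex_of_real (d2 x)) \<in> L2 \<Omega>"
    by (rule L2_of_compact_support[OF _ _ sub \<Omega>s]) (use sm z2 in \<open>auto intro!: continuous_on_of_real smooth_continuous\<close>)
  have Lv: "(\<lambda>x. complex_of_real (v x * \<phi> x)) \<in> L2 \<Omega>"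
    by (rule L2_of_compact_support[OF _ _ sub \<Omega>s])
      (use \<phi> in \<open>auto intro!: continuous_on_of_real continuous_on_mult cv smooth_continuous\<close>)
  have Lh: "h \<in> L2 \<Omega>"
    using L2_add[OF L2_cmult[OF Ld2, of "- complex_of_real \<nu>"] L2_cmult[OF Lv, of "\<i> * complex_of_real k"]] by (simp add: h_def[abs_def])
  have H: "H1_deriv \<Omega> (\<lambda>x. complex_of_real (\<phi> x)) (\<lambda>x. complex_of_real (d1 x))"
    by (rule H1_deriv_if_ac_on[OF \<Omega> L\<phi> Ld1 ac_on_of_real[OF _ smooth_continuous[OF sm(1)] \<Omega>(2)]])
      (use smooth_has_derivative[OF \<phi>(1)] in \<open>auto simp: d1_def\<close>)
  have "neumann_op \<Omega> v \<nu> k (\<lambda>x. complex_of_real (\<phi> x)) h"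
    unfolding neumann_op_def
  proof (intro conjI exI allI impI)
    show "h \<in> L2 \<Omega>" by (rule Lh)
    show "H1_deriv \<Omega> (\<lambda>x. complex_of_real (\<phi> x)) (\<lambda>x. complex_of_real (d1 x))" by (rule H)
    fix w w' assume w: "H1_deriv \<Omega> w w'" "bounded_support \<Omega> w"
    have wL: "w \<in> L2 \<Omega>" "w' \<in> L2 \<Omega>" using w by (auto simp: H1_deriv_def)
    have pair: "integrable (lebesgue_on \<Omega>) (\<lambda>y. f y * cnj (w y))" if "f \<in> L2 \<Omega>" for f
      using L2_weighted_pairing(1)[OF that wL(1), of "\<lambda>_. 1" 1] by simp
    \<comment> \<open>The required integration by parts is the definition of the weak derivative of
      \<open>w\<close>, tested against the first derivative of \<phi>.\<close>
    have "(LINT x|lebesgue_on \<Omega>. deriv d1 x *\<^sub>R w x) = - (LINT x|lebesgue_on \<Omega>. d1 x *\<^sub>R w' x)"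
      using w(1) test_functionI[OF sm(1) z1 sub] unfolding H1_deriv_def by blast
    from arg_cong[OF this, of cnj]
    have "(LINT x|lebesgue_on \<Omega>. cnj (d2 x *\<^sub>R w x)) = - (LINT x|lebesgue_on \<Omega>. cnj (d1 x *\<^sub>R w' x))"
      unfolding d2_def by (simp only: Bochner_Integration.integral_cnj complex_cnj_minus)
    then have 1: "(LINT y|lebesgue_on \<Omega>. complex_of_real (d1 y) * cnj (w' y)) = - (LINT y|lebesgue_on \<Omega>. complex_of_real (d2 y) * cnj (w y))"
      by (simp add: scaleR_conv_of_real)
    have "(LINT y|lebesgue_on \<Omega>. h y * cnj (w y)) = (LINT y|lebesgue_on \<Omega>. (- complex_of_real \<nu>) * (complex_of_real (d2 y) * cnj (w y)) + (\<i> * complex_of_real k) * (complex_of_real (v y * \<phi> y) * cnj (w y)))"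
      by (intro Bochner_Integration.integral_cong) (auto simp: h_def algebra_simps)
    also have "\<dots> = (- complex_of_real \<nu>) * (LINT y|lebesgue_on \<Omega>. complex_of_real (d2 y) * cnj (w y)) + (\<i> * complex_of_real k) * (LINT y|lebesgue_on \<Omega>. complex_of_real (v y * \<phi> y) * cnj (w y))"
      by (simp only: Bochner_Integration.integral_add[OF integrable_mult_right[OF pair[OF Ld2]] integrable_mult_right[OF pair[OF Lv]]] integral_mult_right_zero)
    finally show "complex_of_real \<nu> * (LINT y|lebesgue_on \<Omega>. complex_of_real (d1 y) * cnj (w' y))
          + \<i> * complex_of_real k * (LINT y|lebesgue_on \<Omega>. complex_of_real (v y) * complex_of_real (\<phi> y) * cnj (w y))
          = (LINT y|lebesgue_on \<Omega>. h y * cnj (w y))" unfolding 1 by simp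
  qed
  then show ?thesis by blast
qed

lemma L2_norm_dominated_limit:
  assumes f: "f \<in> L2 \<Omega>" and fn: "\<And>n::nat. F n \<in> L2 \<Omega>" and B: "integrable (lebesgue_on \<Omega>) B"
    and dom: "\<And>n. AE x in lebesgue_on \<Omega>. (cmod (f x - F n x))\<^sup>2 \<le> B x"
    and lim: "AE x in lebesgue_on \<Omega>. (\<lambda>n. F n x) \<longlonglongrightarrow> f x"
  shows "(\<lambda>n. L2_norm \<Omega> (\<lambda>x. f x - F n x)) \<longlonglongrightarrow> 0"
proof -
  have [measurable]: "f \<in> borel_measurable (lebesgue_on \<Omega>)" "F n \<in> borel_measurable (lebesgue_on \<Omega>)" for n
    using L2D(1)[OF f] L2D(1)[OF fn] by auto
  have "(\<lambda>n. LINT x|lebesgue_on \<Omega>. (cmod (f x - F n x))\<^sup>2) \<longlonglongrightarrow> (LINT x|lebesgue_on \<Omega>. 0)"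
  proof (rule integral_dominated_convergence[OF _ _ B])
    show "AE x in lebesgue_on \<Omega>. (\<lambda>n. (cmod (f x - F n x))\<^sup>2) \<longlonglongrightarrow> 0"
      using lim
    proof eventually_elim
      case (elim x)
      have "(\<lambda>n. (cmod (f x - F n x))\<^sup>2) \<longlonglongrightarrow> (cmod (f x - f x))\<^sup>2" by (intro tendsto_intros elim)
      then show ?case by simp
    qed
    show "AE x in lebesgue_on \<Omega>. norm ((cmod (f x - F n x))\<^sup>2) \<le> B x" for n using dom[of n] by eventually_elim simp
  qed measurable
  then have "(\<lambda>n. sqrt (LINT x|lebesgue_on \<Omega>. (cmod (f x - F n x))\<^sup>2)) \<longlonglongrightarrow> sqrt 0" by (intro tendsto_intros) simp
  then show ?thesis by (simp add: L2_norm_def)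
qed

text \<open>\<open>Cl\<close> is the L2 closure of the operator domain, stable under limits and
  linear combinations. Smooth cutoffs times polynomials lie in the domain. Their limits give
  polynomials restricted to an interval, these give bounded measurable functions on it, and
  truncation in value and in space gives all real functions in L2; real and imaginary parts finish
  the argument.\<close>

lemma neumann_domain_dense:
  assumes \<Omega>: "open \<Omega>" "convex \<Omega>" "\<Omega> \<noteq> {}" and v: "continuous_on (closure \<Omega>) v"
    and exh: "\<And>n::nat. {a n..b n} \<subseteq> \<Omega>" "\<And>x. x \<in> \<Omega> \<Longrightarrow> \<forall>\<^sub>F n in sequentially. x \<in> {a n..b n}"
    and f: "f \<in> L2 \<Omega>" and e: "e > 0"
  shows "\<exists>g h. neumann_op \<Omega> v \<nu> k g h \<and> L2_norm \<Omega> (\<lambda>x. f x - g x) < e"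
proof -
  have \<Omega>s: "\<Omega> \<in> sets lebesgue" using \<Omega>(1) by simp
  define Cl where "Cl f \<longleftrightarrow> f \<in> L2 \<Omega> \<and> (\<forall>e>0. \<exists>g h. neumann_op \<Omega> v \<nu> k g h \<and> L2_norm \<Omega> (\<lambda>x. f x - g x) < e)" for f
  have Cl_lim: "Cl w" if w: "w \<in> L2 \<Omega>" and F: "\<And>n::nat. Cl (F n)" and lim: "(\<lambda>n. L2_norm \<Omega> (\<lambda>x. w x - F n x)) \<longlonglongrightarrow> 0" for w F
    unfolding Cl_def
  proof (intro conjI w allI impI)
    fix e :: real assume e: "e > 0"
    have "\<forall>\<^sub>F n in sequentially. L2_norm \<Omega> (\<lambda>x. w x - F n x) < e / 2" using e by (intro order_tendstoD(2)[OF lim]) simp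
    then obtain n where n: "L2_norm \<Omega> (\<lambda>x. w x - F n x) < e / 2" by (auto simp: eventually_sequentially)
    obtain g h where g: "neumann_op \<Omega> v \<nu> k g h" "L2_norm \<Omega> (\<lambda>x. F n x - g x) < e / 2"
      using F[of n] e unfolding Cl_def by (meson half_gt_zero)
    have "L2_norm \<Omega> (\<lambda>x. (w x - F n x) + (F n x - g x)) \<le> L2_norm \<Omega> (\<lambda>x. w x - F n x) + L2_norm \<Omega> (\<lambda>x. F n x - g x)"
      using F[of n] neumann_op_L2[OF g(1)] by (intro L2_norm_triangle L2_diff w) (auto simp: Cl_def)
    then show "\<exists>g h. neumann_op \<Omega> v \<nu> k g h \<and> L2_norm \<Omega> (\<lambda>x. w x - g x) < e"
      using g n by (intro exI[of _ g] exI[of _ h]) simp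
  qed
  have Cl_lin: "Cl (\<lambda>x. c * w x + d * w' x)" if w: "Cl w" "Cl w'" for c d w w'
    unfolding Cl_def
  proof (intro conjI allI impI)
    have L: "w \<in> L2 \<Omega>" "w' \<in> L2 \<Omega>" using w by (auto simp: Cl_def)
    then show "(\<lambda>x. c * w x + d * w' x) \<in> L2 \<Omega>" by (intro L2_add L2_cmult)
    fix e :: real assume e: "e > 0"
    define r where "r = e / (2 * (cmod c + cmod d + 1))"
    have cd: "cmod c + cmod d + 1 > 0" using norm_ge_zero[of c] norm_ge_zero[of d] by linarith
    have r: "r > 0" using e cd by (simp add: r_def)
    obtain g h where g: "neumann_op \<Omega> v \<nu> k g h" "L2_norm \<Omega> (\<lambda>x. w x - g x) < r" using w(1) r unfolding Cl_def by meson
    obtain g' h' where g': "neumann_op \<Omega> v \<nu> k g' h'" "L2_norm \<Omega> (\<lambda>x. w' x - g' x) < r" using w(2) r unfolding Cl_def by meson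
    have "L2_norm \<Omega> (\<lambda>x. (c * w x + d * w' x) - (c * g x + d * g' x)) = L2_norm \<Omega> (\<lambda>x. c * (w x - g x) + d * (w' x - g' x))"
      by (rule arg_cong[where f="L2_norm \<Omega>"]) (auto simp: algebra_simps)
    also have "\<dots> \<le> L2_norm \<Omega> (\<lambda>x. c * (w x - g x)) + L2_norm \<Omega> (\<lambda>x. d * (w' x - g' x))"
      using neumann_op_L2[OF g(1)] neumann_op_L2[OF g'(1)] L by (intro L2_norm_triangle L2_cmult L2_diff) auto
    also have "\<dots> \<le> cmod c * r + cmod d * r"
      unfolding L2_norm_cmult using g(2) g'(2) by (intro add_mono mult_left_mono) auto
    also have "\<dots> = (cmod c + cmod d) * r" by (simp add: distrib_right)
    also have "\<dots> < (2 * (cmod c + cmod d + 1)) * r"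
      using cd by (intro mult_strict_right_mono[OF _ r]) (simp add: add_pos_nonneg)
    also have "\<dots> = e" using cd by (simp add: r_def)
    finally show "\<exists>g h. neumann_op \<Omega> v \<nu> k g h \<and> L2_norm \<Omega> (\<lambda>x. (c * w x + d * w' x) - g x) < e"
      using neumann_op_linear[OF \<Omega> v g(1) g'(1)] by blast
  qed
  have indL: "(\<lambda>x. complex_of_real (w x * indicator {a..b} x)) \<in> L2 \<Omega>"
    "integrable (lebesgue_on \<Omega>) (\<lambda>x. K * indicator {a..b} x)"
    if sub: "{a..b} \<subseteq> \<Omega>" and m: "w \<in> borel_measurable (lebesgue_on {a..b})" and K: "\<And>x. x \<in> {a..b} \<Longrightarrow> \<bar>w x\<bar> \<le> M" for a b w M and K :: real
  proof -
    have c: "integrable (lebesgue_on {a..b}) (\<lambda>x. C)" for C :: real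
      by (intro absolutely_integrable_imp_integrable absolutely_integrable_continuous_real) auto
    have i: "integrable (lebesgue_on \<Omega>) (\<lambda>x. C * indicator {a..b} x)" for C :: real
    proof -
      have "integrable (lebesgue_on \<Omega>) (\<lambda>x. C * indicator {a..b} x) \<longleftrightarrow> integrable (lebesgue_on {a..b}) (\<lambda>x. C * indicator {a..b} x)"
        by (rule lebesgue_on_zero_outside(2)) (use sub \<Omega>s in auto)
      also have "\<dots> \<longleftrightarrow> integrable (lebesgue_on {a..b}) (\<lambda>x. C)" by (rule Bochner_Integration.integrable_cong) auto
      finally show ?thesis using c by simp
    qed
    then show "integrable (lebesgue_on \<Omega>) (\<lambda>x. K * indicator {a..b} x)" .
    have "integrable (lebesgue_on {a..b}) w"
      by (rule Bochner_Integration.integrable_bound[OF c[of M] m]) (use K in \<open>auto intro!: AE_I2 intro: order_trans[OF _ abs_ge_self]\<close>)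
    then have "integrable (lebesgue_on {a..b}) (\<lambda>x. complex_of_real (w x * indicator {a..b} x))"
      by (subst Bochner_Integration.integrable_cong[OF refl, of _ _ "\<lambda>x. complex_of_real (w x)"]) auto
    moreover have "integrable (lebesgue_on \<Omega>) (\<lambda>x. complex_of_real (w x * indicator {a..b} x)) \<longleftrightarrow> integrable (lebesgue_on {a..b}) (\<lambda>x. complex_of_real (w x * indicator {a..b} x))"
      by (rule lebesgue_on_zero_outside(2)) (use sub \<Omega>s in auto)
    ultimately have "(\<lambda>x. complex_of_real (w x * indicator {a..b} x)) \<in> borel_measurable (lebesgue_on \<Omega>)" by simp
    then show "(\<lambda>x. complex_of_real (w x * indicator {a..b} x)) \<in> L2 \<Omega>"
    proof (rule L2_bound[OF _ i[of "M\<^sup>2"]])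
      show "(cmod (complex_of_real (w x * indicator {a..b} x)))\<^sup>2 \<le> M\<^sup>2 * indicator {a..b} x" for x
        using K[of x] by (auto simp: indicator_def abs_le_square_iff[symmetric] norm_mult)
    qed
  qed
  have poly: "Cl (\<lambda>x. complex_of_real (p x * indicator {a..b} x))" if p: "real_polynomial_function p" and sub: "{a..b} \<subseteq> \<Omega>" for p a b
  proof -
    have cp: "continuous_on A p" for A by (rule smooth_continuous[OF smooth_polynomial[OF p]])
    have mp: "p \<in> borel_measurable (lebesgue_on {a..b})" by (intro continuous_imp_measurable_on_sets_lebesgue cp) auto
    obtain P where P: "\<And>x. x \<in> {a..b} \<Longrightarrow> \<bar>p x\<bar> \<le> P"
      using compact_imp_bounded[OF compact_continuous_image[OF cp compact_Icc[of a b]]]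
      unfolding bounded_iff by (metis image_eqI real_norm_def)
    obtain \<theta> :: "nat \<Rightarrow> real \<Rightarrow> real" where \<theta>: "\<And>n. smooth (\<theta> n)" "\<And>n x. 0 \<le> \<theta> n x" "\<And>n x. \<theta> n x \<le> 1"
      "\<And>n x. x \<notin> {a..b} \<Longrightarrow> \<theta> n x = 0" "\<And>x. a < x \<Longrightarrow> x < b \<Longrightarrow> (\<lambda>n. \<theta> n x) \<longlonglongrightarrow> 1"
      using smooth_cutoffs[of a b] by metis
    have Cn: "Cl (\<lambda>x. complex_of_real (p x * \<theta> n x))" for n
    proof -
      obtain h where h: "neumann_op \<Omega> v \<nu> k (\<lambda>x. complex_of_real (p x * \<theta> n x)) h"
        using neumann_op_test_function[OF \<Omega> v smooth_mult[OF smooth_polynomial[OF p] \<theta>(1)] _ sub, of n \<nu> k] \<theta>(4) by auto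
      have "L2_norm \<Omega> (\<lambda>x. complex_of_real (p x * \<theta> n x) - complex_of_real (p x * \<theta> n x)) = 0" by (simp add: L2_norm_def)
      then have "\<exists>g h. neumann_op \<Omega> v \<nu> k g h \<and> L2_norm \<Omega> (\<lambda>x. complex_of_real (p x * \<theta> n x) - g x) < e" if "e > 0" for e
        using h that by (intro exI[of _ "\<lambda>x. complex_of_real (p x * \<theta> n x)"] exI[of _ h]) simp
      then show ?thesis using neumann_op_L2[OF h] unfolding Cl_def by blast
    qed
    show ?thesis
    proof (rule Cl_lim[OF indL(1)[OF sub mp P] Cn], simp)
      show "(\<lambda>n. L2_norm \<Omega> (\<lambda>x. complex_of_real (p x * indicator {a..b} x) - complex_of_real (p x * \<theta> n x))) \<longlonglongrightarrow> 0"
      proof (rule L2_norm_dominated_limit[where B="\<lambda>x. P\<^sup>2 * indicator {a..b} x"])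
        show "(\<lambda>x. complex_of_real (p x * indicator {a..b} x)) \<in> L2 \<Omega>" by (rule indL(1)[OF sub mp P])
        show "(\<lambda>x. complex_of_real (p x * \<theta> n x)) \<in> L2 \<Omega>" for n using Cn[of n] by (simp add: Cl_def)
        show "integrable (lebesgue_on \<Omega>) (\<lambda>x. P\<^sup>2 * indicator {a..b} x)" by (rule indL(2)[OF sub mp P])
        show "AE x in lebesgue_on \<Omega>. (cmod (complex_of_real (p x * indicator {a..b} x) - complex_of_real (p x * \<theta> n x)))\<^sup>2 \<le> P\<^sup>2 * indicator {a..b} x" for n
        proof (rule AE_I2)
          fix x
          show "(cmod (complex_of_real (p x * indicator {a..b} x) - complex_of_real (p x * \<theta> n x)))\<^sup>2 \<le> P\<^sup>2 * indicator {a..b} x"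
          proof (cases "x \<in> {a..b}")
            case True
            have "\<bar>p x\<bar> * \<bar>1 - \<theta> n x\<bar> \<le> P * 1" using P[OF True] \<theta>(2,3)[of n x] by (intro mult_mono) auto
            then have "\<bar>p x - p x * \<theta> n x\<bar> \<le> \<bar>P\<bar>" by (simp add: abs_mult[symmetric] right_diff_distrib)
            then have "(p x - p x * \<theta> n x)\<^sup>2 \<le> P\<^sup>2" by (simp add: abs_le_square_iff)
            then show ?thesis using True by (simp flip: of_real_mult of_real_diff)
          qed (simp add: \<theta>(4))
        qed
        have "AE x in lebesgue_on \<Omega>. x \<notin> {a, b}" by (rule finite_AE_notin[OF _ \<Omega>s]) simp
        then show "AE x in lebesgue_on \<Omega>. (\<lambda>n. complex_of_real (p x * \<theta> n x)) \<longlonglongrightarrow> complex_of_real (p x * indicator {a..b} x)"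
        proof eventually_elim
          case (elim x)
          show ?case
          proof (cases "x \<in> {a..b}")
            case True
            then have "(\<lambda>n. \<theta> n x) \<longlonglongrightarrow> 1" using elim by (intro \<theta>(5)) auto
            then have "(\<lambda>n. complex_of_real (p x * \<theta> n x)) \<longlonglongrightarrow> complex_of_real (p x * 1)" by (intro tendsto_intros)
            then show ?thesis using True by simp
          qed (simp add: \<theta>(4))
        qed
      qed
    qed
  qed
  have bdd: "Cl (\<lambda>x. complex_of_real (w x * indicator {a..b} x))"
    if m: "w \<in> borel_measurable (lebesgue_on {a..b})" and M: "\<And>x. \<bar>w x\<bar> \<le> M" and sub: "{a..b} \<subseteq> \<Omega>" for w a b M
  proof -
    obtain p where p: "\<And>n::nat. real_polynomial_function (p n)" "\<And>n x. x \<in> {a..b} \<Longrightarrow> \<bar>p n x\<bar> \<le> M + 1"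
      "AE x in lebesgue_on {a..b}. (\<lambda>n. p n x) \<longlonglongrightarrow> w x"
      using bounded_measurable_AE_limit_polynomials[OF m M] by blast
    note Cn = poly[OF p(1) sub]
    note wL = indL(1)[OF sub m M]
    show ?thesis
    proof (rule Cl_lim[OF wL Cn])
      show "(\<lambda>n. L2_norm \<Omega> (\<lambda>x. complex_of_real (w x * indicator {a..b} x) - complex_of_real (p n x * indicator {a..b} x))) \<longlonglongrightarrow> 0"
      proof (rule L2_norm_dominated_limit[where B="\<lambda>x. (2 * M + 1)\<^sup>2 * indicator {a..b} x"])
        show "(\<lambda>x. complex_of_real (w x * indicator {a..b} x)) \<in> L2 \<Omega>" by (rule wL)
        show "(\<lambda>x. complex_of_real (p n x * indicator {a..b} x)) \<in> L2 \<Omega>" for n using Cn[of n] by (simp add: Cl_def)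
        show "integrable (lebesgue_on \<Omega>) (\<lambda>x. (2 * M + 1)\<^sup>2 * indicator {a..b} x)" by (rule indL(2)[OF sub m M])
        show "AE x in lebesgue_on \<Omega>. (cmod (complex_of_real (w x * indicator {a..b} x) - complex_of_real (p n x * indicator {a..b} x)))\<^sup>2 \<le> (2 * M + 1)\<^sup>2 * indicator {a..b} x" for n
        proof (rule AE_I2)
          fix x
          show "(cmod (complex_of_real (w x * indicator {a..b} x) - complex_of_real (p n x * indicator {a..b} x)))\<^sup>2 \<le> (2 * M + 1)\<^sup>2 * indicator {a..b} x"
          proof (cases "x \<in> {a..b}")
            case True
            have "\<bar>w x - p n x\<bar> \<le> \<bar>2 * M + 1\<bar>" using M[of x] p(2)[OF True, of n] by linarith
            then have "(w x - p n x)\<^sup>2 \<le> (2 * M + 1)\<^sup>2" by (simp add: abs_le_square_iff)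
            then show ?thesis using True by (simp flip: of_real_mult of_real_diff)
          qed simp
        qed
        have "AE x in lebesgue. x \<in> {a..b} \<longrightarrow> (\<lambda>n. p n x) \<longlonglongrightarrow> w x" using p(3) by (simp add: AE_restrict_space_iff)
        then have "AE x in lebesgue. x \<in> \<Omega> \<longrightarrow> (\<lambda>n. complex_of_real (p n x * indicator {a..b} x)) \<longlonglongrightarrow> complex_of_real (w x * indicator {a..b} x)"
          by eventually_elim (auto simp: indicator_def intro!: tendsto_intros)
        then show "AE x in lebesgue_on \<Omega>. (\<lambda>n. complex_of_real (p n x * indicator {a..b} x)) \<longlonglongrightarrow> complex_of_real (w x * indicator {a..b} x)"
          using \<Omega>s by (simp add: AE_restrict_space_iff)
      qed
    qed
  qed
  have realpart: "Cl (\<lambda>x. complex_of_real (w x))" if w: "(\<lambda>x. complex_of_real (w x)) \<in> L2 \<Omega>" for w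
  proof -
    have "(\<lambda>x. Re (complex_of_real (w x))) \<in> borel_measurable (lebesgue_on \<Omega>)" using L2D(1)[OF w] by measurable
    then have wm: "w \<in> borel_measurable (lebesgue_on \<Omega>)" by simp
    define T where "T n x = max (- real n) (min (real n) (w x))" for n :: nat and x
    have Tm: "T n \<in> borel_measurable (lebesgue_on {a..b})" if "{a..b} \<subseteq> \<Omega>" for n a b
    proof -
      have [measurable]: "w \<in> borel_measurable (lebesgue_on {a..b})" using wm that measurable_restrict_mono by blast
      show ?thesis unfolding T_def[abs_def] by measurable
    qed
    have Cn: "Cl (\<lambda>x. complex_of_real (T n x * indicator {a n..b n} x))" for n
      by (rule bdd[OF Tm[OF exh(1)] _ exh(1), of n "real n"]) (auto simp: T_def)
    show ?thesis
    proof (rule Cl_lim[OF w Cn])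
      show "(\<lambda>n. L2_norm \<Omega> (\<lambda>x. complex_of_real (w x) - complex_of_real (T n x * indicator {a n..b n} x))) \<longlonglongrightarrow> 0"
      proof (rule L2_norm_dominated_limit[OF w _ L2D(2)[OF w]])
        show "(\<lambda>x. complex_of_real (T n x * indicator {a n..b n} x)) \<in> L2 \<Omega>" for n using Cn[of n] by (simp add: Cl_def)
        show "AE x in lebesgue_on \<Omega>. (cmod (complex_of_real (w x) - complex_of_real (T n x * indicator {a n..b n} x)))\<^sup>2 \<le> (cmod (complex_of_real (w x)))\<^sup>2" for n
        proof (rule AE_I2)
          fix x
          have "\<bar>w x - T n x * indicator {a n..b n} x\<bar> \<le> \<bar>w x\<bar>" by (auto simp: T_def indicator_def)
          then show "(cmod (complex_of_real (w x) - complex_of_real (T n x * indicator {a n..b n} x)))\<^sup>2 \<le> (cmod (complex_of_real (w x)))\<^sup>2"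
            by (simp add: abs_le_square_iff flip: of_real_mult of_real_diff)
        qed
        show "AE x in lebesgue_on \<Omega>. (\<lambda>n. complex_of_real (T n x * indicator {a n..b n} x)) \<longlonglongrightarrow> complex_of_real (w x)"
        proof (rule AE_I2, rule tendsto_eventually)
          fix x assume "x \<in> space (lebesgue_on \<Omega>)"
          then have "x \<in> \<Omega>" by simp
          obtain N where "\<bar>w x\<bar> \<le> real N" using real_arch_simple by blast
          then have "\<forall>\<^sub>F n in sequentially. \<bar>w x\<bar> \<le> real n" by (auto simp: eventually_sequentially intro!: exI[of _ N])
          with exh(2)[OF \<open>x \<in> \<Omega>\<close>]
          show "\<forall>\<^sub>F n in sequentially. complex_of_real (T n x * indicator {a n..b n} x) = complex_of_real (w x)"
            by eventually_elim (auto simp: T_def)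
        qed
      qed
    qed
  qed
  have fm: "f \<in> borel_measurable (lebesgue_on \<Omega>)" by (rule L2D(1)[OF f])
  have "(\<lambda>x. complex_of_real (Re (f x))) \<in> L2 \<Omega>" "(\<lambda>x. complex_of_real (Im (f x))) \<in> L2 \<Omega>"
  proof -
    note fm[measurable]
    have 1: "(cmod (complex_of_real (Re (f x))))\<^sup>2 \<le> (cmod (f x))\<^sup>2" "(cmod (complex_of_real (Im (f x))))\<^sup>2 \<le> (cmod (f x))\<^sup>2" for x
      by (auto simp: cmod_power2)
    show "(\<lambda>x. complex_of_real (Re (f x))) \<in> L2 \<Omega>" by (rule L2_bound[OF _ L2D(2)[OF f] 1(1)]) measurable
    show "(\<lambda>x. complex_of_real (Im (f x))) \<in> L2 \<Omega>" by (rule L2_bound[OF _ L2D(2)[OF f] 1(2)]) measurable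
  qed
  from Cl_lin[OF realpart[OF this(1)] realpart[OF this(2)], of 1 \<i>]
  have "Cl f" by (simp add: complex_eq[symmetric])
  then show ?thesis using e unfolding Cl_def by blast
qed

section \<open>Exponential decay\<close>

text \<open>The three kinds of domain enter the proof only through these properties. The finite
  frontier serves the count of exceptional points, arbitrarily long subintervals serve the supremum
  bound, and the exhaustion by compact intervals serves density.\<close>

lemma half_line_cases:
  fixes \<Omega> :: "real set"
  assumes "\<Omega> = UNIV \<or> (\<exists>L\<^sub>1. \<Omega> = {..<L\<^sub>1}) \<or> (\<exists>L\<^sub>2. \<Omega> = {L\<^sub>2<..})"
  shows "open \<Omega>" "convex \<Omega>" "\<Omega> \<noteq> {}" "finite (frontier \<Omega>)"
    and "\<exists>a b. a \<in> \<Omega> \<and> b \<in> \<Omega> \<and> b - a = real n"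
    and "\<exists>a b. (\<forall>n::nat. {a n..b n} \<subseteq> \<Omega>) \<and> (\<forall>x\<in>\<Omega>. \<forall>\<^sub>F n in sequentially. x \<in> {a n..b n})"
proof -
  show "open \<Omega>" "convex \<Omega>" "finite (frontier \<Omega>)" using assms by (auto intro: convex_real_interval)
  consider "\<Omega> = UNIV" | L where "\<Omega> = {..<L}" | L where "\<Omega> = {L<..}" using assms by blast
  note \<Omega> = this
  show "\<Omega> \<noteq> {}" using assms lt_ex gt_ex by (metis UNIV_not_empty empty_iff greaterThan_iff lessThan_iff)
  show "\<exists>a b. a \<in> \<Omega> \<and> b \<in> \<Omega> \<and> b - a = real n"
    using \<Omega>
  proof cases
    case 1
    then show ?thesis by (intro exI[of _ 0] exI[of _ "real n"]) auto
  next
    case (2 L)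
    then show ?thesis by (intro exI[of _ "L - 1 - real n"] exI[of _ "L - 1"]) auto
  next
    case (3 L)
    then show ?thesis by (intro exI[of _ "L + 1"] exI[of _ "L + 1 + real n"]) auto
  qed
  have big: "\<forall>\<^sub>F n in sequentially. x \<le> real n" for x :: real
  proof -
    obtain N where "x \<le> real N" using real_arch_simple by blast
    then show ?thesis by (auto simp: eventually_sequentially intro!: exI[of _ N])
  qed
  have small: "\<forall>\<^sub>F n in sequentially. 1 / real (Suc n) < e" if "e > 0" for e :: real
    using order_tendstoD(2)[OF LIMSEQ_inverse_real_of_nat that] by (simp add: inverse_eq_divide)
  show "\<exists>a b. (\<forall>n::nat. {a n..b n} \<subseteq> \<Omega>) \<and> (\<forall>x\<in>\<Omega>. \<forall>\<^sub>F n in sequentially. x \<in> {a n..b n})"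
    using \<Omega>
  proof cases
    case 1
    have "\<forall>\<^sub>F n in sequentially. x \<in> {- real n..real n}" for x :: real
      using big[of x] big[of "- x"] by eventually_elim auto
    then show ?thesis using 1 by (intro exI[of _ "\<lambda>n. - real n"] exI[of _ real]) auto
  next
    case (2 L)
    have "\<forall>\<^sub>F n in sequentially. x \<in> {- real n..L - 1 / real (Suc n)}" if "x < L" for x :: real
      using big[of "- x"] small[of "L - x"] that by (auto elim: eventually_elim2)
    moreover have "{- real n..L - 1 / real (Suc n)} \<subseteq> {..<L}" for n
    proof
      fix x assume "x \<in> {- real n..L - 1 / real (Suc n)}"
      moreover have "1 / real (Suc n) > 0" by simp
      ultimately show "x \<in> {..<L}" unfolding atLeastAtMost_iff lessThan_iff by linarith
    qed
    ultimately show ?thesis unfolding 2 by (intro exI[of _ "\<lambda>n. - real n"] exI[of _ "\<lambda>n. L - 1 / real (Suc n)"]) blast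
  next
    case (3 L)
    have "\<forall>\<^sub>F n in sequentially. x \<in> {L + 1 / real (Suc n)..real n}" if "L < x" for x :: real
      using big[of x] small[of "x - L"] that by (auto elim: eventually_elim2)
    moreover have "{L + 1 / real (Suc n)..real n} \<subseteq> {L<..}" for n
    proof
      fix x assume "x \<in> {L + 1 / real (Suc n)..real n}"
      moreover have "1 / real (Suc n) > 0" by simp
      ultimately show "x \<in> {L<..}" unfolding atLeastAtMost_iff greaterThan_iff by linarith
    qed
    ultimately show ?thesis unfolding 3 by (intro exI[of _ "\<lambda>n. L + 1 / real (Suc n)"] exI[of _ real]) blast
  qed
qed

lemma nth_deriv_on_has_derivative:
  assumes "C_on m S f" "i < m" "x \<in> S"
  shows "(nth_deriv_on S i f has_real_derivative nth_deriv_on S (Suc i) f x) (at x within S)"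
proof -
  have "nth_deriv_on S i f differentiable (at x within S)"
    using assms by (auto simp: C_on_def differentiable_on_def)
  then have "(nth_deriv_on S i f has_vector_derivative vector_derivative (nth_deriv_on S i f) (at x within S)) (at x within S)"
    by (simp add: vector_derivative_works)
  then show ?thesis by (simp add: nth_deriv_on_def has_real_derivative_iff_has_vector_derivative)
qed

lemma resolvent_lower_bound:
  fixes v :: "real \<Rightarrow> real"
  assumes \<Omega>: "open \<Omega>" "convex \<Omega>" "\<Omega> \<noteq> {}" and unb: "\<And>n::nat. \<exists>a b. a \<in> \<Omega> \<and> b \<in> \<Omega> \<and> b - a = real n"
    and v: "continuous_on (closure \<Omega>) v" and c: "c > 0"
    and level: "\<And>\<mu>. \<exists>Z. finite Z \<and> card Z \<le> N \<and> (\<forall>x\<in>\<Omega>. v x = \<mu> \<longrightarrow> x \<in> Z) \<and>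
           (\<forall>\<delta> y. 0 < \<delta> \<longrightarrow> \<delta> \<le> 1 \<longrightarrow> y \<in> \<Omega> \<longrightarrow> (\<forall>z\<in>Z. \<delta> \<le> \<bar>y - z\<bar>) \<longrightarrow> c * \<delta> ^ m \<le> \<bar>v y - \<mu>\<bar>)"
  shows "\<exists>b>0. \<forall>\<nu> k u h z. \<nu> > 0 \<longrightarrow> k \<noteq> 0 \<longrightarrow> neumann_op \<Omega> v \<nu> k u h \<longrightarrow> 0 \<le> Re z \<longrightarrow>
    b * decay_rate m \<nu> k * L2_norm \<Omega> u \<le> L2_norm \<Omega> (\<lambda>x. h x + z * u x)"
proof -
  define q where "q = 4 * real N + 1 / c + real N / c"
  have q: "q \<ge> 0" using c by (simp add: q_def)
  \<comment> \<open>This choice gives both s \<le> 1 and s q < 1, as the absorption of the three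
    error terms requires; \<open>s\<^sup>2\<close> is the constant in front of the rate.\<close>
  define s where "s = 1 / (q + 1)"
  have s: "0 < s" "s \<le> 1" "s * q < 1" using q by (auto simp: s_def divide_simps)
  have "s\<^sup>2 * decay_rate m \<nu> k * L2_norm \<Omega> u \<le> L2_norm \<Omega> (\<lambda>x. h x + z * u x)"
    if \<nu>: "\<nu> > 0" and k: "k \<noteq> 0" and op: "neumann_op \<Omega> v \<nu> k u h" and z: "0 \<le> Re z" for \<nu> k u h z
  proof -
    obtain \<delta> where \<delta>: "0 < \<delta>" "\<delta> \<le> 1" "\<delta>\<^sup>2 * decay_rate m \<nu> k \<le> \<nu>" "decay_rate m \<nu> k \<le> \<bar>k\<bar> * \<delta> ^ m"
      "\<nu> * decay_rate m \<nu> k \<le> (\<bar>k\<bar> * \<delta> ^ (m + 1))\<^sup>2" "decay_rate m \<nu> k > 0"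
      by (rule decay_rate_scale[OF \<nu> k, of m]) blast
    obtain Z where Z: "finite Z" "card Z \<le> N" "\<And>x. x \<in> \<Omega> \<Longrightarrow> v x = - Im z / k \<Longrightarrow> x \<in> Z"
      "\<And>y. y \<in> \<Omega> \<Longrightarrow> (\<forall>z\<in>Z. \<delta> \<le> \<bar>y - z\<bar>) \<Longrightarrow> c * \<delta> ^ m \<le> \<bar>v y - (- Im z / k)\<bar>"
      using level[of "- Im z / k"] \<delta>(1,2) by metis
    have "c * \<delta> ^ m > 0" using c \<delta> by simp
    from resolvent_estimate_raw[OF \<Omega> unb v op \<nu> k z \<delta>(1) this Z]
    obtain W where W: "W \<ge> 0" "\<nu> * W\<^sup>2 \<le> L2_norm \<Omega> (\<lambda>x. h x + z * u x) * L2_norm \<Omega> u"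
      "(L2_norm \<Omega> u)\<^sup>2 \<le> 4 * real N * \<delta> * (W * L2_norm \<Omega> u) + (L2_norm \<Omega> (\<lambda>x. h x + z * u x) * L2_norm \<Omega> u
         + \<nu> * (real N / \<delta>) * (W * L2_norm \<Omega> u)) / (\<bar>k\<bar> * (c * \<delta> ^ m))" by blast
    show ?thesis
      by (rule resolvent_algebra[OF L2_norm_nonneg L2_norm_nonneg W(1) of_nat_0_le_iff \<nu> _ \<delta>(1) c \<delta>(6) s(1,2) W(2,3) \<delta>(3,4,5)])
        (use k s(3) in \<open>auto simp: q_def\<close>)
  qed
  then show ?thesis using s(1) by (intro exI[of _ "s\<^sup>2"]) auto
qed

theorem theorem1p1:
  fixes \<Omega> :: "real set" and v :: "real \<Rightarrow> real" and m :: nat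
  assumes "\<Omega> = UNIV \<or> (\<exists>L\<^sub>1. \<Omega> = {..<L\<^sub>1}) \<or> (\<exists>L\<^sub>2. \<Omega> = {L\<^sub>2<..})"
    and "m \<ge> 1"
    and "C_on m (closure \<Omega>) v"
    and "\<forall>y\<in>closure \<Omega>. (\<Sum>j=1..m. \<bar>nth_deriv_on (closure \<Omega>) j v y\<bar>) > 0"
    and "\<exists>c\<^sub>0>0. Liminf (inf at_infinity (principal \<Omega>))
                  (\<lambda>y. ereal \<bar>nth_deriv_on (closure \<Omega>) 1 v y\<bar>) \<ge> ereal c\<^sub>0"
  shows "\<exists>C>0. \<exists>c>0. \<forall>\<nu>>0. \<forall>k. k \<noteq> 0 \<longrightarrow>
           (\<forall>T. neumann_semigroup \<Omega> v \<nu> k T \<longrightarrow>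
             (\<forall>g\<^sub>0\<in>L2 \<Omega>. \<forall>t\<ge>0.
                L2_norm \<Omega> (T t g\<^sub>0) \<le> C * exp (- c * decay_rate m \<nu> k * t) * L2_norm \<Omega> g\<^sub>0))"
proof -
  note \<Omega> = half_line_cases(1-3)[OF assms(1)] and unb = half_line_cases(5)[OF assms(1)]
  define D where "D j = nth_deriv_on (closure \<Omega>) j v" for j
  have D0: "D 0 = v" by (simp add: D_def nth_deriv_on_def)
  have der: "(D i has_real_derivative D (Suc i) x) (at x within closure \<Omega>)" if "i < m" "x \<in> closure \<Omega>" for i x
    unfolding D_def by (rule nth_deriv_on_has_derivative[OF assms(3) that])
  have contD: "continuous_on (closure \<Omega>) (D m)" using assms(3) by (simp add: D_def C_on_def)
  have v: "continuous_on (closure \<Omega>) v"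
    using DERIV_continuous_on[of "closure \<Omega>" "D 0" "D 1"] der[of 0] assms(2) by (simp add: D0)
  have pos: "\<exists>j\<in>{1..m}. D j y \<noteq> 0" if "y \<in> closure \<Omega>" for y
  proof (rule ccontr)
    assume "\<not> ?thesis"
    then have "(\<Sum>j=1..m. \<bar>D j y\<bar>) = 0" by (intro sum.neutral) auto
    then show False using assms(4) that by (force simp: D_def)
  qed
  obtain c\<^sub>0 where c0: "c\<^sub>0 > 0" "ereal c\<^sub>0 \<le> Liminf (inf at_infinity (principal \<Omega>)) (\<lambda>y. ereal \<bar>D 1 y\<bar>)"
    using assms(5) unfolding D_def by blast
  \<comment> \<open>A lower limit of at least \<open>c\<^sub>0\<close> only guarantees that values
    eventually exceed each smaller number, hence the half.\<close>
  have "ereal (c\<^sub>0 / 2) < ereal c\<^sub>0" using c0(1) by simp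
  then have "\<forall>\<^sub>F y in inf at_infinity (principal \<Omega>). ereal (c\<^sub>0 / 2) < ereal \<bar>D 1 y\<bar>"
    using c0(2) unfolding le_Liminf_iff by blast
  then obtain R where R: "\<And>y. R \<le> norm y \<Longrightarrow> y \<in> \<Omega> \<Longrightarrow> ereal (c\<^sub>0 / 2) < ereal \<bar>D 1 y\<bar>"
    unfolding eventually_inf_principal eventually_at_infinity by blast
  then have tail: "c\<^sub>0 / 2 \<le> \<bar>D 1 y\<bar>" if "y \<in> \<Omega>" "R \<le> \<bar>y\<bar>" for y
  proof -
    have "ereal (c\<^sub>0 / 2) < ereal \<bar>D 1 y\<bar>" by (rule R) (use that in auto)
    then have "c\<^sub>0 / 2 < \<bar>D 1 y\<bar>" by simp
    then show ?thesis by (rule less_imp_le)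
  qed
  have c2: "c\<^sub>0 / 2 > 0" using c0(1) by simp
  have "\<exists>N c. c > 0 \<and> (\<forall>\<mu>. \<exists>Z. finite Z \<and> card Z \<le> N \<and> (\<forall>x\<in>\<Omega>. D 0 x = \<mu> \<longrightarrow> x \<in> Z) \<and>
           (\<forall>\<delta> y. 0 < \<delta> \<longrightarrow> \<delta> \<le> 1 \<longrightarrow> y \<in> \<Omega> \<longrightarrow> (\<forall>z\<in>Z. \<delta> \<le> \<bar>y - z\<bar>) \<longrightarrow> c * \<delta> ^ m \<le> \<bar>D 0 y - \<mu>\<bar>))"
    by (rule level_set_exceptional_points[where R=R, OF \<Omega>(1,2) half_line_cases(4)[OF assms(1)] assms(2) der contD pos c2 tail])
  then obtain N c where c: "c > 0" and level: "\<forall>\<mu>. \<exists>Z. finite Z \<and> card Z \<le> N \<and> (\<forall>x\<in>\<Omega>. v x = \<mu> \<longrightarrow> x \<in> Z) \<and>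
           (\<forall>\<delta> y. 0 < \<delta> \<longrightarrow> \<delta> \<le> 1 \<longrightarrow> y \<in> \<Omega> \<longrightarrow> (\<forall>z\<in>Z. \<delta> \<le> \<bar>y - z\<bar>) \<longrightarrow> c * \<delta> ^ m \<le> \<bar>v y - \<mu>\<bar>)"
    unfolding D0 by (elim exE conjE) (rule that)
  from resolvent_lower_bound[OF \<Omega> unb v c level[THEN spec]]
  obtain b where b: "b > 0" and res: "\<forall>\<nu> k u h z. \<nu> > 0 \<longrightarrow> k \<noteq> 0 \<longrightarrow> neumann_op \<Omega> v \<nu> k u h \<longrightarrow> 0 \<le> Re z \<longrightarrow>
    b * decay_rate m \<nu> k * L2_norm \<Omega> u \<le> L2_norm \<Omega> (\<lambda>x. h x + z * u x)"
    by (elim exE conjE) (rule that)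
  obtain l r :: "nat \<Rightarrow> real" where exh: "\<And>n. {l n..r n} \<subseteq> \<Omega>" "\<And>x. x \<in> \<Omega> \<Longrightarrow> \<forall>\<^sub>F n in sequentially. x \<in> {l n..r n}"
    using half_line_cases(6)[OF assms(1)] by blast
  have "L2_norm \<Omega> (T t g\<^sub>0) \<le> sqrt (5 / 4) * exp (- (ln (5 / 4) / 12 * b) * decay_rate m \<nu> k * t) * L2_norm \<Omega> g\<^sub>0"
    if \<nu>: "\<nu> > 0" and k: "k \<noteq> 0" and T: "neumann_semigroup \<Omega> v \<nu> k T" and g0: "g\<^sub>0 \<in> L2 \<Omega>" and t: "t \<ge> 0" for \<nu> k T g\<^sub>0 t
  proof -
    have sg: "contraction_semigroup \<Omega> T" and gen: "\<And>f h. generator \<Omega> T f h \<longleftrightarrow> neumann_op \<Omega> v \<nu> k f (\<lambda>x. - h x)"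
      using T by (auto simp: neumann_semigroup_def)
    define \<Psi> where "\<Psi> = b * decay_rate m \<nu> k"
    have "decay_rate m \<nu> k > 0" by (rule decay_rate_scale[OF \<nu> k, of m])
    then have \<Psi>: "\<Psi> > 0" using b by (simp add: \<Psi>_def)
    have dense: "\<exists>g q. generator \<Omega> T g q \<and> L2_norm \<Omega> (\<lambda>x. f x - g x) < e" if "f \<in> L2 \<Omega>" "e > 0" for f e
    proof -
      have "\<exists>g h. neumann_op \<Omega> v \<nu> k g h \<and> L2_norm \<Omega> (\<lambda>x. f x - g x) < e"
        by (rule neumann_domain_dense[OF \<Omega> v exh that])
      then obtain g h where gh: "neumann_op \<Omega> v \<nu> k g h" "L2_norm \<Omega> (\<lambda>x. f x - g x) < e" by blast
      have "generator \<Omega> T g (\<lambda>x. - h x)" unfolding gen using gh(1) by simp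
      then show ?thesis using gh(2) by blast
    qed
    have decay: "5 * (L2_norm \<Omega> (T (6 / \<Psi>) g))\<^sup>2 \<le> 4 * (L2_norm \<Omega> g)\<^sup>2" if g: "generator \<Omega> T g q" for g q
    proof (rule semigroup_decay_generator_domain[where Rel="neumann_op \<Omega> v \<nu> k", OF sg _ _ _ _ \<Psi> g])
      show "neumann_op \<Omega> v \<nu> k f (\<lambda>x. - h x)" if "generator \<Omega> T f h" for f h using that gen by simp
      show "neumann_op \<Omega> v \<nu> k (\<lambda>x. \<Sum>n<N. a n * f n x) (\<lambda>x. \<Sum>n<N. a n * h n x)"
        if "\<And>n::nat. n < N \<Longrightarrow> neumann_op \<Omega> v \<nu> k (f n) (h n)" for N a f h
        by (rule neumann_op_sum[OF \<Omega> v that])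
      show "\<Psi> * L2_norm \<Omega> f \<le> L2_norm \<Omega> (\<lambda>x. h x + z * f x)" if "neumann_op \<Omega> v \<nu> k f h" "0 \<le> Re z" for f h z
        unfolding \<Psi>_def by (rule res[rule_format, OF \<nu> k that])
    qed (rule neumann_op_L2)
    show ?thesis using semigroup_exponential_decay[OF sg \<Psi> dense decay g0 t] by (simp add: \<Psi>_def mult_ac)
  qed
  then show ?thesis using b
    by (intro exI[of _ "sqrt (5 / 4)"] conjI exI[of _ "ln (5 / 4) / 12 * b"]) auto
qed

end
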